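(* Let $(\mathcal{A},\varphi)$ be a tracial noncommutative probability space with universal enveloping traffic space $(\mathcal{B},\psi)$. For any $t\in\mathcal{B}$ there exists a graph polynomial of trees $\mathbf{T}(t)$, i.e. a linear combination of classes of graph monomials whose underlying undirected multigraphs are trees, such that $\mathbf{T}(t)\equiv t\pmod\psi$.
   Context: $(\mathcal{A},\varphi)$: unital complex algebra with unital tracial linear functional; free cumulants $\kappa_n$ determined by $\varphi(a_1\cdots a_n)=\sum_{\pi\in NC(n)}\prod_{B\in\pi}\kappa_{|B|}[(a_i)_{i\in B}]$. A graph monomial in $\mathcal{A}$ is a finite connected directed multigraph (loops, parallel edges allowed) with distinguished, not necessarily distinct, vertices $v_{\mathrm{in}},v_{\mathrm{out}}$ and edge labels in $\mathcal{A}$, up to isomorphism. $\iota(a)$: two vertices, one edge from $v_{\mathrm{in}}$ to $v_{\mathrm{out}}$ labelled $a$. Substitution $Z_g(t_1,\dots,t_K)$ for a connected bi-rooted multidigraph $g$ with ordered edges $e_1,\dots,e_K$ replaces each $e_i$ by a copy of $t_i$, identifying $\mathrm{src}(e_i)$ with the input and $\mathrm{tgt}(e_i)$ with the output of $t_i$; the product $t_1t_2$ identifies the input of $t_1$ with the output of $t_2$. $\mathcal{B}=\mathcal{G}(\mathcal{A})$ is the span of graph monomials modulo the span of $Z_g(\iota(a_1),\dots,\iota(a_K))-Z_g(P(\iota(b_1),\dots,\iota(b_n)),\iota(a_2),\dots)$ (any edge position) for $a_1=P(b_1,\dots,b_n)$, $P$ a noncommutative polynomial. Test graphs: finite connected directed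 multigraphs with labels in $\mathcal{A}$; $T^\pi$ identifies vertices in blocks. Cactus: connected multigraph with each edge in exactly one simple cycle (loops, pairs of parallel edges count); pads = cycles; oriented cactus: pads directed. $\tau^0_\varphi[T]=\prod_{C\in\mathrm{Pads}(T)}\kappa_{n_C}[\gamma(e_1),\dots,\gamma(e_{n_C})]$ for oriented cacti (edges listed with $\mathrm{src}(e_i)=\mathrm{tgt}(e_{i+1})$, indices mod $n_C$), else $0$; $\tau_\varphi[T]=\sum_\pi\tau^0_\varphi[T^\pi]$. $\psi(t)=\tau_\varphi[\tilde\Delta(t)]$ with $\tilde\Delta(t)$ identifying input and output and forgetting roots. $s\equiv t\pmod\psi$ means $\psi((s-t)u)=0$ for all $u\in\mathcal{B}$. *)

theory Defs
  imports Complex_Main "HOL-Library.Disjoint_Sets"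
begin

section \<open>The algebra: a unital complex algebra, given by a ring with a complex scalar action\<close>

definition complex_algebra :: "(complex \<Rightarrow> 'a::ring_1 \<Rightarrow> 'a) \<Rightarrow> bool" where
  "complex_algebra sm \<longleftrightarrow>
     (\<forall>x. sm 1 x = x) \<and>
     (\<forall>c d x. sm (c * d) x = sm c (sm d x)) \<and>
     (\<forall>c d x. sm (c + d) x = sm c x + sm d x) \<and>
     (\<forall>c x y. sm c (x + y) = sm c x + sm c y) \<and>
     (\<forall>c x y. sm c (x * y) = sm c x * y) \<and>
     (\<forall>c x y. sm c (x * y) = x * sm c y)"

definition tracial_state :: "(complex \<Rightarrow> 'a::ring_1 \<Rightarrow> 'a) \<Rightarrow> ('a \<Rightarrow> complex) \<Rightarrow> bool" where
  "tracial_state sm \<phi> \<longleftrightarrow>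
     (\<forall>x y. \<phi> (x + y) = \<phi> x + \<phi> y) \<and>
     (\<forall>c x. \<phi> (sm c x) = c * \<phi> x) \<and>
     \<phi> 1 = 1 \<and>
     (\<forall>x y. \<phi> (x * y) = \<phi> (y * x))"

section \<open>Free cumulants\<close>

definition noncrossing :: "nat set set \<Rightarrow> bool" where
  "noncrossing P \<longleftrightarrow> (\<forall>B1\<in>P. \<forall>B2\<in>P. B1 \<noteq> B2 \<longrightarrow>
      \<not> (\<exists>a b c d. a < b \<and> b < c \<and> c < d \<and> a \<in> B1 \<and> c \<in> B1 \<and> b \<in> B2 \<and> d \<in> B2))"

definition NC :: "nat \<Rightarrow> nat set set set" where
  "NC n = {P. partition_on {0..<n} P \<and> noncrossing P}"

text \<open>kappa phi [a1,...,an] is the free cumulant; it is the unique function on nonempty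
  lists satisfying the moment-cumulant formula (normalised to 0 on the empty list).\<close>
definition free_cumulant :: "('a::ring_1 \<Rightarrow> complex) \<Rightarrow> 'a list \<Rightarrow> complex" where
  "free_cumulant \<phi> = (THE k. k [] = 0 \<and>
      (\<forall>as. as \<noteq> [] \<longrightarrow> \<phi> (prod_list as) = (\<Sum>P\<in>NC (length as). \<Prod>B\<in>P. k (nths as B))))"

section \<open>Test graphs (edge list of (source, target, label))\<close>

definition esrc :: "('v \<times> 'v \<times> 'a) list \<Rightarrow> nat \<Rightarrow> 'v" where
  "esrc E j = fst (E ! j)"
definition etgt :: "('v \<times> 'v \<times> 'a) list \<Rightarrow> nat \<Rightarrow> 'v" where
  "etgt E j = fst (snd (E ! j))"
definition elab :: "('v \<times> 'v \<times> 'a) list \<Rightarrow> nat \<Rightarrow> 'a" where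
  "elab E j = snd (snd (E ! j))"

definition uadj :: "('v \<times> 'v \<times> 'a) list \<Rightarrow> ('v \<times> 'v) set" where
  "uadj E = {(esrc E j, etgt E j) | j. j < length E} \<union> {(etgt E j, esrc E j) | j. j < length E}"

text \<open>Finite connected (directed multi)graph with vertex set V and edge list E.\<close>
definition connected_graph :: "'v set \<Rightarrow> ('v \<times> 'v \<times> 'a) list \<Rightarrow> bool" where
  "connected_graph V E \<longleftrightarrow> finite V \<and> V \<noteq> {} \<and>
     (\<forall>j<length E. esrc E j \<in> V \<and> etgt E j \<in> V) \<and>
     (\<forall>u\<in>V. \<forall>w\<in>V. (u, w) \<in> (uadj E)\<^sup>*)"

text \<open>Simple (undirected) cycle: distinct edges es!i joining distinct vertices vs!i and
  vs!(i+1 mod k); k = 1 are loops, k = 2 pairs of parallel edges.\<close>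
definition ucycle :: "('v \<times> 'v \<times> 'a) list \<Rightarrow> nat list \<Rightarrow> 'v list \<Rightarrow> bool" where
  "ucycle E es vs \<longleftrightarrow> es \<noteq> [] \<and> length vs = length es \<and> distinct es \<and> distinct vs \<and>
     (\<forall>i<length es. es ! i < length E \<and>
        ((esrc E (es ! i) = vs ! i \<and> etgt E (es ! i) = vs ! ((i + 1) mod length es)) \<or>
         (etgt E (es ! i) = vs ! i \<and> esrc E (es ! i) = vs ! ((i + 1) mod length es))))"

definition pads :: "('v \<times> 'v \<times> 'a) list \<Rightarrow> nat set set" where
  "pads E = {set es | es. \<exists>vs. ucycle E es vs}"

definition cactus :: "'v set \<Rightarrow> ('v \<times> 'v \<times> 'a) list \<Rightarrow> bool" where
  "cactus V E \<longleftrightarrow> connected_graph V E \<and> (\<forall>j<length E. \<exists>!C. C \<in> pads E \<and> j \<in> C)"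

text \<open>Directed enumeration of a pad: src(e_i) = tgt(e_(i+1)), indices mod n.\<close>
definition dir_enum :: "('v \<times> 'v \<times> 'a) list \<Rightarrow> nat set \<Rightarrow> nat list \<Rightarrow> bool" where
  "dir_enum E C es \<longleftrightarrow> es \<noteq> [] \<and> distinct es \<and> set es = C \<and>
     (\<forall>i<length es. esrc E (es ! i) = etgt E (es ! ((i + 1) mod length es)))"

definition oriented_cactus :: "'v set \<Rightarrow> ('v \<times> 'v \<times> 'a) list \<Rightarrow> bool" where
  "oriented_cactus V E \<longleftrightarrow> cactus V E \<and> (\<forall>C\<in>pads E. \<exists>es. dir_enum E C es)"

definition tau0 :: "('a::ring_1 \<Rightarrow> complex) \<Rightarrow> 'v set \<Rightarrow> ('v \<times> 'v \<times> 'a) list \<Rightarrow> complex" where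
  "tau0 \<phi> V E = (if oriented_cactus V E
      then (\<Prod>C\<in>pads E. free_cumulant \<phi> (map (elab E) (SOME es. dir_enum E C es)))
      else 0)"

definition blk :: "'v set set \<Rightarrow> 'v \<Rightarrow> 'v set" where
  "blk P v = (THE B. B \<in> P \<and> v \<in> B)"

text \<open>T^pi: vertices identified along the blocks of pi.\<close>
definition quot_edges :: "'v set set \<Rightarrow> ('v \<times> 'v \<times> 'a) list \<Rightarrow> ('v set \<times> 'v set \<times> 'a) list" where
  "quot_edges P E = map (\<lambda>(s, t, a). (blk P s, blk P t, a)) E"

definition tau :: "('a::ring_1 \<Rightarrow> complex) \<Rightarrow> 'v set \<Rightarrow> ('v \<times> 'v \<times> 'a) list \<Rightarrow> complex" where
  "tau \<phi> V E = (\<Sum>P\<in>{P. partition_on V P}. tau0 \<phi> P (quot_edges P E))"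

section \<open>Graph monomials and graph polynomials\<close>

text \<open>(vertex set, edge list, v_in, v_out)\<close>
type_synonym 'a gmon = "nat set \<times> (nat \<times> nat \<times> 'a) list \<times> nat \<times> nat"

definition is_gmon :: "'a gmon \<Rightarrow> bool" where
  "is_gmon g = (case g of (V, E, vi, vo) \<Rightarrow> connected_graph V E \<and> vi \<in> V \<and> vo \<in> V)"

text \<open>Underlying undirected multigraph is a tree: connected and without simple cycles
  (in particular without loops and parallel edges).\<close>
definition is_tree_gmon :: "'a gmon \<Rightarrow> bool" where
  "is_tree_gmon g = (case g of (V, E, vi, vo) \<Rightarrow>
      connected_graph V E \<and> \<not> (\<exists>es vs. ucycle E es vs))"

definition relabel :: "(nat \<Rightarrow> nat) \<Rightarrow> (nat \<times> nat \<times> 'a) list \<Rightarrow> (nat \<times> nat \<times> 'a) list" where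
  "relabel f E = map (\<lambda>(s, t, a). (f s, f t, a)) E"

text \<open>Product t1 t2: input of t1 identified with output of t2; input is that of t2,
  output that of t1.\<close>
definition gmon_mult :: "'a gmon \<Rightarrow> 'a gmon \<Rightarrow> 'a gmon" where
  "gmon_mult g h = (case g of (V1, E1, i1, o1) \<Rightarrow> case h of (V2, E2, i2, o2) \<Rightarrow>
      (let f1 = (\<lambda>v. 2 * v); f2 = (\<lambda>v. if v = o2 then 2 * i1 else 2 * v + 1)
       in (f1 ` V1 \<union> f2 ` V2, relabel f1 E1 @ relabel f2 E2, f2 i2, f1 o1)))"

text \<open>Delta-tilde: identify input and output, forget the roots.\<close>
definition delta_vertices :: "'a gmon \<Rightarrow> nat set" where
  "delta_vertices g = (case g of (V, E, vi, vo) \<Rightarrow> (\<lambda>v. if v = vo then vi else v) ` V)"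
definition delta_edges :: "'a gmon \<Rightarrow> (nat \<times> nat \<times> 'a) list" where
  "delta_edges g = (case g of (V, E, vi, vo) \<Rightarrow> relabel (\<lambda>v. if v = vo then vi else v) E)"

definition psi_mon :: "('a::ring_1 \<Rightarrow> complex) \<Rightarrow> 'a gmon \<Rightarrow> complex" where
  "psi_mon \<phi> g = tau \<phi> (delta_vertices g) (delta_edges g)"

text \<open>Graph polynomials: finite formal complex linear combinations of graph monomials.\<close>
type_synonym 'a gpoly = "(complex \<times> 'a gmon) list"

definition is_gpoly :: "'a gpoly \<Rightarrow> bool" where
  "is_gpoly p \<longleftrightarrow> (\<forall>(c, g) \<in> set p. is_gmon g)"

definition is_tree_gpoly :: "'a gpoly \<Rightarrow> bool" where
  "is_tree_gpoly p \<longleftrightarrow> (\<forall>(c, g) \<in> set p. is_gmon g \<and> is_tree_gmon g)"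

definition gp_mult :: "'a gpoly \<Rightarrow> 'a gpoly \<Rightarrow> 'a gpoly" where
  "gp_mult p q = concat (map (\<lambda>(c, g). map (\<lambda>(d, h). (c * d, gmon_mult g h)) q) p)"

definition gp_diff :: "'a gpoly \<Rightarrow> 'a gpoly \<Rightarrow> 'a gpoly" where
  "gp_diff p q = p @ map (\<lambda>(c, g). (- c, g)) q"

definition psi :: "('a::ring_1 \<Rightarrow> complex) \<Rightarrow> 'a gpoly \<Rightarrow> complex" where
  "psi \<phi> p = sum_list (map (\<lambda>(c, g). c * psi_mon \<phi> g) p)"

definition cong_psi :: "('a::ring_1 \<Rightarrow> complex) \<Rightarrow> 'a gpoly \<Rightarrow> 'a gpoly \<Rightarrow> bool" where
  "cong_psi \<phi> s t \<longleftrightarrow> (\<forall>u. is_gpoly u \<longrightarrow> psi \<phi> (gp_mult (gp_diff s t) u) = 0)"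

end

theory Submission
  imports Defs
begin

text \<open>
  Fix a graph monomial \<open>g\<close> and a test monomial \<open>h\<close>. Grouping the quotients of \<open>\<Delta>(gh)\<close> by the partition
  they induce on the vertices of \<open>g\<close> writes \<open>\<psi>(gh)\<close> as a sum, over the quotients \<open>g'\<close> of \<open>g\<close>, of
  contributions \<open>\<psi>\<^sub>i(g', h)\<close> in which no two vertices of \<open>g'\<close> are identified. In such a quotient every
  simple cycle of \<open>g'\<close> survives as a pad. If \<open>g'\<close> has a cycle \<open>C\<close>, then removing \<open>C\<close> from an oriented
  cactus leaves the vertices of \<open>C\<close> in different components, so \<open>\<psi>\<^sub>i(g', h)\<close> either vanishes for all
  \<open>h\<close> or is a constant, not depending on \<open>h\<close>, times \<open>\<psi>\<^sub>i(g\<^sub>1, h)\<close>, where \<open>g\<^sub>1\<close> is the component of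
  \<open>g' - C\<close> containing the roots. If \<open>g'\<close> is a tree, then \<open>\<psi>\<^sub>i(g', h)\<close> is \<open>\<psi>(g'h)\<close> minus
  contributions of proper quotients of \<open>g'\<close>. Induction on the number of vertices and edges expresses
  every \<open>\<psi>\<^sub>i(g', \<cdot>)\<close>, hence \<open>\<psi>(g \<cdot>)\<close>, through trees.
\<close>


section \<open>Free cumulants\<close>

text \<open>The congruence is tested by multiplying on the right, so a polynomial matters only
  through the functional sending \<open>h\<close> to \<open>\<psi>(th)\<close>; the obstacle is that
  the trees must be found before \<open>h\<close> is known. What helps is the rigidity of cactuses:
  if two vertices of a pad were joined outside it, an edge of the pad would lie in two simple
  cycles. As \<open>h\<close> is connected and attached at both roots, it can touch only one
  component left by deleting the pad, and the other components contribute a scalar. Passing to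
  injective quotients is essential, because a general quotient may pinch a cycle of
  \<open>g\<close>, which then need not become a pad. The trace property makes the weight of a pad
  independent of the edge at which its enumeration starts, hence invariant under the many
  re-encodings of graphs. Since deleting a cycle leaves an arbitrary set of edges, the combinatorics
  is done for edge sets with endpoint and label functions; edge lists return only at the boundary
  with the definitions.\<close>

lemma finite_NC: "finite (NC n)"
  by (rule finite_subset[OF _ finitely_many_partition_on[of "{0..<n}"]]) (auto simp: NC_def)

lemma full_in_NC: "0 < n \<Longrightarrow> {{0..<n}} \<in> NC n"
  by (auto simp: NC_def noncrossing_def partition_on_def disjoint_def)

lemma NC_block_subset: "P \<in> NC n \<Longrightarrow> B \<in> P \<Longrightarrow> B \<subseteq> {0..<n}"
  by (auto simp: NC_def partition_on_def)

lemma NC_block_nonempty: "P \<in> NC n \<Longrightarrow> B \<in> P \<Longrightarrow> B \<noteq> {}"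
  by (auto simp: NC_def partition_on_def)

text \<open>Blocks are disjoint and nonempty, so a block filling the interval would be the only one.
  Hence every partition but the one-block one involves only shorter sublists, which founds the
  recursions on length below.\<close>

lemma NC_block_proper:
  assumes "P \<in> NC n" "P \<noteq> {{0..<n}}" "B \<in> P"
  shows "B \<subset> {0..<n}"
proof -
  have "B \<noteq> {0..<n}"
  proof
    assume B: "B = {0..<n}"
    have "C = B" if "C \<in> P" for C
    proof (rule ccontr)
      assume "C \<noteq> B"
      then have "C \<inter> B = {}" using that assms by (auto simp: NC_def partition_on_def disjoint_def)
      moreover have "C \<subseteq> B" "C \<noteq> {}"
        using NC_block_subset[OF assms(1) that] NC_block_nonempty[OF assms(1) that] B by auto
      ultimately show False by auto
    qed
    then have "P = {B}" using assms(3) by blast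
    then show False using assms(2) B by simp
  qed
  then show ?thesis using NC_block_subset[OF assms(1,3)] by auto
qed

lemma length_nths_proper:
  assumes "B \<subset> {0..<length as}"
  shows "length (nths as B) < length as"
proof -
  have "{i. i < length as \<and> i \<in> B} = B" using assms by auto
  then show ?thesis using psubset_card_mono[OF _ assms] by (simp add: length_nths)
qed

section \<open>Existence and uniqueness of free cumulants\<close>

definition moment_cumulant :: "('a::ring_1 \<Rightarrow> complex) \<Rightarrow> ('a list \<Rightarrow> complex) \<Rightarrow> bool" where
  "moment_cumulant \<phi> k \<longleftrightarrow> k [] = 0 \<and>
     (\<forall>as. as \<noteq> [] \<longrightarrow> \<phi> (prod_list as) = (\<Sum>P\<in>NC (length as). \<Prod>B\<in>P. k (nths as B)))"

text \<open>The one-block partition contributes \<open>k as\<close> itself, so the moment-cumulant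
  formula can be solved for \<open>k as\<close> in terms of shorter lists.\<close>

lemma moment_cumulant_split:
  assumes "as \<noteq> []"
  shows "(\<Sum>P\<in>NC (length as). \<Prod>B\<in>P. k (nths as B)) =
    k as + (\<Sum>P\<in>NC (length as) - {{{0..<length as}}}. \<Prod>B\<in>P. k (nths as B) :: complex)"
proof -
  have "{{0..<length as}} \<in> NC (length as)" using assms by (intro full_in_NC) auto
  then show ?thesis
    by (subst sum.remove[OF finite_NC]) (auto simp: nths_all)
qed

text \<open>Solves the formula recursively. The sublists \<open>nths as B\<close> are no structural
  subterms, so the first argument serves as fuel; any amount of at least the length gives the same
  value.\<close>

fun cumulant_rec :: "('a::ring_1 \<Rightarrow> complex) \<Rightarrow> nat \<Rightarrow> 'a list \<Rightarrow> complex" where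
  "cumulant_rec \<phi> 0 as = 0"
| "cumulant_rec \<phi> (Suc n) as = (if as = [] then 0 else \<phi> (prod_list as) -
     (\<Sum>P\<in>NC (length as) - {{{0..<length as}}}. \<Prod>B\<in>P. cumulant_rec \<phi> n (nths as B)))"

lemma cumulant_rec_fuel:
  "length as \<le> n \<Longrightarrow> length as \<le> m \<Longrightarrow> cumulant_rec \<phi> n as = cumulant_rec \<phi> m as"
proof (induction n arbitrary: as m)
  case 0
  then show ?case by (cases m) auto
next
  case (Suc n)
  show ?case
  proof (cases "as = []")
    case True
    then show ?thesis by (cases m) auto
  next
    case False
    then obtain m' where m: "m = Suc m'" using Suc.prems by (cases m) auto
    have "cumulant_rec \<phi> n (nths as B) = cumulant_rec \<phi> m' (nths as B)"
      if "P \<in> NC (length as) - {{{0..<length as}}}" "B \<in> P" for P B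
    proof -
      have "length (nths as B) < length as"
        using that NC_block_proper by (intro length_nths_proper) blast
      then show ?thesis using Suc.prems m by (intro Suc.IH) auto
    qed
    then show ?thesis using False unfolding m cumulant_rec.simps
      by (auto intro!: sum.cong prod.cong)
  qed
qed

lemma moment_cumulant_exists:
  "moment_cumulant \<phi> (\<lambda>as. cumulant_rec \<phi> (length as) as)"
  unfolding moment_cumulant_def
proof (intro conjI allI impI)
  fix as :: "'a list" assume ne: "as \<noteq> []"
  then obtain n where n: "length as = Suc n" by (cases as) auto
  have "cumulant_rec \<phi> n (nths as B) = cumulant_rec \<phi> (length (nths as B)) (nths as B)"
    if "P \<in> NC (length as) - {{{0..<length as}}}" "B \<in> P" for P B
  proof -
    have "length (nths as B) < length as"
      using that NC_block_proper by (intro length_nths_proper) blast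
    then show ?thesis using n by (intro cumulant_rec_fuel) auto
  qed
  then have "cumulant_rec \<phi> (length as) as = \<phi> (prod_list as) -
     (\<Sum>P\<in>NC (length as) - {{{0..<length as}}}.
        \<Prod>B\<in>P. cumulant_rec \<phi> (length (nths as B)) (nths as B))"
    using ne unfolding n cumulant_rec.simps by (auto intro!: sum.cong prod.cong)
  then show "\<phi> (prod_list as) = (\<Sum>P\<in>NC (length as). \<Prod>B\<in>P.
      cumulant_rec \<phi> (length (nths as B)) (nths as B))"
    using moment_cumulant_split[OF ne, of "\<lambda>as. cumulant_rec \<phi> (length as) as"] by simp
qed simp

lemma moment_cumulant_unique:
  assumes "moment_cumulant \<phi> k" "moment_cumulant \<phi> k'"
  shows "k as = k' as"
proof (induction as rule: length_induct)
  case (1 as)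
  show ?case
  proof (cases "as = []")
    case True
    then show ?thesis using assms by (simp add: moment_cumulant_def)
  next
    case False
    have "k (nths as B) = k' (nths as B)"
      if "P \<in> NC (length as) - {{{0..<length as}}}" "B \<in> P" for P B
    proof -
      have "length (nths as B) < length as"
        using that NC_block_proper by (intro length_nths_proper) blast
      then show ?thesis using 1 by blast
    qed
    then have "(\<Sum>P\<in>NC (length as) - {{{0..<length as}}}. \<Prod>B\<in>P. k (nths as B)) =
        (\<Sum>P\<in>NC (length as) - {{{0..<length as}}}. \<Prod>B\<in>P. k' (nths as B))"
      by (intro sum.cong prod.cong) auto
    moreover have "\<phi> (prod_list as) = k as + (\<Sum>P\<in>NC (length as) - {{{0..<length as}}}. \<Prod>B\<in>P. k (nths as B))"
      using assms(1) False moment_cumulant_split[OF False, of k] by (simp add: moment_cumulant_def)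
    moreover have "\<phi> (prod_list as) = k' as + (\<Sum>P\<in>NC (length as) - {{{0..<length as}}}. \<Prod>B\<in>P. k' (nths as B))"
      using assms(2) False moment_cumulant_split[OF False, of k'] by (simp add: moment_cumulant_def)
    ultimately show ?thesis by simp
  qed
qed

text \<open>Existence and uniqueness give the definite description in \<open>free_cumulant\<close>
  its meaning, so it satisfies its own defining formula.\<close>

lemma moment_cumulant_free_cumulant: "moment_cumulant \<phi> (free_cumulant \<phi>)"
proof -
  have "\<exists>!k. moment_cumulant \<phi> k"
    using moment_cumulant_exists[of \<phi>] moment_cumulant_unique[of \<phi>] by (intro ex_ex1I) blast+
  then have "moment_cumulant \<phi> (THE k. moment_cumulant \<phi> k)" by (rule theI')
  moreover have "free_cumulant \<phi> = (THE k. moment_cumulant \<phi> k)"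
    unfolding free_cumulant_def moment_cumulant_def ..
  ultimately show ?thesis by simp
qed

section \<open>Cyclic invariance of the free cumulants of a trace\<close>

definition cyc_pred :: "nat \<Rightarrow> nat \<Rightarrow> nat" where
  "cyc_pred m j = (if j = 0 then m else j - 1)"

lemma cyc_pred_bij: "bij_betw (cyc_pred m) {0..<Suc m} {0..<Suc m}"
  by (rule bij_betw_byWitness[where f' = "\<lambda>j. if j = m then 0 else Suc j"])
     (auto simp: cyc_pred_def)

lemma mem_cyc_pred_image:
  assumes "B \<subseteq> {0..<Suc m}"
  shows "j \<in> cyc_pred m ` B \<longleftrightarrow> j \<le> m \<and> (if j = m then 0 else Suc j) \<in> B"
proof
  assume "j \<in> cyc_pred m ` B"
  then obtain x where "x \<in> B" "j = cyc_pred m x" by auto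
  moreover have "x \<le> m" using assms \<open>x \<in> B\<close> by auto
  ultimately show "j \<le> m \<and> (if j = m then 0 else Suc j) \<in> B"
    by (cases x) (auto simp: cyc_pred_def)
next
  assume j: "j \<le> m \<and> (if j = m then 0 else Suc j) \<in> B"
  then have "j = cyc_pred m (if j = m then 0 else Suc j)" by (auto simp: cyc_pred_def)
  then show "j \<in> cyc_pred m ` B" using j by blast
qed

text \<open>\<open>cyc_pred\<close> follows the entries under \<open>rotate1\<close>: the first goes
  to the end, the others move down by one. The order within a sublist is kept unless it contains the
  first entry, and such a sublist is itself rotated.\<close>

lemma nths_rotate1:
  assumes "B \<subseteq> {0..<Suc (length xs)}"
  shows "nths (xs @ [x]) (cyc_pred (length xs) ` B) =
    (if 0 \<in> B then rotate1 (nths (x # xs) B) else nths (x # xs) B)"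
proof -
  have *: "i \<in> cyc_pred (length xs) ` B \<longleftrightarrow> Suc i \<in> B" if "i < length xs" for i
    using that mem_cyc_pred_image[OF assms, of i] by simp
  have "nths xs (cyc_pred (length xs) ` B) = nths xs {j. Suc j \<in> B}"
    unfolding nths_def
  proof (intro arg_cong[where f = "map fst"] filter_cong refl)
    fix p assume "p \<in> set (zip xs [0..<length xs])"
    then have "snd p < length xs" by (auto simp: set_zip)
    then show "snd p \<in> cyc_pred (length xs) ` B \<longleftrightarrow> snd p \<in> {j. Suc j \<in> B}"
      using * by simp
  qed
  moreover have "length xs \<in> cyc_pred (length xs) ` B \<longleftrightarrow> 0 \<in> B"
    using mem_cyc_pred_image[OF assms, of "length xs"] by simp
  ultimately show ?thesis by (simp add: nths_append nths_Cons)
qed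

text \<open>Being noncrossing is a property of points on a circle. A crossing
  \<open>a < b < c < d\<close> of the rotated partition pulls back along the successor; only
  \<open>d\<close> can wrap round, to \<open>0\<close>, and then
  \<open>0 < Suc a < Suc b < Suc c\<close> is a crossing with the roles of the two blocks
  exchanged.\<close>

lemma NC_cyc_pred:
  assumes P: "P \<in> NC (Suc m)"
  shows "(`) (cyc_pred m) ` P \<in> NC (Suc m)"
proof -
  define \<sigma> where "\<sigma> = cyc_pred m"
  have inj: "inj_on \<sigma> {0..<Suc m}" and img: "\<sigma> ` {0..<Suc m} = {0..<Suc m}"
    using cyc_pred_bij[of m] by (auto simp: bij_betw_def \<sigma>_def)
  have part: "partition_on {0..<Suc m} P" and nc: "noncrossing P"
    using P by (auto simp: NC_def)
  have 1: "partition_on {0..<Suc m} ((`) \<sigma> ` P)"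
  proof -
    have "{} \<notin> (`) \<sigma> ` P" using partition_onD3[OF part] by auto
    then show ?thesis using partition_on_inj_image[OF part inj] by (simp add: img)
  qed
  have mem: "j \<in> \<sigma> ` B \<longleftrightarrow> j \<le> m \<and> (if j = m then 0 else Suc j) \<in> B" if "B \<in> P" for j B
    unfolding \<sigma>_def by (rule mem_cyc_pred_image[OF NC_block_subset[OF P that]])
  have ncD: False if "B1 \<in> P" "B2 \<in> P" "B1 \<noteq> B2" "a < b" "b < c" "c < d" "a \<in> B1" "c \<in> B1" "b \<in> B2" "d \<in> B2"
    for B1 B2 a b c d
    using nc[unfolded noncrossing_def, rule_format, OF that(1-3)] that(4-) by blast
  have "noncrossing ((`) \<sigma> ` P)"
    unfolding noncrossing_def
  proof (intro ballI impI notI, elim exE conjE imageE)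
    fix B1' B2' a b c d C1 C2
    assume ne: "B1' \<noteq> B2'" and ord: "a < b" "b < c" "c < d"
      and m: "a \<in> B1'" "c \<in> B1'" "b \<in> B2'" "d \<in> B2'"
      and C: "B1' = \<sigma> ` C1" "C1 \<in> P" "B2' = \<sigma> ` C2" "C2 \<in> P"
    have C12: "C1 \<noteq> C2" using ne C by auto
    have dm: "d \<le> m" and d: "(if d = m then 0 else Suc d) \<in> C2"
      using m(4) mem[OF C(4), of d] unfolding C(3) by auto
    have mm: "Suc a \<in> C1" "Suc c \<in> C1" "Suc b \<in> C2"
      using m(1-3) mem[OF C(2), of a] mem[OF C(2), of c] mem[OF C(4), of b] ord dm
      unfolding C(1,3) by simp_all
    show False
    proof (cases "d = m")
      case True
      then show False using ncD[of C2 C1 0 "Suc a" "Suc b" "Suc c"] d mm C(2,4) C12 ord by simp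
    next
      case False
      then show False using ncD[of C1 C2 "Suc a" "Suc b" "Suc c" "Suc d"] d mm C(2,4) C12 ord by simp
    qed
  qed
  with 1 show ?thesis by (simp add: NC_def \<sigma>_def)
qed

text \<open>The moments of \<open>as\<close> and \<open>rotate1 as\<close> agree by traciality.
  Rotation permutes the partitions other than the one-block one, and the induction hypothesis
  equates their contributions block by block; what is left of the two formulas are the cumulants
  themselves.\<close>

lemma free_cumulant_rotate1:
  fixes \<phi> :: "'a::ring_1 \<Rightarrow> complex"
  assumes tr: "\<And>x y. \<phi> (x * y) = \<phi> (y * x)"
  shows "free_cumulant \<phi> (rotate1 as) = free_cumulant \<phi> as"
proof (induction as rule: length_induct)
  case (1 as)
  show ?case
  proof (cases as)
    case Nil
    then show ?thesis by simp
  next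
    case (Cons x xs)
    define m where "m = length xs"
    define k where "k = free_cumulant \<phi>"
    define A where "A = NC (Suc m) - {{{0..<Suc m}}}"
    let ?\<sigma> = "(`) (cyc_pred m)"
    have mc: "moment_cumulant \<phi> k" unfolding k_def by (rule moment_cumulant_free_cumulant)
    have len: "length as = Suc m" by (simp add: Cons m_def)
    have inj\<sigma>: "inj_on (cyc_pred m) {0..<Suc m}" and img: "cyc_pred m ` {0..<Suc m} = {0..<Suc m}"
      using cyc_pred_bij[of m] by (auto simp: bij_betw_def)
    have injB: "inj_on ?\<sigma> (Pow {0..<Suc m})" using inj_on_image_Pow[OF inj\<sigma>] .
    have sub: "NC (Suc m) \<subseteq> Pow (Pow {0..<Suc m})" using NC_block_subset by blast
    have injP: "inj_on ((`) ?\<sigma>) (NC (Suc m))"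
      using inj_on_subset[OF inj_on_image_Pow[OF injB] sub] .
    \<comment> \<open>An injective self-map of a finite set is onto, so no inverse rotation of
      partitions has to be handled.\<close>
    have "(`) ?\<sigma> ` NC (Suc m) = NC (Suc m)"
      using NC_cyc_pred by (intro endo_inj_surj[OF finite_NC _ injP]) auto
    moreover have full: "?\<sigma> ` {{0..<Suc m}} = {{0..<Suc m}}" using img by simp
    ultimately have bijA: "bij_betw ((`) ?\<sigma>) A A"
      unfolding A_def
      using inj_on_image_set_diff[OF injP, of "NC (Suc m)" "{{{0..<Suc m}}}"] injP full_in_NC[of "Suc m"]
      by (auto simp: bij_betw_def intro: inj_on_subset)
    have prod_eq: "(\<Prod>B\<in>?\<sigma> ` P. k (nths (rotate1 as) B)) = (\<Prod>B\<in>P. k (nths as B))" if "P \<in> A" for P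
    proof -
      have PN: "P \<in> NC (Suc m)" using that by (simp add: A_def)
      have "inj_on ?\<sigma> P" using inj_on_subset[OF injB] sub PN by blast
      then have "(\<Prod>B\<in>?\<sigma> ` P. k (nths (rotate1 as) B)) = (\<Prod>B\<in>P. k (nths (rotate1 as) (?\<sigma> B)))"
        by (simp add: prod.reindex)
      also have "\<dots> = (\<Prod>B\<in>P. k (nths as B))"
      proof (rule prod.cong[OF refl])
        fix B assume B: "B \<in> P"
        have "nths (rotate1 as) (?\<sigma> B) = (if 0 \<in> B then rotate1 (nths as B) else nths as B)"
          using nths_rotate1[of B xs x] NC_block_subset[OF PN B] by (simp add: Cons m_def)
        moreover have "k (rotate1 (nths as B)) = k (nths as B)"
        proof -
          have "B \<subset> {0..<Suc m}" using NC_block_proper[OF PN _ B] that by (simp add: A_def)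
          then have "length (nths as B) < length as" by (intro length_nths_proper) (simp add: len)
          then show ?thesis using 1 by (simp add: k_def)
        qed
        ultimately show "k (nths (rotate1 as) (?\<sigma> B)) = k (nths as B)" by simp
      qed
      finally show ?thesis .
    qed
    have rest: "(\<Sum>P\<in>A. \<Prod>B\<in>P. k (nths (rotate1 as) B)) = (\<Sum>P\<in>A. \<Prod>B\<in>P. k (nths as B))"
      using sum.reindex_bij_betw[OF bijA, of "\<lambda>P. \<Prod>B\<in>P. k (nths (rotate1 as) B)"] prod_eq
      by (simp cong: sum.cong)
    have ne: "as \<noteq> []" "rotate1 as \<noteq> []" using Cons by auto
    have "\<phi> (prod_list as) = k as + (\<Sum>P\<in>A. \<Prod>B\<in>P. k (nths as B))"
      using mc ne(1) moment_cumulant_split[OF ne(1), of k] by (simp add: moment_cumulant_def A_def len)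
    moreover have "\<phi> (prod_list (rotate1 as)) = k (rotate1 as) + (\<Sum>P\<in>A. \<Prod>B\<in>P. k (nths (rotate1 as) B))"
      using mc ne(2) moment_cumulant_split[OF ne(2), of k] by (simp add: moment_cumulant_def A_def len)
    moreover have "\<phi> (prod_list (rotate1 as)) = \<phi> (prod_list as)"
      using tr by (simp add: Cons)
    ultimately show ?thesis using rest by (simp add: k_def)
  qed
qed

lemma free_cumulant_rotate:
  assumes "\<And>x y. \<phi> (x * y) = \<phi> (y * x)"
  shows "free_cumulant \<phi> (rotate n as) = free_cumulant \<phi> as"
  by (induction n) (simp_all add: rotate_def free_cumulant_rotate1[of \<phi>, OF assms])

section \<open>Simple cycles\<close>

definition adj :: "('e \<Rightarrow> 'v) \<Rightarrow> ('e \<Rightarrow> 'v) \<Rightarrow> 'e set \<Rightarrow> ('v \<times> 'v) set" where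
  "adj s t Z = (\<lambda>e. (s e, t e)) ` Z \<union> (\<lambda>e. (t e, s e)) ` Z"

text \<open>Counterpart of \<open>ucycle\<close> for an arbitrary edge set \<open>Z\<close> with
  endpoint functions, so that deleting edges or renaming vertices changes only the parameters.
  Unordered pairs of ends ignore directions; for length one the index \<open>Suc 0 mod 1\<close>
  makes the edge a loop.\<close>

definition cyc :: "('e \<Rightarrow> 'v) \<Rightarrow> ('e \<Rightarrow> 'v) \<Rightarrow> 'e set \<Rightarrow> 'e list \<Rightarrow> 'v list \<Rightarrow> bool" where
  "cyc s t Z es vs \<longleftrightarrow> es \<noteq> [] \<and> length vs = length es \<and> distinct es \<and> distinct vs \<and> set es \<subseteq> Z \<and>
     (\<forall>i<length es. {s (es ! i), t (es ! i)} = {vs ! i, vs ! (Suc i mod length es)})"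

definition cycles :: "('e \<Rightarrow> 'v) \<Rightarrow> ('e \<Rightarrow> 'v) \<Rightarrow> 'e set \<Rightarrow> 'e set set" where
  "cycles s t Z = {set es |es. \<exists>vs. cyc s t Z es vs}"

lemma adj_sym: "sym (adj s t Z)"
  by (auto simp: adj_def sym_def)

lemma adj_rtrancl_sym: "(x, y) \<in> (adj s t Z)\<^sup>* \<Longrightarrow> (y, x) \<in> (adj s t Z)\<^sup>*"
  using sym_rtrancl[OF adj_sym] by (rule symD)

lemma adj_mono: "Z \<subseteq> Z' \<Longrightarrow> adj s t Z \<subseteq> adj s t Z'"
  by (auto simp: adj_def)

lemma adj_rtrancl_mono: "(x, y) \<in> (adj s t Z)\<^sup>* \<Longrightarrow> Z \<subseteq> Z' \<Longrightarrow> (x, y) \<in> (adj s t Z')\<^sup>*"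
  using rtrancl_mono[OF adj_mono] by blast

lemma adj_iff: "(x, y) \<in> adj s t Z \<longleftrightarrow> (\<exists>e\<in>Z. {s e, t e} = {x, y})"
  by (auto simp: adj_def doubleton_eq_iff)

lemma adjE:
  assumes "(x, y) \<in> adj s t Z"
  obtains e where "e \<in> Z" "{s e, t e} = {x, y}"
  using assms by (auto simp: adj_iff)

lemma cyc_mono: "cyc s t Z es vs \<Longrightarrow> set es \<subseteq> Z' \<Longrightarrow> cyc s t Z' es vs"
  by (simp add: cyc_def)

lemma cyc_ends:
  "cyc s t Z es vs \<Longrightarrow> i < length es \<Longrightarrow>
    {s (es ! i), t (es ! i)} = {vs ! i, vs ! (Suc i mod length es)}"
  by (simp add: cyc_def)

lemma cyc_in_cycles: "cyc s t Z es vs \<Longrightarrow> set es \<in> cycles s t Z"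
  by (auto simp: cycles_def)

lemma cycles_subset: "C \<in> cycles s t Z \<Longrightarrow> C \<subseteq> Z"
  by (auto simp: cycles_def cyc_def)

lemma cycles_nonempty: "C \<in> cycles s t Z \<Longrightarrow> C \<noteq> {}"
  by (auto simp: cycles_def cyc_def)

lemma cycles_mono: "C \<in> cycles s t Z \<Longrightarrow> C \<subseteq> Z' \<Longrightarrow> C \<in> cycles s t Z'"
  by (auto simp: cycles_def intro: cyc_mono)

lemma cycles_set_mono:
  assumes "Z \<subseteq> Z'"
  shows "cycles s t Z \<subseteq> cycles s t Z'"
proof
  fix C assume C: "C \<in> cycles s t Z"
  then have "C \<subseteq> Z'" using cycles_subset assms by blast
  then show "C \<in> cycles s t Z'" by (rule cycles_mono[OF C])
qed

lemma finite_cycles: "finite Z \<Longrightarrow> finite (cycles s t Z)"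
  by (rule finite_subset[of _ "Pow Z"]) (auto dest: cycles_subset)

text \<open>The walk is built from its far end; when the new first vertex already occurs, everything
  before that occurrence is cut off. A repeated edge would bring back the new vertex, hence the
  edges stay distinct too.\<close>

lemma simple_path:
  assumes "(x, y) \<in> (adj s t Z)\<^sup>*"
  shows "\<exists>es vs. length vs = Suc (length es) \<and> vs ! 0 = x \<and> vs ! length es = y \<and> distinct vs \<and>
    distinct es \<and> set es \<subseteq> Z \<and> (\<forall>i<length es. {s (es ! i), t (es ! i)} = {vs ! i, vs ! Suc i})"
  using assms
proof (induction rule: converse_rtrancl_induct)
  case base
  show ?case by (rule exI[of _ "[]"], rule exI[of _ "[y]"]) simp
next
  case (step x z)
  obtain e where e: "e \<in> Z" "{s e, t e} = {x, z}" using step(1) by (rule adjE)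
  obtain es vs where p: "length vs = Suc (length es)" "vs ! 0 = z" "vs ! length es = y" "distinct vs"
    "distinct es" "set es \<subseteq> Z" "\<And>i. i < length es \<Longrightarrow> {s (es ! i), t (es ! i)} = {vs ! i, vs ! Suc i}"
    using step(3) by blast
  show ?case
  proof (cases "x \<in> set vs")
    case True
    then obtain k where k: "k < length vs" "vs ! k = x" by (auto simp: in_set_conv_nth)
    have "set (drop k es) \<subseteq> Z" using p(6) set_drop_subset[of k es] by auto
    then show ?thesis using k p
      by (intro exI[of _ "drop k es"] exI[of _ "drop k vs"]) auto
  next
    case False
    have "e \<notin> set es"
    proof
      assume "e \<in> set es"
      then obtain i where i: "i < length es" "es ! i = e" by (auto simp: in_set_conv_nth)
      then have "{x, z} = {vs ! i, vs ! Suc i}" using p(7)[of i] e(2) by simp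
      then have "x \<in> {vs ! i, vs ! Suc i}" by blast
      then show False using False i p(1) nth_mem[of i vs] nth_mem[of "Suc i" vs] by auto
    qed
    moreover have "{s ((e # es) ! i), t ((e # es) ! i)} = {(x # vs) ! i, (x # vs) ! Suc i}"
      if "i < length (e # es)" for i
      using that e(2) p(2,7) by (cases i) auto
    ultimately show ?thesis using False e(1) p
      by (intro exI[of _ "e # es"] exI[of _ "x # vs"]) auto
  qed
qed

text \<open>A simple path between the ends of \<open>e\<close> that avoids \<open>e\<close> closes
  up through \<open>e\<close>; the empty path is the case of a loop.\<close>

lemma closed_path_cyc:
  assumes "e \<in> Z" "(t e, s e) \<in> (adj s t (Z - {e}))\<^sup>*"
  shows "\<exists>C\<in>cycles s t Z. e \<in> C"
proof -
  obtain es vs where p: "length vs = Suc (length es)" "vs ! 0 = t e" "vs ! length es = s e" "distinct vs"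
    "distinct es" "set es \<subseteq> Z - {e}"
    "\<And>i. i < length es \<Longrightarrow> {s (es ! i), t (es ! i)} = {vs ! i, vs ! Suc i}"
    using simple_path[OF assms(2)] by blast
  have "cyc s t Z (es @ [e]) vs"
    unfolding cyc_def
  proof (intro conjI allI impI)
    fix i assume "i < length (es @ [e])"
    then consider "i < length es" | "i = length es" by fastforce
    then show "{s ((es @ [e]) ! i), t ((es @ [e]) ! i)} = {vs ! i, vs ! (Suc i mod length (es @ [e]))}"
    proof cases
      case 1
      then show ?thesis using p(7)[of i] by (simp add: nth_append)
    next
      case 2
      then show ?thesis using p(2,3) by simp
    qed
  qed (use p assms in auto)
  then have "set (es @ [e]) \<in> cycles s t Z" by (rule cyc_in_cycles)
  then show ?thesis by (rule bexI[rotated]) simp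
qed

lemma cyc_arc:
  assumes "cyc s t Z es vs"
  shows "(vs ! (a mod length es), vs ! ((a + k) mod length es)) \<in>
    (adj s t ((\<lambda>j. es ! ((a + j) mod length es)) ` {..<k}))\<^sup>*"
proof (induction k)
  case (Suc k)
  let ?n = "length es" and ?A = "\<lambda>k. (\<lambda>j. es ! ((a + j) mod length es)) ` {..<k}"
  have "0 < ?n" using assms by (auto simp: cyc_def)
  then have "{s (es ! ((a + k) mod ?n)), t (es ! ((a + k) mod ?n))} =
      {vs ! ((a + k) mod ?n), vs ! ((a + Suc k) mod ?n)}"
    using assms by (auto simp: cyc_def mod_Suc_eq)
  then have "(vs ! ((a + k) mod ?n), vs ! ((a + Suc k) mod ?n)) \<in> adj s t (?A (Suc k))"
    unfolding adj_iff by (intro bexI[of _ "es ! ((a + k) mod ?n)"]) auto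
  moreover have "(vs ! (a mod ?n), vs ! ((a + k) mod ?n)) \<in> (adj s t (?A (Suc k)))\<^sup>*"
    by (rule adj_rtrancl_mono[OF Suc]) auto
  ultimately show ?case by (rule rtrancl_into_rtrancl[rotated])
qed simp

text \<open>The long way round: \<open>length es - 1\<close> steps from position
  \<open>Suc i\<close> arrive at \<open>i\<close> without using edge \<open>i\<close>.\<close>

lemma cyc_around:
  assumes "cyc s t Z es vs" "i < length es"
  shows "(vs ! (Suc i mod length es), vs ! i) \<in> (adj s t (set es - {es ! i}))\<^sup>*"
proof -
  let ?n = "length es"
  have d: "distinct es" using assms(1) by (simp add: cyc_def)
  have *: "(Suc i + j) mod ?n \<noteq> i" if "j < ?n - 1" for j
    using assms(2) that by (cases "Suc i + j < ?n") (auto simp: le_mod_geq)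
  then have sub: "(\<lambda>j. es ! ((Suc i + j) mod ?n)) ` {..<?n - 1} \<subseteq> set es - {es ! i}"
  proof (intro subsetI, elim imageE)
    fix e j assume e: "e = es ! ((Suc i + j) mod ?n)" and j: "j \<in> {..<?n - 1}"
    have "(Suc i + j) mod ?n < ?n" using assms(2) by (intro mod_less_divisor) linarith
    then show "e \<in> set es - {es ! i}"
      using e j d assms(2) * by (simp add: nth_eq_iff_index_eq)
  qed
  have "Suc i + (?n - 1) = i + ?n" using assms(2) by simp
  then have "(Suc i + (?n - 1)) mod ?n = i" using assms(2) by simp
  then show ?thesis
    using adj_rtrancl_mono[OF cyc_arc[OF assms(1), of "Suc i" "?n - 1"] sub] by metis
qed

text \<open>An outside connection short-circuits the cycle: the arc from \<open>Suc a\<close> to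
  \<open>b\<close> followed by that connection leads back to \<open>a\<close>, and edge
  \<open>a\<close> closes it up. The new cycle avoids \<open>es ! b\<close>, so edge
  \<open>a\<close> lies on two cycles, which a cactus forbids.\<close>

lemma cyc_chord:
  assumes c: "cyc s t Z es vs" and ab: "a < b" "b < length es"
    and conn: "(vs ! a, vs ! b) \<in> (adj s t (Z - set es))\<^sup>*"
  shows "\<exists>C\<in>cycles s t Z. es ! a \<in> C \<and> C \<noteq> set es"
proof -
  let ?n = "length es" and ?Z = "Z - {es ! b}"
  have d: "distinct es" and sub: "set es \<subseteq> Z" using c by (auto simp: cyc_def)
  have ends: "{s (es ! a), t (es ! a)} = {vs ! a, vs ! Suc a}"
    using c ab by (auto simp: cyc_def)
  have "(\<lambda>j. es ! ((Suc a + j) mod ?n)) ` {..<b - Suc a} \<subseteq> ?Z - {es ! a}"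
  proof (intro subsetI, elim imageE)
    fix e j assume e: "e = es ! ((Suc a + j) mod ?n)" and "j \<in> {..<b - Suc a}"
    then have "Suc a + j < b" "e = es ! (Suc a + j)" using ab by auto
    then show "e \<in> ?Z - {es ! a}"
      using d sub ab nth_mem[of "Suc a + j" es] by (auto simp: nth_eq_iff_index_eq)
  qed
  from adj_rtrancl_mono[OF cyc_arc[OF c, of "Suc a" "b - Suc a"] this]
  have 1: "(vs ! Suc a, vs ! b) \<in> (adj s t (?Z - {es ! a}))\<^sup>*" using ab by simp
  have 2: "(vs ! b, vs ! a) \<in> (adj s t (?Z - {es ! a}))\<^sup>*"
    by (rule adj_rtrancl_sym, rule adj_rtrancl_mono[OF conn]) (use ab in auto)
  have "(vs ! Suc a, vs ! a) \<in> (adj s t (?Z - {es ! a}))\<^sup>*" using 1 2 by (rule rtrancl_trans)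
  moreover from adj_rtrancl_sym[OF this]
  have "(vs ! a, vs ! Suc a) \<in> (adj s t (?Z - {es ! a}))\<^sup>*" .
  ultimately have "(t (es ! a), s (es ! a)) \<in> (adj s t (?Z - {es ! a}))\<^sup>*"
    using ends by (auto simp: doubleton_eq_iff)
  moreover have "es ! a \<in> ?Z" using d sub ab by (auto simp: nth_eq_iff_index_eq)
  ultimately obtain C where "C \<in> cycles s t ?Z" "es ! a \<in> C" 
    using closed_path_cyc[where s = s and t = t and Z = ?Z and e = "es ! a"] by blast
  moreover have "es ! b \<notin> C" using cycles_subset[OF calculation(1)] by auto
  ultimately show ?thesis using ab cycles_mono[of C s t ?Z Z] cycles_subset[of C s t ?Z]
    by (intro bexI[of _ C]) auto
qed

section \<open>Splitting off a cycle whose removal separates its vertices\<close>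

definition separated :: "('e \<Rightarrow> 'v) \<Rightarrow> ('e \<Rightarrow> 'v) \<Rightarrow> 'e set \<Rightarrow> 'v set \<Rightarrow> bool" where
  "separated s t Y X \<longleftrightarrow> (\<forall>x\<in>X. \<forall>y\<in>X. (x, y) \<in> (adj s t Y)\<^sup>* \<longrightarrow> x = y)"

lemma rtrancl_leaves:
  assumes "(x, y) \<in> r\<^sup>*" "x \<in> K" "y \<notin> K"
  shows "\<exists>u w. (u, w) \<in> r \<and> u \<in> K \<and> w \<notin> K"
  using assms by (induction rule: rtrancl_induct) auto

text \<open>The component \<^term>\<open>K\<close> of a vertex of the separated cycle is left by exactly two edges, both on
  that cycle; another cycle entering \<^term>\<open>K\<close> through one of them must leave through the other.\<close>

lemma cyc_step_shared:
  assumes c: "cyc s t Z es vs" and c': "cyc s t Z es' vs'"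
    and sep: "separated s t (Z - set es) (set vs)"
    and i: "i < length es" "es ! i \<in> set es'"
  shows "es ! (Suc i mod length es) \<in> set es'"
proof (cases "length es = 1")
  case True
  then show ?thesis using i by simp
next
  case False
  let ?n = "length es"
  have n: "?n > 1" using False i by linarith
  have len: "length vs = ?n" and dv: "distinct vs"
    and ends: "\<And>i. i < ?n \<Longrightarrow> {s (es ! i), t (es ! i)} = {vs ! i, vs ! (Suc i mod ?n)}"
    using c by (auto simp: cyc_def)
  define i' where "i' = Suc i mod ?n"
  have i': "i' < ?n" unfolding i'_def using n by (intro mod_less_divisor) linarith
  have "i' \<noteq> i" using i n by (auto simp: i'_def mod_Suc)
  then have xi: "vs ! i' \<noteq> vs ! i" using dv i i' len by (simp add: nth_eq_iff_index_eq)
  define x where "x = vs ! i'"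
  have x: "x \<in> set vs" using i' len by (simp add: x_def)
  define K where "K = {y. (x, y) \<in> (adj s t (Z - set es))\<^sup>*}"
  have Kv: "y = x" if "y \<in> K" "y \<in> set vs" for y
    using sep that x unfolding separated_def K_def by blast
  have vi: "vs ! i \<notin> K" using Kv[of "vs ! i"] xi i len by (auto simp: x_def)
  obtain j where j: "j < length es'" "es' ! j = es ! i" using i by (auto simp: in_set_conv_nth)
  have "{vs' ! j, vs' ! (Suc j mod length es')} = {vs ! i, x}"
    using cyc_ends[OF c' j(1)] ends[OF i(1)] j(2) by (simp add: x_def i'_def)
  moreover note a = cyc_around[OF c' j(1)]
  ultimately have xv: "(x, vs ! i) \<in> (adj s t (set es' - {es ! i}))\<^sup>*"
    using adj_rtrancl_sym[OF a] unfolding j(2) by (auto simp: doubleton_eq_iff)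
  have xK: "x \<in> K" by (simp add: K_def)
  obtain u w where uw: "(u, w) \<in> adj s t (set es' - {es ! i})" "u \<in> K" "w \<notin> K"
    using rtrancl_leaves[OF xv xK vi] by blast
  obtain f where f: "f \<in> set es'" "f \<noteq> es ! i" "{s f, t f} = {u, w}" using uw(1) by (auto simp: adj_iff)
  have "f \<in> set es"
  proof (rule ccontr)
    assume "f \<notin> set es"
    then have "f \<in> Z - set es" using f(1) c' by (auto simp: cyc_def)
    then have "(u, w) \<in> adj s t (Z - set es)" unfolding adj_iff using f(3) by blast
    then have "w \<in> K" using uw(2) unfolding K_def by (auto intro: rtrancl_into_rtrancl)
    then show False using uw(3) by simp
  qed
  then obtain m where m: "m < ?n" "f = es ! m" by (auto simp: in_set_conv_nth)
  have eq: "{vs ! m, vs ! (Suc m mod ?n)} = {u, w}" using ends[OF m(1)] f(3) m(2) by simp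
  have sm: "Suc m mod ?n < ?n" using n by (intro mod_less_divisor) linarith
  have "u \<in> {vs ! m, vs ! (Suc m mod ?n)}" using eq by blast
  then have "u \<in> set vs" using m(1) len sm by (auto intro: nth_mem)
  then have "u = x" using Kv uw(2) by blast
  then have "vs ! i' = vs ! m \<or> vs ! i' = vs ! (Suc m mod ?n)" using eq by (auto simp: x_def doubleton_eq_iff)
  then have "i' = m \<or> i' = Suc m mod ?n" using dv len m(1) sm i' by (simp add: nth_eq_iff_index_eq)
  \<comment> \<open>The edges of \<open>es\<close> at \<open>x\<close> are \<open>es ! i\<close> and
    its successor, and \<open>f\<close> is not the former.\<close>
  moreover have "m \<noteq> i" using f(2) m(2) by auto
  then have "i' \<noteq> Suc m mod ?n" using i(1) m(1) by (auto simp: i'_def mod_Suc split: if_splits)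
  ultimately show ?thesis using f(1) m(2) by (simp add: i'_def)
qed

text \<open>A shared edge passes the property on to its successor, and so once round the whole of
  \<open>es\<close>.\<close>

lemma cyc_subset_shared:
  assumes c: "cyc s t Z es vs" and c': "cyc s t Z es' vs'"
    and sep: "separated s t (Z - set es) (set vs)"
    and "set es \<inter> set es' \<noteq> {}"
  shows "set es \<subseteq> set es'"
proof -
  let ?n = "length es"
  obtain e where "e \<in> set es" "e \<in> set es'" using assms(4) by blast
  then obtain i where i: "i < ?n" "es ! i \<in> set es'" by (metis in_set_conv_nth)
  have *: "es ! ((i + k) mod ?n) \<in> set es'" for k
  proof (induction k)
    case 0
    then show ?case using i by simp
  next
    case (Suc k)
    have "(i + k) mod ?n < ?n" using i by (intro mod_less_divisor) linarith
    from cyc_step_shared[OF c c' sep this Suc] show ?case by (simp add: mod_Suc_eq)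
  qed
  show ?thesis
  proof
    fix e assume "e \<in> set es"
    then obtain m where m: "m < ?n" "e = es ! m" by (auto simp: in_set_conv_nth)
    have "(i + (?n - i + m)) mod ?n = m" using m i by simp
    then show "e \<in> set es'" using *[of "?n - i + m"] m by simp
  qed
qed

text \<open>A cycle sharing an edge with a separated one coincides with it: it contains the
  separated cycle by walking round the latter, and a simple cycle contains no smaller one.\<close>

lemma cycles_peel:
  assumes c: "cyc s t Z es vs" and sep: "separated s t (Z - set es) (set vs)"
  shows "cycles s t Z = insert (set es) (cycles s t (Z - set es))"
proof -
  have "C = set es \<or> C \<in> cycles s t (Z - set es)" if C: "C \<in> cycles s t Z" for C
  proof (cases "set es \<inter> C = {}")
    case True
    then show ?thesis using cycles_mono[OF C] cycles_subset[OF C] by blast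
  next
    case False
    obtain es' vs' where c': "cyc s t Z es' vs'" "C = set es'" using C by (auto simp: cycles_def)
    have 1: "set es \<subseteq> set es'" using cyc_subset_shared[OF c c'(1) sep] False c'(2) by simp
    \<comment> \<open>With \<open>set es'\<close> as the whole edge set nothing remains outside that
      cycle, so its vertices are trivially separated and the same lemma gives the reverse
      inclusion.\<close>
    have "set es' \<subseteq> set es"
    proof (rule cyc_subset_shared)
      show "cyc s t (set es') es' vs'" "cyc s t (set es') es vs"
        using cyc_mono c c' 1 by blast+
      show "separated s t (set es' - set es') (set vs')" by (simp add: separated_def adj_def)
      show "set es' \<inter> set es \<noteq> {}" using False c'(2) by auto
    qed
    then show ?thesis using 1 c'(2) by simp
  qed
  then show ?thesis using cyc_in_cycles[OF c] cycles_mono[of _ s t "Z - set es" Z]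
    by (blast dest: cycles_subset)
qed

text \<open>Consecutive edges of a cycle share a vertex and the two edge sets share none, so a cycle
  stays on the side of its first edge.\<close>

lemma cycles_disjoint_union:
  assumes dis: "(s ` Z1 \<union> t ` Z1) \<inter> (s ` Z2 \<union> t ` Z2) = {}"
  shows "cycles s t (Z1 \<union> Z2) = cycles s t Z1 \<union> cycles s t Z2"
proof -
  have *: "set es \<subseteq> Y1"
    if c: "cyc s t (Y1 \<union> Y2) es vs" and d: "(s ` Y1 \<union> t ` Y1) \<inter> (s ` Y2 \<union> t ` Y2) = {}"
      and e0: "es ! 0 \<in> Y1" for es vs Y1 Y2
  proof -
    have "es ! i \<in> Y1" if "i < length es" for i
      using that
    proof (induction i)
      case 0
      then show ?case using e0 by simp
    next
      case (Suc i)
      have 1: "{s (es ! i), t (es ! i)} = {vs ! i, vs ! Suc i}"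
        and 2: "{s (es ! Suc i), t (es ! Suc i)} = {vs ! Suc i, vs ! (Suc (Suc i) mod length es)}"
        using c Suc.prems by (auto simp: cyc_def)
      have "vs ! Suc i \<in> {s (es ! i), t (es ! i)}" using 1 by blast
      then have v1: "vs ! Suc i \<in> s ` Y1 \<union> t ` Y1" using Suc by auto
      have "vs ! Suc i \<in> {s (es ! Suc i), t (es ! Suc i)}" using 2 by blast
      then have "es ! Suc i \<notin> Y2" using v1 d by auto
      moreover have "es ! Suc i \<in> Y1 \<union> Y2" using c nth_mem[OF Suc.prems] by (auto simp: cyc_def)
      ultimately show ?case by blast
    qed
    then show ?thesis by (auto simp: in_set_conv_nth)
  qed
  have "C \<in> cycles s t Z1 \<union> cycles s t Z2" if C: "C \<in> cycles s t (Z1 \<union> Z2)" for C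
  proof -
    obtain es vs where c: "cyc s t (Z1 \<union> Z2) es vs" "C = set es" using C by (auto simp: cycles_def)
    have "es ! 0 \<in> Z1 \<union> Z2" using c by (auto simp: cyc_def)
    then have "set es \<subseteq> Z1 \<or> set es \<subseteq> Z2"
    proof
      assume "es ! 0 \<in> Z1"
      then show ?thesis using *[OF c(1) dis] by simp
    next
      assume "es ! 0 \<in> Z2"
      moreover have "cyc s t (Z2 \<union> Z1) es vs" using c(1) by (simp add: Un_commute)
      ultimately show ?thesis using *[of Z2 Z1 es vs] dis by (simp add: Int_commute)
    qed
    then show ?thesis using cycles_mono[OF C] c(2) by blast
  qed
  moreover have "cycles s t Z1 \<subseteq> cycles s t (Z1 \<union> Z2)" "cycles s t Z2 \<subseteq> cycles s t (Z1 \<union> Z2)"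
    by (simp_all add: cycles_set_mono)
  ultimately show ?thesis by blast
qed

section \<open>Cactus weights\<close>

definition denum :: "('e \<Rightarrow> 'v) \<Rightarrow> ('e \<Rightarrow> 'v) \<Rightarrow> 'e set \<Rightarrow> 'e list \<Rightarrow> bool" where
  "denum s t C es \<longleftrightarrow> es \<noteq> [] \<and> distinct es \<and> set es = C \<and>
     (\<forall>i<length es. s (es ! i) = t (es ! (Suc i mod length es)))"

definition pad_weight ::
    "('a list \<Rightarrow> complex) \<Rightarrow> ('e \<Rightarrow> 'v) \<Rightarrow> ('e \<Rightarrow> 'v) \<Rightarrow> ('e \<Rightarrow> 'a) \<Rightarrow> 'e set \<Rightarrow> complex" where
  "pad_weight \<kappa> s t l C = \<kappa> (map l (SOME es. denum s t C es))"

text \<open>This is \<open>tau0\<close> without the demand of connectedness. Without it the weight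
  is multiplicative over disjoint pieces, which is what remains once a pad is deleted; the empty
  edge set has weight 1.\<close>

definition weight ::
    "('a list \<Rightarrow> complex) \<Rightarrow> ('e \<Rightarrow> 'v) \<Rightarrow> ('e \<Rightarrow> 'v) \<Rightarrow> ('e \<Rightarrow> 'a) \<Rightarrow> 'e set \<Rightarrow> complex" where
  "weight \<kappa> s t l Z =
     (if (\<forall>e\<in>Z. \<exists>!C. C \<in> cycles s t Z \<and> e \<in> C) \<and> (\<forall>C\<in>cycles s t Z. \<exists>es. denum s t C es)
      then \<Prod>C\<in>cycles s t Z. pad_weight \<kappa> s t l C else 0)"

text \<open>By \<open>cyc_chord\<close> an edge of \<open>es\<close> then lies on a second cycle,
  which violates the cactus condition.\<close>

lemma weight_zero_chord:
  assumes c: "cyc s t Z es vs" and "\<not> separated s t (Z - set es) (set vs)"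
  shows "weight \<kappa> s t l Z = 0"
proof -
  obtain x y where xy: "x \<in> set vs" "y \<in> set vs" "x \<noteq> y" "(x, y) \<in> (adj s t (Z - set es))\<^sup>*"
    using assms(2) by (auto simp: separated_def)
  have len: "length vs = length es" using c by (simp add: cyc_def)
  obtain a b where "a < length es" "vs ! a = x" "b < length es" "vs ! b = y"
    using xy(1,2) len by (metis in_set_conv_nth)
  moreover then have "a \<noteq> b" using xy(3) by auto
  ultimately obtain a b where ab: "a < b" "b < length es" "(vs ! a, vs ! b) \<in> (adj s t (Z - set es))\<^sup>*"
    using xy(4) adj_rtrancl_sym[OF xy(4)] by (metis linorder_neqE_nat)
  obtain C where C: "C \<in> cycles s t Z" "es ! a \<in> C" "C \<noteq> set es"
    using cyc_chord[OF c ab] by blast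
  have ea: "es ! a \<in> set es" "es ! a \<in> Z" using ab c nth_mem[of a es] by (auto simp: cyc_def)
  have "\<not> (\<exists>!C. C \<in> cycles s t Z \<and> es ! a \<in> C)"
    using C cyc_in_cycles[OF c] ea(1) by blast
  then have "\<not> (\<forall>e\<in>Z. \<exists>!C. C \<in> cycles s t Z \<and> e \<in> C)" using ea(2) by blast
  then show ?thesis unfolding weight_def by (subst if_not_P) blast+
qed

lemma weight_zero_undirected:
  assumes "C \<in> cycles s t Z" "\<nexists>es. denum s t C es"
  shows "weight \<kappa> s t l Z = 0"
  using assms by (auto simp: weight_def)

text \<open>By \<open>cycles_peel\<close> exactly one cycle disappears and its edges lie on no
  other, so the cactus and orientation conditions pass between \<open>Z\<close> and
  \<open>Z - set es\<close> and the product loses one factor.\<close>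

lemma weight_peel:
  assumes fin: "finite Z" and c: "cyc s t Z es vs" and sep: "separated s t (Z - set es) (set vs)"
    and d: "\<exists>es'. denum s t (set es) es'"
  shows "weight \<kappa> s t l Z = pad_weight \<kappa> s t l (set es) * weight \<kappa> s t l (Z - set es)"
proof -
  let ?C = "set es"
  note peel = cycles_peel[OF c sep]
  have sub: "?C \<subseteq> Z" "?C \<noteq> {}" using c by (auto simp: cyc_def)
  have new: "?C \<notin> cycles s t (Z - ?C)" 
  proof
    assume "?C \<in> cycles s t (Z - ?C)"
    then have "?C \<subseteq> Z - ?C" by (rule cycles_subset)
    moreover obtain e where "e \<in> ?C" using sub(2) by (meson ex_in_conv)
    ultimately show False by (meson DiffD2 subsetD)
  qed
  have in1: "(\<exists>!C. C \<in> cycles s t Z \<and> e \<in> C)" if "e \<in> ?C" for e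
  proof (rule ex1I[of _ ?C])
    show "?C \<in> cycles s t Z \<and> e \<in> ?C" using cyc_in_cycles[OF c] that by simp
    fix C assume "C \<in> cycles s t Z \<and> e \<in> C"
    then show "C = ?C" using peel that cycles_subset[of C s t "Z - ?C"] by blast
  qed
  have in2: "C \<in> cycles s t Z \<and> e \<in> C \<longleftrightarrow> C \<in> cycles s t (Z - ?C) \<and> e \<in> C" if "e \<notin> ?C" for e C
    using peel that by blast
  have "(\<forall>e\<in>Z. \<exists>!C. C \<in> cycles s t Z \<and> e \<in> C) \<longleftrightarrow>
      (\<forall>e\<in>Z - ?C. \<exists>!C. C \<in> cycles s t Z \<and> e \<in> C)"
    using in1 by blast
  also have "\<dots> \<longleftrightarrow> (\<forall>e\<in>Z - ?C. \<exists>!C. C \<in> cycles s t (Z - ?C) \<and> e \<in> C)"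
    using in2 by (intro ball_cong) auto
  finally have 1: "(\<forall>e\<in>Z. \<exists>!C. C \<in> cycles s t Z \<and> e \<in> C) \<longleftrightarrow>
      (\<forall>e\<in>Z - ?C. \<exists>!C. C \<in> cycles s t (Z - ?C) \<and> e \<in> C)" .
  have 2: "(\<forall>C\<in>cycles s t Z. \<exists>es. denum s t C es) \<longleftrightarrow>
      (\<forall>C\<in>cycles s t (Z - ?C). \<exists>es. denum s t C es)"
    unfolding peel using d by simp
  have 3: "(\<Prod>C\<in>cycles s t Z. pad_weight \<kappa> s t l C) =
      pad_weight \<kappa> s t l ?C * (\<Prod>C\<in>cycles s t (Z - ?C). pad_weight \<kappa> s t l C)"
    unfolding peel using new fin by (simp add: finite_cycles)
  have "(if P then a * b else 0) = a * (if P then b else 0)" for P and a b :: complex by simp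
  then show ?thesis unfolding weight_def 1 2 3 .
qed

lemma weight_disjoint_union:
  assumes fin: "finite Z1" "finite Z2"
    and dis: "(s ` Z1 \<union> t ` Z1) \<inter> (s ` Z2 \<union> t ` Z2) = {}"
  shows "weight \<kappa> s t l (Z1 \<union> Z2) = weight \<kappa> s t l Z1 * weight \<kappa> s t l Z2"
proof -
  note un = cycles_disjoint_union[OF dis]
  have Z: "Z1 \<inter> Z2 = {}" using dis by blast
  have cd: "cycles s t Z1 \<inter> cycles s t Z2 = {}"
  proof (rule ccontr)
    assume "cycles s t Z1 \<inter> cycles s t Z2 \<noteq> {}"
    then obtain C where C: "C \<in> cycles s t Z1" "C \<in> cycles s t Z2" by (meson disjoint_iff)
    then have "C \<subseteq> Z1 \<inter> Z2" by (simp add: cycles_subset)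
    then show False using Z cycles_nonempty[OF C(1)] by simp
  qed
  have m1: "C \<in> cycles s t (Z1 \<union> Z2) \<and> e \<in> C \<longleftrightarrow> C \<in> cycles s t Z1 \<and> e \<in> C" if "e \<in> Z1" for e C
    unfolding un using that Z cycles_subset[of C s t Z2] by blast
  have m2: "C \<in> cycles s t (Z1 \<union> Z2) \<and> e \<in> C \<longleftrightarrow> C \<in> cycles s t Z2 \<and> e \<in> C" if "e \<in> Z2" for e C
    unfolding un using that Z cycles_subset[of C s t Z1] by blast
  have 1: "(\<forall>e\<in>Z1 \<union> Z2. \<exists>!C. C \<in> cycles s t (Z1 \<union> Z2) \<and> e \<in> C) \<longleftrightarrow>
      (\<forall>e\<in>Z1. \<exists>!C. C \<in> cycles s t Z1 \<and> e \<in> C) \<and> (\<forall>e\<in>Z2. \<exists>!C. C \<in> cycles s t Z2 \<and> e \<in> C)"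
    unfolding ball_Un using m1 m2 by (intro arg_cong2[where f = "(\<and>)"] ball_cong) auto
  have 2: "(\<forall>C\<in>cycles s t (Z1 \<union> Z2). \<exists>es. denum s t C es) \<longleftrightarrow>
      (\<forall>C\<in>cycles s t Z1. \<exists>es. denum s t C es) \<and> (\<forall>C\<in>cycles s t Z2. \<exists>es. denum s t C es)"
    unfolding un by blast
  have 3: "(\<Prod>C\<in>cycles s t (Z1 \<union> Z2). pad_weight \<kappa> s t l C) =
      (\<Prod>C\<in>cycles s t Z1. pad_weight \<kappa> s t l C) * (\<Prod>C\<in>cycles s t Z2. pad_weight \<kappa> s t l C)"
    unfolding un using fin cd by (intro prod.union_disjoint) (auto simp: finite_cycles)
  have "(if (P \<and> P') \<and> Q \<and> Q' then a * b else 0) = (if P \<and> Q then a else 0) * (if P' \<and> Q' then b else 0)"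
    for P P' Q Q' and a b :: complex by simp
  then show ?thesis unfolding weight_def 1 2 3 .
qed

text \<open>In a directed enumeration every source is also a target, so all vertices of the pad are
  targets. There are as many vertices as edges, hence \<open>t\<close> is injective on the pad and
  each edge determines its successor; two enumerations can differ only in where they start.\<close>

lemma denum_rotate:
  assumes c: "cyc s t Z es0 vs" and d: "denum s t (set es0) es" and d': "denum s t (set es0) es'"
  shows "\<exists>k. es' = rotate k es"
proof -
  let ?C = "set es0" and ?n = "length es"
  have n: "?n = card ?C" "length es' = card ?C"
    using d d' by (auto simp: denum_def distinct_card[symmetric])
  have pos: "0 < ?n" using d by (simp add: denum_def)
  have sub: "s ` ?C \<subseteq> t ` ?C"
  proof
    fix v assume "v \<in> s ` ?C"
    then obtain e where "e \<in> set es" "v = s e" using d by (auto simp: denum_def)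
    then obtain i where i: "i < ?n" "v = s (es ! i)" by (metis in_set_conv_nth)
    then have "v = t (es ! (Suc i mod ?n))" using d by (simp add: denum_def)
    moreover have "es ! (Suc i mod ?n) \<in> ?C" using d pos by (metis denum_def mod_less_divisor nth_mem)
    ultimately show "v \<in> t ` ?C" by blast
  qed
  have "set vs \<subseteq> s ` ?C \<union> t ` ?C"
  proof
    fix v assume "v \<in> set vs"
    then obtain i where i: "i < length es0" "v = vs ! i" using c by (auto simp: in_set_conv_nth cyc_def)
    then have "v \<in> {s (es0 ! i), t (es0 ! i)}" using cyc_ends[OF c i(1)] by blast
    then show "v \<in> s ` ?C \<union> t ` ?C" using i(1) by auto
  qed
  then have "set vs \<subseteq> t ` ?C" using sub by blast
  then have "card (set vs) \<le> card (t ` ?C)" by (rule card_mono[rotated]) simp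
  moreover have "card (set vs) = card ?C" using c by (simp add: cyc_def distinct_card)
  ultimately have "card (t ` ?C) = card ?C" using card_image_le[of ?C t] by simp
  then have inj: "inj_on t ?C" by (intro eq_card_imp_inj_on) auto
  have "es' ! 0 \<in> set es" using d d' by (auto simp: denum_def)
  then obtain k where k: "k < ?n" "es ! k = es' ! 0" by (auto simp: in_set_conv_nth)
  have "es' ! i = es ! ((k + i) mod ?n)" if "i < ?n" for i
    using that
  proof (induction i)
    case 0
    then show ?case using k by simp
  next
    case (Suc i)
    have "t (es' ! Suc i) = s (es' ! i)" using d' Suc.prems n by (simp add: denum_def)
    also have "\<dots> = s (es ! ((k + i) mod ?n))" using Suc by simp
    also have "\<dots> = t (es ! (Suc ((k + i) mod ?n) mod ?n))"
      using d pos by (simp add: denum_def)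
    also have "\<dots> = t (es ! ((k + Suc i) mod ?n))" by (simp add: mod_Suc_eq)
    finally have "t (es' ! Suc i) = t (es ! ((k + Suc i) mod ?n))" .
    moreover have "es' ! Suc i \<in> ?C" using d' Suc.prems n nth_mem[of "Suc i" es'] by (simp add: denum_def)
    moreover have "es ! ((k + Suc i) mod ?n) \<in> ?C"
      using d nth_mem[of "(k + Suc i) mod ?n" es] mod_less_divisor[OF pos] by (simp add: denum_def)
    ultimately show ?case using inj by (simp add: inj_on_def)
  qed
  then have "es' = rotate k es"
    using n k by (intro nth_equalityI) (auto simp: nth_rotate)
  then show ?thesis ..
qed

definition cyclic_invariant :: "('a list \<Rightarrow> 'b) \<Rightarrow> bool" where
  "cyclic_invariant \<kappa> \<longleftrightarrow> (\<forall>k as. \<kappa> (rotate k as) = \<kappa> as)"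

text \<open>The choice hidden in \<open>pad_weight\<close> is harmless: by
  \<open>denum_rotate\<close> only rotations are possible, and \<open>\<kappa>\<close> ignores
  them.\<close>

lemma pad_weight_denum:
  assumes "cyclic_invariant \<kappa>" "C \<in> cycles s t Z" "denum s t C es"
  shows "pad_weight \<kappa> s t l C = \<kappa> (map l es)"
proof -
  obtain es0 vs where c: "cyc s t Z es0 vs" "C = set es0" using assms(2) by (auto simp: cycles_def)
  have "denum s t C (SOME es. denum s t C es)" using assms(3) by (rule someI)
  then obtain k where "(SOME es. denum s t C es) = rotate k es"
    using denum_rotate[OF c(1)] assms(3) c(2) by blast
  then show ?thesis using assms(1) by (simp add: pad_weight_def cyclic_invariant_def rotate_map[symmetric])
qed

section \<open>Invariance of cycles and weights under isomorphism\<close>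

lemma cyc_transport:
  assumes c: "cyc s t Z es vs" and f: "bij_betw f Z Z'" and m: "inj_on m (s ` Z \<union> t ` Z)"
    and st: "\<And>e. e \<in> Z \<Longrightarrow> s' (f e) = m (s e)" "\<And>e. e \<in> Z \<Longrightarrow> t' (f e) = m (t e)"
  shows "cyc s' t' Z' (map f es) (map m vs)"
proof -
  have sub: "set es \<subseteq> Z" and len: "length vs = length es" using c by (auto simp: cyc_def)
  have ne: "0 < length es" using c by (auto simp: cyc_def)
  have vsub: "set vs \<subseteq> s ` Z \<union> t ` Z"
  proof
    fix v assume "v \<in> set vs"
    then obtain i where i: "i < length es" "v = vs ! i" using len by (auto simp: in_set_conv_nth)
    then have "v \<in> {s (es ! i), t (es ! i)}" using cyc_ends[OF c i(1)] by blast
    moreover have "es ! i \<in> Z" using sub i(1) by auto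
    ultimately show "v \<in> s ` Z \<union> t ` Z" by blast
  qed
  have "distinct (map f es)"
    using c f sub by (auto simp: distinct_map cyc_def bij_betw_def intro: inj_on_subset)
  moreover have "distinct (map m vs)"
    using c m vsub by (auto simp: distinct_map cyc_def intro: inj_on_subset)
  moreover have "set (map f es) \<subseteq> Z'" using sub f by (auto simp: bij_betw_def)
  moreover have "{s' (map f es ! i), t' (map f es ! i)} = {map m vs ! i, map m vs ! (Suc i mod length es)}"
    if i: "i < length es" for i
  proof -
    have "es ! i \<in> Z" using sub i by auto
    then have "{s' (map f es ! i), t' (map f es ! i)} = m ` {s (es ! i), t (es ! i)}"
      using st i by simp
    also have "\<dots> = m ` {vs ! i, vs ! (Suc i mod length es)}" using cyc_ends[OF c i] by simp
    finally show ?thesis using i len mod_less_divisor[OF ne] by simp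
  qed
  ultimately show ?thesis using c by (simp add: cyc_def)
qed

lemma denum_transport:
  assumes d: "denum s t C es" and "C \<subseteq> Z" and f: "bij_betw f Z Z'"
    and st: "\<And>e. e \<in> Z \<Longrightarrow> s' (f e) = m (s e)" "\<And>e. e \<in> Z \<Longrightarrow> t' (f e) = m (t e)"
  shows "denum s' t' (f ` C) (map f es)"
proof -
  have sub: "set es \<subseteq> Z" and ne: "0 < length es" using d assms(2) by (auto simp: denum_def)
  have "distinct (map f es)"
    using d f sub by (auto simp: distinct_map denum_def bij_betw_def intro: inj_on_subset)
  moreover have "s' (map f es ! i) = t' (map f es ! (Suc i mod length es))" if i: "i < length es" for i
  proof -
    have j: "Suc i mod length es < length es" using mod_less_divisor[OF ne] .
    have "es ! i \<in> Z" "es ! (Suc i mod length es) \<in> Z" using sub i j nth_mem by blast+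
    then show ?thesis using st i j d by (simp add: denum_def)
  qed
  ultimately show ?thesis using d by (simp add: denum_def)
qed

lemma cycles_transport_subset:
  assumes f: "bij_betw f Z Z'" and m: "inj_on m (s ` Z \<union> t ` Z)"
    and st: "\<And>e. e \<in> Z \<Longrightarrow> s' (f e) = m (s e)" "\<And>e. e \<in> Z \<Longrightarrow> t' (f e) = m (t e)"
    and C: "C \<in> cycles s t Z"
  shows "f ` C \<in> cycles s' t' Z'"
proof -
  obtain es vs where c: "cyc s t Z es vs" "C = set es" using C by (auto simp: cycles_def)
  then have "cyc s' t' Z' (map f es) (map m vs)" using cyc_transport[OF c(1) f m st] by blast
  then have "set (map f es) \<in> cycles s' t' Z'" by (rule cyc_in_cycles)
  then show ?thesis using c(2) by simp
qed

text \<open>An isomorphism matches the cycles and their directed enumerations; \<open>m\<close> is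
  injective on the vertices that carry an edge. Cyclic invariance enters because the enumeration
  chosen for the image of a pad need not be the image of the chosen one.\<close>

lemma weight_transport:
  assumes \<kappa>: "cyclic_invariant \<kappa>" and f: "bij_betw f Z Z'" and m: "inj_on m (s ` Z \<union> t ` Z)"
    and st: "\<And>e. e \<in> Z \<Longrightarrow> s' (f e) = m (s e)" "\<And>e. e \<in> Z \<Longrightarrow> t' (f e) = m (t e)"
    and l: "\<And>e. e \<in> Z \<Longrightarrow> l' (f e) = l e"
  shows "weight \<kappa> s' t' l' Z' = weight \<kappa> s t l Z"
proof -
  define g where "g = the_inv_into Z f"
  define m' where "m' = the_inv_into (s ` Z \<union> t ` Z) m"
  have fi: "inj_on f Z" and fZ: "f ` Z = Z'" using f by (auto simp: bij_betw_def)
  have g: "bij_betw g Z' Z" unfolding g_def by (rule bij_betw_the_inv_into[OF f])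
  have gf: "g (f e) = e" if "e \<in> Z" for e using the_inv_into_f_f[OF fi that] by (simp add: g_def)
  have fg: "f (g e) = e" if "e \<in> Z'" for e
    using f_the_inv_into_f_bij_betw[OF f] that by (simp add: g_def)
  have gZ: "g e \<in> Z" if "e \<in> Z'" for e using g that by (auto simp: bij_betw_def)
  have m'm: "m' (m v) = v" if "v \<in> s ` Z \<union> t ` Z" for v
    using the_inv_into_f_f[OF m that] by (simp add: m'_def)
  have st': "s (g e) = m' (s' e)" "t (g e) = m' (t' e)" if "e \<in> Z'" for e
    using st[of "g e"] gZ[OF that] fg[OF that] m'm by auto
  have img: "s' ` Z' \<union> t' ` Z' = m ` (s ` Z \<union> t ` Z)"
    unfolding fZ[symmetric] image_Un image_image using st by (auto simp: image_iff)
  have m'i: "inj_on m' (s' ` Z' \<union> t' ` Z')"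
    unfolding img by (rule inj_on_inverseI[where g = m]) (use m'm in auto)
  have gfC: "g ` f ` C = C" if "C \<subseteq> Z" for C using that gf by (force simp: image_image)
  have fgC: "f ` g ` C = C" if "C \<subseteq> Z'" for C using that fg by (force simp: image_image)
  have cyc1: "f ` C \<in> cycles s' t' Z'" if "C \<in> cycles s t Z" for C
    by (rule cycles_transport_subset[OF f m st that])
  have cyc2: "g ` C \<in> cycles s t Z" if "C \<in> cycles s' t' Z'" for C
    by (rule cycles_transport_subset[OF g m'i st' that])
  have cyc_eq: "cycles s' t' Z' = (`) f ` cycles s t Z"
  proof
    show "cycles s' t' Z' \<subseteq> (`) f ` cycles s t Z"
    proof
      fix C assume C: "C \<in> cycles s' t' Z'"
      then show "C \<in> (`) f ` cycles s t Z" using cyc2[OF C] fgC[OF cycles_subset[OF C]] by (metis imageI)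
    qed
  qed (use cyc1 in auto)
  have inj_img: "inj_on ((`) f) (cycles s t Z)"
    by (rule inj_on_inverseI[where g = "(`) g"]) (rule gfC[OF cycles_subset])
  have mem: "f e \<in> f ` C \<longleftrightarrow> e \<in> C" if "e \<in> Z" "C \<in> cycles s t Z" for e C
    using inj_on_image_mem_iff[OF fi that(1) cycles_subset[OF that(2)]] .
  have uni: "(\<exists>!C. C \<in> cycles s' t' Z' \<and> f e \<in> C) \<longleftrightarrow> (\<exists>!C. C \<in> cycles s t Z \<and> e \<in> C)" if e: "e \<in> Z" for e
  proof
    assume "\<exists>!C. C \<in> cycles s t Z \<and> e \<in> C"
    then obtain C where C: "C \<in> cycles s t Z" "e \<in> C" "\<And>D. D \<in> cycles s t Z \<Longrightarrow> e \<in> D \<Longrightarrow> D = C" by blast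
    show "\<exists>!C. C \<in> cycles s' t' Z' \<and> f e \<in> C"
    proof (rule ex1I[of _ "f ` C"])
      show "f ` C \<in> cycles s' t' Z' \<and> f e \<in> f ` C" using C cyc1 by blast
      fix D' assume "D' \<in> cycles s' t' Z' \<and> f e \<in> D'"
      then obtain D where "D' = f ` D" "D \<in> cycles s t Z" "f e \<in> f ` D" using cyc_eq by blast
      then show "D' = f ` C" using C(3) mem[OF e] by blast
    qed
  next
    assume "\<exists>!C. C \<in> cycles s' t' Z' \<and> f e \<in> C"
    then obtain C' where C': "C' \<in> cycles s' t' Z'" "f e \<in> C'"
        "\<And>D. D \<in> cycles s' t' Z' \<Longrightarrow> f e \<in> D \<Longrightarrow> D = C'" by blast
    then obtain C where C: "C' = f ` C" "C \<in> cycles s t Z" using cyc_eq by blast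
    show "\<exists>!C. C \<in> cycles s t Z \<and> e \<in> C"
    proof (rule ex1I[of _ C])
      show "C \<in> cycles s t Z \<and> e \<in> C" using C C'(2) mem[OF e] by blast
      fix D assume D: "D \<in> cycles s t Z \<and> e \<in> D"
      then have "f ` D = f ` C" using C'(3)[of "f ` D"] cyc1 C(1) by blast
      then show "D = C" using inj_img D C(2) by (auto dest: inj_onD)
    qed
  qed
  have 1: "(\<forall>e\<in>Z'. \<exists>!C. C \<in> cycles s' t' Z' \<and> e \<in> C) \<longleftrightarrow> (\<forall>e\<in>Z. \<exists>!C. C \<in> cycles s t Z \<and> e \<in> C)"
    unfolding fZ[symmetric] ball_simps(9) using uni fZ by (intro ball_cong) auto
  have den1: "denum s' t' (f ` C) (map f es)" if "C \<in> cycles s t Z" "denum s t C es" for C es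
    by (rule denum_transport[OF that(2) cycles_subset[OF that(1)] f st])
  have den2: "\<exists>es. denum s t C es" if "C \<in> cycles s t Z" "denum s' t' (f ` C) es" for C es
  proof -
    have "f ` C \<subseteq> Z'" using cycles_subset[OF cyc1[OF that(1)]] .
    from denum_transport[OF that(2) this g st'] have "denum s t (g ` f ` C) (map g es)" .
    then show ?thesis using gfC[OF cycles_subset[OF that(1)]] by auto
  qed
  have 2: "(\<forall>C\<in>cycles s' t' Z'. \<exists>es. denum s' t' C es) \<longleftrightarrow> (\<forall>C\<in>cycles s t Z. \<exists>es. denum s t C es)"
    unfolding cyc_eq ball_simps(9) using den1 den2 by (intro ball_cong) auto
  have pw: "pad_weight \<kappa> s' t' l' (f ` C) = pad_weight \<kappa> s t l C"
    if C: "C \<in> cycles s t Z" and d: "denum s t C es" for C es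
  proof -
    have "pad_weight \<kappa> s' t' l' (f ` C) = \<kappa> (map l' (map f es))"
      by (rule pad_weight_denum[OF \<kappa> cyc1[OF C] den1[OF C d]])
    also have "map l' (map f es) = map l es"
      using l d cycles_subset[OF C] by (auto simp: denum_def)
    also have "\<kappa> (map l es) = pad_weight \<kappa> s t l C" by (rule pad_weight_denum[OF \<kappa> C d, symmetric])
    finally show ?thesis .
  qed
  show ?thesis
  proof (cases "\<forall>C\<in>cycles s t Z. \<exists>es. denum s t C es")
    case True
    have "(\<Prod>C\<in>cycles s' t' Z'. pad_weight \<kappa> s' t' l' C) = (\<Prod>C\<in>cycles s t Z. pad_weight \<kappa> s t l C)"
      unfolding cyc_eq prod.reindex[OF inj_img] using True pw by (intro prod.cong) auto
    then show ?thesis unfolding weight_def 1 2 by (rule arg_cong)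
  next
    case False
    then show ?thesis unfolding weight_def 1 2 by (subst (1 2) if_not_P) blast+
  qed
qed

text \<open>Both graphs have their vertices named by a common set \<open>X\<close>, once through
  \<open>p\<close> and once through \<open>p'\<close>; equal kernels yield the isomorphism. In this
  way quotients by relations on different sets are compared without handling their classes.\<close>

lemma weight_cong_kernel:
  assumes \<kappa>: "cyclic_invariant \<kappa>" and f: "bij_betw f Z Z'"
    and s: "\<And>e. e \<in> Z \<Longrightarrow> a e \<in> X \<and> s e = p (a e) \<and> s' (f e) = p' (a e)"
    and t: "\<And>e. e \<in> Z \<Longrightarrow> b e \<in> X \<and> t e = p (b e) \<and> t' (f e) = p' (b e)"
    and l: "\<And>e. e \<in> Z \<Longrightarrow> l' (f e) = l e"
    and pp: "\<And>x y. x \<in> X \<Longrightarrow> y \<in> X \<Longrightarrow> p x = p y \<longleftrightarrow> p' x = p' y"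
  shows "weight \<kappa> s' t' l' Z' = weight \<kappa> s t l Z"
proof -
  define m where "m v = p' (SOME x. x \<in> X \<and> p x = v)" for v
  have mp: "m (p x) = p' x" if "x \<in> X" for x
  proof -
    have "(SOME y. y \<in> X \<and> p y = p x) \<in> X \<and> p (SOME y. y \<in> X \<and> p y = p x) = p x"
      by (rule someI[of _ x]) (use that in simp)
    then show ?thesis unfolding m_def using pp[OF _ that] by blast
  qed
  have "inj_on m (p ` X)" by (rule inj_onI) (use mp pp in auto)
  moreover have "s ` Z \<union> t ` Z \<subseteq> p ` X" using s t by auto
  ultimately have "inj_on m (s ` Z \<union> t ` Z)" by (rule inj_on_subset)
  then show ?thesis using s t l mp by (intro weight_transport[OF \<kappa> f]) auto
qed

section \<open>Quotients of a graph glued to a host graph\<close>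

definition birooted :: "'v set \<Rightarrow> 'e set \<Rightarrow> ('e \<Rightarrow> 'v) \<Rightarrow> ('e \<Rightarrow> 'v) \<Rightarrow> 'v \<Rightarrow> 'v \<Rightarrow> bool" where
  "birooted V J s t i o' \<longleftrightarrow> finite V \<and> finite J \<and> s ` J \<subseteq> V \<and> t ` J \<subseteq> V \<and> i \<in> V \<and> o' \<in> V \<and>
     (\<forall>x\<in>V. \<forall>y\<in>V. (x, y) \<in> (adj s t J)\<^sup>*)"

lemma adj_rtrancl_image:
  assumes "(x, y) \<in> (adj s t Y)\<^sup>*"
    and "\<And>e. e \<in> Y \<Longrightarrow> f e \<in> Y' \<and> S (f e) = p (s e) \<and> T (f e) = p (t e)"
  shows "(p x, p y) \<in> (adj S T Y')\<^sup>*"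
  using assms(1)
proof (induction rule: rtrancl_induct)
  case (step y z)
  obtain e where e: "e \<in> Y" "{s e, t e} = {y, z}" using step(2) by (rule adjE)
  have "{S (f e), T (f e)} = {p y, p z}" using assms(2)[OF e(1)] arg_cong[OF e(2), of "(`) p"] by simp
  then have "(p y, p z) \<in> adj S T Y'" using assms(2)[OF e(1)] unfolding adj_iff by blast
  then show ?case using step(3) by simp
qed simp

text \<open>On a walk towards the cycle, the first cycle edge starts at a cycle vertex, and the part
  of the walk before it avoids the cycle.\<close>

lemma birooted_reaches_cycle:
  assumes g: "birooted V J s t i o'" and c: "cyc s t J es vs" and x: "x \<in> V"
  shows "\<exists>v\<in>set vs. (x, v) \<in> (adj s t (J - set es))\<^sup>*"
proof -
  have ne: "0 < length es" and len: "length vs = length es" using c by (auto simp: cyc_def)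
  have ends: "{s e, t e} \<subseteq> set vs" if e: "e \<in> set es" for e
  proof -
    obtain i where i: "i < length es" "e = es ! i" using e by (metis in_set_conv_nth)
    show ?thesis unfolding i(2) cyc_ends[OF c i(1)] using i(1) mod_less_divisor[OF ne] len by simp
  qed
  have "es ! 0 \<in> J" using c ne by (auto simp: cyc_def)
  then have "{s (es ! 0), t (es ! 0)} \<subseteq> V" using g by (auto simp: birooted_def)
  then have "vs ! 0 \<in> V" using cyc_ends[OF c ne] by auto
  then have "(x, vs ! 0) \<in> (adj s t J)\<^sup>*" using g x by (simp add: birooted_def)
  then show ?thesis
  proof (induction rule: converse_rtrancl_induct)
    case base
    have "vs ! 0 \<in> set vs" using ne len by (intro nth_mem) simp
    then show ?case by blast
  next
    case (step y z)
    obtain e where e: "e \<in> J" "{s e, t e} = {y, z}" using step(1) by (rule adjE)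
    show ?case
    proof (cases "e \<in> set es")
      case True
      then show ?thesis using ends[OF True] e(2) by blast
    next
      case False
      then have "(y, z) \<in> adj s t (J - set es)" using e unfolding adj_iff by blast
      then show ?thesis using step(3) by (meson converse_rtrancl_into_rtrancl)
    qed
  qed
qed

section \<open>The component of the input root after deleting edges\<close>

definition component :: "'v set \<Rightarrow> 'e set \<Rightarrow> ('e \<Rightarrow> 'v) \<Rightarrow> ('e \<Rightarrow> 'v) \<Rightarrow> 'v \<Rightarrow> 'v set" where
  "component V Y s t i = {x \<in> V. (i, x) \<in> (adj s t Y)\<^sup>*}"

definition component_edges :: "'v set \<Rightarrow> 'e set \<Rightarrow> ('e \<Rightarrow> 'v) \<Rightarrow> ('e \<Rightarrow> 'v) \<Rightarrow> 'v \<Rightarrow> 'e set" where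
  "component_edges V Y s t i = {e \<in> Y. s e \<in> component V Y s t i}"

lemma component_edge_iff:
  assumes "s ` Y \<subseteq> V" "t ` Y \<subseteq> V" "e \<in> Y"
  shows "s e \<in> component V Y s t i \<longleftrightarrow> t e \<in> component V Y s t i"
proof -
  have "(s e, t e) \<in> adj s t Y" "(t e, s e) \<in> adj s t Y" using assms(3) by (auto simp: adj_def)
  moreover have "s e \<in> V" "t e \<in> V" using assms by auto
  ultimately show ?thesis unfolding component_def by (auto intro: rtrancl_into_rtrancl)
qed

text \<open>A walk from \<open>i\<close> never leaves the component, so the edges of the component
  suffice to connect it. The result is a birooted graph again and thus open to induction.\<close>

lemma birooted_component:
  assumes g: "birooted V J s t i o'" and Y: "Y \<subseteq> J" and o: "o' \<in> component V Y s t i"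
  shows "birooted (component V Y s t i) (component_edges V Y s t i) s t i o'"
proof -
  let ?V1 = "component V Y s t i" and ?J1 = "component_edges V Y s t i"
  have sV: "s ` Y \<subseteq> V" "t ` Y \<subseteq> V" using g Y by (auto simp: birooted_def)
  note ce = component_edge_iff[OF sV]
  have i: "i \<in> ?V1" using g by (simp add: birooted_def component_def)
  have "x \<in> V \<longrightarrow> (i, x) \<in> (adj s t ?J1)\<^sup>*" if "(i, x) \<in> (adj s t Y)\<^sup>*" for x
    using that
  proof (induction rule: rtrancl_induct)
    case (step y z)
    obtain e where e: "e \<in> Y" "{s e, t e} = {y, z}" using step(2) by (rule adjE)
    have yV: "y \<in> V" using e sV by (auto simp: doubleton_eq_iff)
    then have "y \<in> ?V1" using step(1) by (simp add: component_def)
    then have "s e \<in> ?V1" using e ce[OF e(1)] by (auto simp: doubleton_eq_iff)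
    then have "e \<in> ?J1" using e(1) by (simp add: component_edges_def)
    then have "(y, z) \<in> adj s t ?J1" using e(2) unfolding adj_iff by blast
    then show ?case using step(3) yV by (auto intro: rtrancl_into_rtrancl)
  qed simp
  then have conn: "(i, x) \<in> (adj s t ?J1)\<^sup>*" if "x \<in> ?V1" for x using that by (simp add: component_def)
  have "(x, y) \<in> (adj s t ?J1)\<^sup>*" if "x \<in> ?V1" "y \<in> ?V1" for x y
    using adj_rtrancl_sym[OF conn[OF that(1)]] conn[OF that(2)] by (rule rtrancl_trans)
  moreover have "s ` ?J1 \<subseteq> ?V1" "t ` ?J1 \<subseteq> ?V1" using ce by (auto simp: component_edges_def)
  moreover have "finite ?V1" using g by (simp add: birooted_def component_def)
  moreover have "finite ?J1"
    using g Y by (auto simp: birooted_def component_edges_def intro: finite_subset)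
  ultimately show ?thesis using i o by (simp add: birooted_def)
qed

text \<open>Quotient graphs get chosen representatives as vertices instead of classes. The vertex
  type thus stays the same, so the induction can pass to quotients and still end in monomials with
  natural numbers as vertices.\<close>

definition rep :: "('v \<times> 'v) set \<Rightarrow> 'v \<Rightarrow> 'v" where
  "rep \<sigma> x = (SOME y. (x, y) \<in> \<sigma>)"

lemma rep_related: "equiv V \<sigma> \<Longrightarrow> x \<in> V \<Longrightarrow> (x, rep \<sigma> x) \<in> \<sigma>"
  unfolding rep_def by (rule someI[of _ x]) (auto simp: equiv_def refl_on_def)

lemma rep_in: "equiv V \<sigma> \<Longrightarrow> x \<in> V \<Longrightarrow> rep \<sigma> x \<in> V"
  using rep_related[of V \<sigma> x] by (auto simp: equiv_def)

lemma rep_eq_iff: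
  assumes "equiv V \<sigma>" "x \<in> V" "y \<in> V"
  shows "rep \<sigma> x = rep \<sigma> y \<longleftrightarrow> (x, y) \<in> \<sigma>"
proof
  assume "rep \<sigma> x = rep \<sigma> y"
  then show "(x, y) \<in> \<sigma>"
    using rep_related[OF assms(1,2)] rep_related[OF assms(1,3)] assms(1)
    by (metis equiv_def symD transD)
next
  assume "(x, y) \<in> \<sigma>"
  then have "(x, z) \<in> \<sigma> \<longleftrightarrow> (y, z) \<in> \<sigma>" for z using assms(1) by (meson equiv_def symD transD)
  then show "rep \<sigma> x = rep \<sigma> y" by (simp add: rep_def)
qed

lemma rep_rep: "equiv V \<sigma> \<Longrightarrow> x \<in> V \<Longrightarrow> rep \<sigma> (rep \<sigma> x) = rep \<sigma> x"
  using rep_eq_iff[of V \<sigma> "rep \<sigma> x" x] rep_related[of V \<sigma> x] rep_in[of V \<sigma> x]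
  by (auto simp: equiv_def dest: symD)

lemma birooted_rep:
  assumes g: "birooted V J s t i o'" and \<sigma>: "equiv V \<sigma>"
  shows "birooted (rep \<sigma> ` V) J (rep \<sigma> \<circ> s) (rep \<sigma> \<circ> t) (rep \<sigma> i) (rep \<sigma> o')"
proof -
  have "(rep \<sigma> x, rep \<sigma> y) \<in> (adj (rep \<sigma> \<circ> s) (rep \<sigma> \<circ> t) J)\<^sup>*" if "x \<in> V" "y \<in> V" for x y
    by (rule adj_rtrancl_image[where s = s and t = t and Y = J and f = id])
       (use g that in \<open>auto simp: birooted_def\<close>)
  then show ?thesis using g by (auto simp: birooted_def)
qed

lemma card_rep_less:
  assumes "finite V" "equiv V \<sigma>" "\<sigma> \<noteq> Id_on V"
  shows "card (rep \<sigma> ` V) < card V"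
proof -
  have "Id_on V \<subseteq> \<sigma>" "\<sigma> \<subseteq> V \<times> V" using assms(2) by (auto simp: equiv_def refl_on_def)
  then obtain x y where "(x, y) \<in> \<sigma>" "x \<noteq> y" "x \<in> V" "y \<in> V" using assms(3) by auto
  then have "\<not> inj_on (rep \<sigma>) V" using rep_eq_iff[OF assms(2)] by (auto simp: inj_on_def)
  then have "card (rep \<sigma> ` V) \<noteq> card V" using assms(1) eq_card_imp_inj_on by blast
  then show ?thesis using card_image_le[OF assms(1), of "rep \<sigma>"] by linarith
qed

lemma rep_Id_on: "x \<in> V \<Longrightarrow> rep (Id_on V) x = x"
  by (simp add: rep_def Id_on_iff)

lemma equivD:
  assumes "equiv U R"
  shows "x \<in> U \<Longrightarrow> (x, x) \<in> R" "(x, y) \<in> R \<Longrightarrow> (y, x) \<in> R"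
    "(x, y) \<in> R \<Longrightarrow> (y, z) \<in> R \<Longrightarrow> (x, z) \<in> R" "(x, y) \<in> R \<Longrightarrow> x \<in> U" "(x, y) \<in> R \<Longrightarrow> y \<in> U"
  using assms unfolding equiv_def refl_on_def by (blast dest: symD transD)+

lemma equiv_pull:
  assumes R': "equiv U' R'" and q: "\<And>u. u \<in> U \<Longrightarrow> q u \<in> U'"
  shows "equiv U {(x, y) \<in> U \<times> U. (q x, q y) \<in> R'}"
proof (rule equivI)
  show "refl_on U {(x, y) \<in> U \<times> U. (q x, q y) \<in> R'}"
    using q equivD(1)[OF R'] by (simp add: refl_on_def)
  show "sym {(x, y) \<in> U \<times> U. (q x, q y) \<in> R'}"
    using equivD(2)[OF R'] by (simp add: sym_def)
  show "trans {(x, y) \<in> U \<times> U. (q x, q y) \<in> R'}"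
  proof (rule transI)
    fix x y z assume "(x, y) \<in> {(x, y) \<in> U \<times> U. (q x, q y) \<in> R'}" "(y, z) \<in> {(x, y) \<in> U \<times> U. (q x, q y) \<in> R'}"
    then show "(x, z) \<in> {(x, y) \<in> U \<times> U. (q x, q y) \<in> R'}"
      using equivD(3)[OF R', of "q x" "q y" "q z"] by simp
  qed
qed auto

lemma equiv_restrict:
  assumes "equiv U R" "U' \<subseteq> U"
  shows "equiv U' (R \<inter> U' \<times> U')"
proof -
  have "{(x, y) \<in> U' \<times> U'. (x, y) \<in> R} = R \<inter> U' \<times> U'" by auto
  then show ?thesis using equiv_pull[OF assms(1), of U' "\<lambda>x. x"] assms(2) by auto
qed

lemma finite_equivs: "finite U \<Longrightarrow> finite {R. equiv U R}"
  by (rule finite_subset[of _ "Pow (U \<times> U)"]) (auto simp: equiv_def)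

section \<open>Quotients of the product with a fixed test graph\<close>

locale host =
  fixes \<kappa> :: "'a list \<Rightarrow> complex"
    and Vh :: "'w set" and Jh :: "'f set" and sh th :: "'f \<Rightarrow> 'w" and lh :: "'f \<Rightarrow> 'a" and ih oh :: 'w
  assumes cyclic: "cyclic_invariant \<kappa>" and host: "birooted Vh Jh sh th ih oh"
begin

text \<open>The glued graph is never built: its quotients are the relations on the disjoint sum that
  contain two identifications. The first comes from the product, which glues the input of the graph
  to the output of the host; the second comes from closing up the product.\<close>

definition quotients :: "'v set \<Rightarrow> 'v \<Rightarrow> 'v \<Rightarrow> ('v + 'w) rel set" where
  "quotients V i o' = {R. equiv (V <+> Vh) R \<and> (Inl i, Inr oh) \<in> R \<and> (Inl o', Inr ih) \<in> R}"

definition injective_on :: "'v set \<Rightarrow> ('v + 'w) rel \<Rightarrow> bool" where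
  "injective_on V R \<longleftrightarrow> (\<forall>x\<in>V. \<forall>y\<in>V. (Inl x, Inl y) \<in> R \<longrightarrow> x = y)"

definition wt :: "'e set \<Rightarrow> ('e \<Rightarrow> 'v) \<Rightarrow> ('e \<Rightarrow> 'v) \<Rightarrow> ('e \<Rightarrow> 'a) \<Rightarrow> ('v + 'w) rel \<Rightarrow> complex" where
  "wt J s t l R = weight \<kappa> (\<lambda>e. R `` {map_sum s sh e}) (\<lambda>e. R `` {map_sum t th e}) (case_sum l lh) (J <+> Jh)"

text \<open>When the graph and its host are graph monomials \<open>g\<close> and \<open>h\<close>, \<open>total\<close> is \<open>\<psi>(gh)\<close>; in \<open>inj_total\<close> no
  two vertices of \<open>g\<close> may be identified.\<close>

definition total :: "'v set \<Rightarrow> 'e set \<Rightarrow> ('e \<Rightarrow> 'v) \<Rightarrow> ('e \<Rightarrow> 'v) \<Rightarrow> ('e \<Rightarrow> 'a) \<Rightarrow> 'v \<Rightarrow> 'v \<Rightarrow> complex" where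
  "total V J s t l i o' = (\<Sum>R\<in>quotients V i o'. wt J s t l R)"

definition inj_total :: "'v set \<Rightarrow> 'e set \<Rightarrow> ('e \<Rightarrow> 'v) \<Rightarrow> ('e \<Rightarrow> 'v) \<Rightarrow> ('e \<Rightarrow> 'a) \<Rightarrow> 'v \<Rightarrow> 'v \<Rightarrow> complex" where
  "inj_total V J s t l i o' = (\<Sum>R\<in>{R \<in> quotients V i o'. injective_on V R}. wt J s t l R)"

lemma finite_quotients: "finite V \<Longrightarrow> finite (quotients V i o')"
  using finite_equivs[of "V <+> Vh"] host
  by (auto simp: quotients_def birooted_def intro: finite_subset[rotated])

text \<open>Once its restriction \<open>\<sigma>\<close> to \<open>V\<close> is fixed, a quotient is
  determined by what it does to the representatives of \<open>\<sigma>\<close> and to the host, and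
  it is injective on these representatives.\<close>

lemma total_eq_sum_inj_total:
  assumes g: "birooted V J s t i o'"
  shows "total V J s t l i o' = (\<Sum>\<sigma>\<in>{\<sigma>. equiv V \<sigma>}.
     inj_total (rep \<sigma> ` V) J (rep \<sigma> \<circ> s) (rep \<sigma> \<circ> t) l (rep \<sigma> i) (rep \<sigma> o'))"
proof -
  let ?U = "V <+> Vh"
  define restr where "restr R = {(x, y) \<in> V \<times> V. (Inl x, Inl y) \<in> R}" for R :: "('b + 'w) rel"
  have finV: "finite V" and io: "i \<in> V" "o' \<in> V" using g by (auto simp: birooted_def)
  have ioh: "ih \<in> Vh" "oh \<in> Vh" using host by (auto simp: birooted_def)
  have "restr ` quotients V i o' \<subseteq> {\<sigma>. equiv V \<sigma>}"
    unfolding restr_def quotients_def using equiv_pull[of ?U _ V Inl] by auto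
  then have "total V J s t l i o' = (\<Sum>\<sigma>\<in>{\<sigma>. equiv V \<sigma>}.
      \<Sum>R\<in>{R \<in> quotients V i o'. restr R = \<sigma>}. wt J s t l R)"
    unfolding total_def using finite_quotients[OF finV] finite_equivs[OF finV]
    by (intro sum.group[symmetric])
  also have "\<dots> = (\<Sum>\<sigma>\<in>{\<sigma>. equiv V \<sigma>}.
     inj_total (rep \<sigma> ` V) J (rep \<sigma> \<circ> s) (rep \<sigma> \<circ> t) l (rep \<sigma> i) (rep \<sigma> o'))"
  proof (rule sum.cong[OF refl])
    fix \<sigma> assume "\<sigma> \<in> {\<sigma>. equiv V \<sigma>}"
    then have \<sigma>: "equiv V \<sigma>" by simp
    let ?r = "rep \<sigma>"
    let ?U' = "?r ` V <+> Vh"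
    \<comment> \<open>A retraction of the vertices onto representatives and host vertices;
      restricting to its image and pulling back along it are mutually inverse on the relations
      concerned.\<close>
    define q :: "'b + 'w \<Rightarrow> 'b + 'w" where "q = map_sum ?r id"
    define pull where "pull R' = {(x, y) \<in> ?U \<times> ?U. (q x, q y) \<in> R'}" for R'
    have U': "?U' \<subseteq> ?U" using rep_in[OF \<sigma>] by auto
    have qU: "q u \<in> ?U'" if "u \<in> ?U" for u using that by (auto simp: q_def)
    have qid: "q u = u" if "u \<in> ?U'" for u using that rep_rep[OF \<sigma>] by (auto simp: q_def)
    show "(\<Sum>R\<in>{R \<in> quotients V i o'. restr R = \<sigma>}. wt J s t l R) =
        inj_total (?r ` V) J (?r \<circ> s) (?r \<circ> t) l (?r i) (?r o')"
      unfolding inj_total_def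
    proof (rule sum.reindex_bij_witness[where j = "\<lambda>R. R \<inter> ?U' \<times> ?U'" and i = pull])
      fix R assume "R \<in> {R \<in> quotients V i o'. restr R = \<sigma>}"
      then have R: "equiv ?U R" "(Inl i, Inr oh) \<in> R" "(Inl o', Inr ih) \<in> R" and rs: "restr R = \<sigma>"
        by (auto simp: quotients_def)
      note RD = equivD[OF R(1)]
      have rsD: "(x, y) \<in> \<sigma> \<longleftrightarrow> (Inl x, Inl y) \<in> R" if "x \<in> V" "y \<in> V" for x y
        using rs that by (auto simp: restr_def)
      have uq: "(u, q u) \<in> R" if "u \<in> ?U" for u
        using that
      proof
        fix x assume "x \<in> V" "u = Inl x"
        then show ?thesis using rep_related[OF \<sigma>, of x] rep_in[OF \<sigma>, of x] rsD by (simp add: q_def)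
      qed (use RD(1) that in \<open>auto simp: q_def\<close>)
      have quw: "(q u, q w) \<in> R \<longleftrightarrow> (u, w) \<in> R" if "u \<in> ?U" "w \<in> ?U" for u w
        using uq[OF that(1)] uq[OF that(2)] RD(2,3) by meson
      have pl: "pull (R \<inter> ?U' \<times> ?U') = {(u, w) \<in> ?U \<times> ?U. (q u, q w) \<in> R}"
        using qU by (auto simp: pull_def)
      also have "\<dots> = R" using quw RD(4,5) by auto
      finally show pR: "pull (R \<inter> ?U' \<times> ?U') = R" .
      have "(Inl (?r i), Inr oh) \<in> R" "(Inl (?r o'), Inr ih) \<in> R"
        using quw[of "Inl i" "Inr oh"] quw[of "Inl o'" "Inr ih"] io ioh R(2,3) by (auto simp: q_def)
      then have "R \<inter> ?U' \<times> ?U' \<in> quotients (?r ` V) (?r i) (?r o')"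
        using equiv_restrict[OF R(1) U'] io ioh by (auto simp: quotients_def)
      moreover have "injective_on (?r ` V) (R \<inter> ?U' \<times> ?U')"
        unfolding injective_on_def
      proof (intro ballI impI, elim imageE)
        fix x' y' x y assume "(Inl x', Inl y') \<in> R \<inter> ?U' \<times> ?U'" "x' = ?r x" "y' = ?r y" "x \<in> V" "y \<in> V"
        then show "x' = y'"
          using rsD[of "?r x" "?r y"] rep_in[OF \<sigma>] rep_eq_iff[OF \<sigma>, of "?r x" "?r y"] rep_rep[OF \<sigma>] by auto
      qed
      ultimately show "R \<inter> ?U' \<times> ?U' \<in> {R \<in> quotients (?r ` V) (?r i) (?r o'). injective_on (?r ` V) R}"
        by simp
      let ?R' = "R \<inter> ?U' \<times> ?U'"
      have eqR': "equiv ?U' ?R'" by (rule equiv_restrict[OF R(1) U'])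
      show "wt J (?r \<circ> s) (?r \<circ> t) l ?R' = wt J s t l R"
        unfolding wt_def
      proof (rule weight_cong_kernel[OF cyclic, where f = id and X = ?U and a = "map_sum s sh"
            and b = "map_sum t th" and p = "\<lambda>u. R `` {u}" and p' = "\<lambda>u. ?R' `` {q u}"])
        fix x y assume xy: "x \<in> ?U" "y \<in> ?U"
        have "(R `` {x} = R `` {y}) \<longleftrightarrow> (x, y) \<in> R" using eq_equiv_class_iff[OF R(1) xy] .
        also have "\<dots> \<longleftrightarrow> (q x, q y) \<in> ?R'" using quw[OF xy] qU xy by blast
        also have "\<dots> \<longleftrightarrow> ?R' `` {q x} = ?R' `` {q y}"
          using eq_equiv_class_iff[OF eqR' qU[OF xy(1)] qU[OF xy(2)]] by simp
        finally show "(R `` {x} = R `` {y}) \<longleftrightarrow> (?R' `` {q x} = ?R' `` {q y})" .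
      qed (use g host in \<open>auto simp: q_def birooted_def\<close>)
    next
      fix R' assume "R' \<in> {R \<in> quotients (?r ` V) (?r i) (?r o'). injective_on (?r ` V) R}"
      then have R': "equiv ?U' R'" "(Inl (?r i), Inr oh) \<in> R'" "(Inl (?r o'), Inr ih) \<in> R'"
        and inj: "injective_on (?r ` V) R'" by (auto simp: quotients_def)
      note RD = equivD[OF R'(1)]
      have "(Inl (?r x), Inl (?r x)) \<in> R'" if "x \<in> V" for x using that by (intro RD(1)) auto
      then have "restr (pull R') = {(x, y) \<in> V \<times> V. ?r x = ?r y}"
        using inj by (auto simp: restr_def pull_def q_def injective_on_def)
      also have "\<dots> = \<sigma>" using rep_eq_iff[OF \<sigma>] equivD(4,5)[OF \<sigma>] by auto
      finally have "restr (pull R') = \<sigma>" .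
      moreover have "equiv ?U (pull R')" unfolding pull_def by (rule equiv_pull[OF R'(1) qU])
      moreover have "(Inl i, Inr oh) \<in> pull R'" "(Inl o', Inr ih) \<in> pull R'"
        using R'(2,3) io ioh by (auto simp: pull_def q_def)
      ultimately show "pull R' \<in> {R \<in> quotients V i o'. restr R = \<sigma>}" by (simp add: quotients_def)
      show "pull R' \<inter> ?U' \<times> ?U' = R'"
      proof (intro equalityI subrelI)
        fix u w assume uw: "(u, w) \<in> pull R' \<inter> ?U' \<times> ?U'"
        then have "u \<in> ?U'" "w \<in> ?U'" by blast+
        moreover have "(q u, q w) \<in> R'" using uw by (simp add: pull_def)
        ultimately show "(u, w) \<in> R'" by (simp only: qid)
      next
        fix u w assume uw: "(u, w) \<in> R'"
        then have U: "u \<in> ?U'" "w \<in> ?U'" using RD(4)[OF uw] RD(5)[OF uw] by blast+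
        then have "(u, w) \<in> pull R'" using uw U' unfolding pull_def by (simp only: mem_Collect_eq prod.case mem_Times_iff fst_conv snd_conv qid) blast
        then show "(u, w) \<in> pull R' \<inter> ?U' \<times> ?U'" using U by blast
      qed
    qed
  qed
  finally show ?thesis .
qed

text \<open>In a quotient of nonzero weight the cycle is a pad, and deleting it leaves its vertices
  unconnected even through the host. The connected host therefore touches only the root component
  \<open>V1\<close>. The constant is the weight of the pad times that of the pieces hanging off the
  other vertices of the cycle, whose edges are \<open>Y - J1\<close>.\<close>

lemma inj_total_peel:
  assumes g: "birooted V J s t i o'" and c: "cyc s t J es vs"
  defines "Y \<equiv> J - set es"
  defines "V1 \<equiv> component V Y s t i" and "J1 \<equiv> component_edges V Y s t i"
  shows "inj_total V J s t l i o' =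
    (if o' \<in> V1 \<and> separated s t Y (set vs) \<and> (\<exists>es'. denum s t (set es) es')
     then pad_weight \<kappa> s t l (set es) * weight \<kappa> s t l (Y - J1) * inj_total V1 J1 s t l i o' else 0)"
proof -
  let ?U = "V <+> Vh" and ?U1 = "V1 <+> Vh" and ?C = "set es" and ?Z = "J <+> Jh" and ?L = "case_sum l lh"
  \<comment> \<open>A property of the graph alone: neither the host nor the quotient occurs in
    it.\<close>
  define good where "good \<longleftrightarrow> o' \<in> V1 \<and> separated s t Y (set vs) \<and> (\<exists>es'. denum s t ?C es')"
  define D where "D = {R \<in> quotients V i o'. injective_on V R}"
  \<comment> \<open>Outside \<open>D1\<close> a host vertex meets a component other than that of the
    roots; two vertices of the cycle are then joined through the host, and the weight
    vanishes.\<close>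
  define D1 where "D1 = {R \<in> D. \<forall>x\<in>V. \<forall>y\<in>Vh. (Inl x, Inr y) \<in> R \<longrightarrow> x \<in> V1}"
  have fin: "finite V" "finite J" "finite Jh" using g host by (auto simp: birooted_def)
  have sJ: "s e \<in> V" "t e \<in> V" if "e \<in> J" for e using g that by (auto simp: birooted_def)
  have shJ: "sh e \<in> Vh" "th e \<in> Vh" if "e \<in> Jh" for e using host that by (auto simp: birooted_def)
  have io: "i \<in> V" "o' \<in> V" using g by (auto simp: birooted_def)
  have ioh: "ih \<in> Vh" "oh \<in> Vh" using host by (auto simp: birooted_def)
  have CJ: "?C \<subseteq> J" using c by (simp add: cyc_def)
  have YJ: "Y \<subseteq> J" by (auto simp: Y_def)
  have V1V: "V1 \<subseteq> V" by (auto simp: V1_def component_def)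
  have U1: "?U1 \<subseteq> ?U" using V1V by auto
  have iV1: "i \<in> V1" using io by (simp add: V1_def component_def)
  have sY: "s ` Y \<subseteq> V" "t ` Y \<subseteq> V" using sJ YJ by auto
  note ce = component_edge_iff[OF sY, folded V1_def]
  have vsV: "set vs \<subseteq> V"
  proof
    fix v assume "v \<in> set vs"
    then obtain k where k: "k < length es" "v = vs ! k" using c by (auto simp: cyc_def in_set_conv_nth)
    then have "v \<in> {s (es ! k), t (es ! k)}" using cyc_ends[OF c k(1)] by blast
    moreover have "es ! k \<in> J" using k(1) CJ by auto
    ultimately show "v \<in> V" using sJ by auto
  qed

  have quot: "wt J s t l R = 0 \<or> good \<and> R \<in> D1"
    and factor: "good \<Longrightarrow> R \<in> D1 \<Longrightarrow>
      wt J s t l R = pad_weight \<kappa> s t l ?C * weight \<kappa> s t l (Y - J1) * wt J1 s t l (R \<inter> ?U1 \<times> ?U1)"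
    if RD0: "R \<in> D" for R
  proof -
    have R: "equiv ?U R" "(Inl i, Inr oh) \<in> R" "(Inl o', Inr ih) \<in> R"
      and injR: "\<And>x y. x \<in> V \<Longrightarrow> y \<in> V \<Longrightarrow> (Inl x, Inl y) \<in> R \<Longrightarrow> x = y"
      using RD0 by (auto simp: D_def quotients_def injective_on_def)
    note RD = equivD[OF R(1)]
    define q where "q u = R `` {u}" for u
    define S where "S e = q (map_sum s sh e)" for e
    define T where "T e = q (map_sum t th e)" for e
    have qeq: "q u = q w \<longleftrightarrow> (u, w) \<in> R" if "u \<in> ?U" "w \<in> ?U" for u w
      unfolding q_def by (rule eq_equiv_class_iff[OF R(1) that])
    have qinj: "x = y" if "x \<in> V" "y \<in> V" "q (Inl x) = q (Inl y)" for x y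
      using qeq[of "Inl x" "Inl y"] that injR by auto
    have wtR: "wt J s t l R = weight \<kappa> S T ?L ?Z" unfolding wt_def S_def T_def q_def ..
    have SI: "S (Inl e) = q (Inl (s e))" "T (Inl e) = q (Inl (t e))" for e by (simp_all add: S_def T_def)
    have SR: "S (Inr e) = q (Inr (sh e))" "T (Inr e) = q (Inr (th e))" for e by (simp_all add: S_def T_def)
    have injm: "inj_on (\<lambda>x. q (Inl x)) V" by (rule inj_onI) (rule qinj)
    have ZC: "?Z - Inl ` ?C = Y <+> Jh" by (auto simp: Y_def)
    have connI: "(q (Inl x), q (Inl y)) \<in> (adj S T (Y <+> Jh))\<^sup>*" if "(x, y) \<in> (adj s t Y)\<^sup>*" for x y
      by (rule adj_rtrancl_image[OF that, where f = Inl]) (auto simp: SI)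
    have connR: "(q (Inr x), q (Inr y)) \<in> (adj S T (Y <+> Jh))\<^sup>*" if "x \<in> Vh" "y \<in> Vh" for x y
    proof -
      have "(x, y) \<in> (adj sh th Jh)\<^sup>*" using host that by (simp add: birooted_def)
      then show ?thesis by (rule adj_rtrancl_image[where f = Inr]) (auto simp: SR)
    qed
    have "cyc S T (Inl ` J) (map Inl es) (map (\<lambda>x. q (Inl x)) vs)"
    proof (rule cyc_transport[OF c])
      show "bij_betw Inl J (Inl ` J)" by (simp add: bij_betw_def)
      show "inj_on (\<lambda>x. q (Inl x)) (s ` J \<union> t ` J)" using sJ by (intro inj_on_subset[OF injm]) auto
    qed (simp_all add: SI)
    then have cR: "cyc S T ?Z (map Inl es) (map (\<lambda>x. q (Inl x)) vs)"
      by (rule cyc_mono) (use CJ in auto)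
    have sepD: "separated s t Y (set vs)"
      if sepR: "separated S T (Y <+> Jh) ((\<lambda>x. q (Inl x)) ` set vs)"
      unfolding separated_def
    proof (intro ballI impI)
      fix x y assume xy: "x \<in> set vs" "y \<in> set vs" "(x, y) \<in> (adj s t Y)\<^sup>*"
      then have "q (Inl x) = q (Inl y)" using connI[OF xy(3)] sepR by (simp add: separated_def)
      then show "x = y" using qinj xy vsV by blast
    qed
    \<comment> \<open>Each vertex reaches the cycle inside the graph itself. Even if a connection
      uses the host, separation forces both ends to reach the same cycle vertex, so they are
      connected without the host.\<close>
    have connD: "(x, y) \<in> (adj s t Y)\<^sup>*"
      if sepR: "separated S T (Y <+> Jh) ((\<lambda>x. q (Inl x)) ` set vs)"
        and xy: "x \<in> V" "y \<in> V" "(q (Inl x), q (Inl y)) \<in> (adj S T (Y <+> Jh))\<^sup>*" for x y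
    proof -
      obtain a where a: "a \<in> set vs" "(x, a) \<in> (adj s t Y)\<^sup>*"
        using birooted_reaches_cycle[OF g c xy(1)] by (auto simp: Y_def)
      obtain b where b: "b \<in> set vs" "(y, b) \<in> (adj s t Y)\<^sup>*"
        using birooted_reaches_cycle[OF g c xy(2)] by (auto simp: Y_def)
      have "(q (Inl a), q (Inl b)) \<in> (adj S T (Y <+> Jh))\<^sup>*"
        using connI[OF adj_rtrancl_sym[OF a(2)]] xy(3) connI[OF b(2)] by (meson rtrancl_trans)
      then have "q (Inl a) = q (Inl b)" using sepR a(1) b(1) by (simp add: separated_def)
      then have "a = b" using qinj a(1) b(1) vsV by blast
      then show ?thesis using a(2) adj_rtrancl_sym[OF b(2)] by (meson rtrancl_trans)
    qed
    show "wt J s t l R = 0 \<or> good \<and> R \<in> D1"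
    proof (cases "wt J s t l R = 0")
      case nz: False
      have "separated S T (?Z - set (map Inl es)) (set (map (\<lambda>x. q (Inl x)) vs))"
        using weight_zero_chord[OF cR] nz wtR by metis
      then have sepR: "separated S T (Y <+> Jh) ((\<lambda>x. q (Inl x)) ` set vs)" by (simp add: ZC)
      have iq: "q (Inl i) = q (Inr oh)" using qeq[of "Inl i" "Inr oh"] R(2) io ioh by auto
      have oq: "q (Inl o') = q (Inr ih)" using qeq[of "Inl o'" "Inr ih"] R(3) io ioh by auto
      \<comment> \<open>The host joins its own two roots, which are merged with \<open>i\<close> and
        \<open>o'\<close>.\<close>
      have "(i, o') \<in> (adj s t Y)\<^sup>*"
        using connD[OF sepR io] connR[OF ioh(2,1)] iq oq by simp
      then have "o' \<in> V1" using io by (simp add: V1_def component_def)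
      moreover have "x \<in> V1" if "x \<in> V" "y \<in> Vh" "(Inl x, Inr y) \<in> R" for x y
      proof -
        have "q (Inl x) = q (Inr y)" using qeq[of "Inl x" "Inr y"] that by auto
        then have "(i, x) \<in> (adj s t Y)\<^sup>*"
          using connD[OF sepR io(1) that(1)] connR[OF ioh(2) that(2)] iq by simp
        then show ?thesis using that(1) by (simp add: V1_def component_def)
      qed
      \<comment> \<open>A directed enumeration of the image pad consists of edges of the graph;
        injectivity on \<open>V\<close> turns equality of classes back into equality of
        vertices.\<close>
      moreover have "\<exists>es'. denum s t ?C es'"
      proof -
        have "set (map Inl es) \<in> cycles S T ?Z" by (rule cyc_in_cycles[OF cR])
        then obtain fs where fs: "denum S T (Inl ` ?C) fs"
          using weight_zero_undirected[of _ S T ?Z \<kappa> ?L] nz wtR by auto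
        then have ne: "0 < length fs" and d: "distinct fs" and set: "set fs = Inl ` ?C"
          and st: "\<And>k. k < length fs \<Longrightarrow> S (fs ! k) = T (fs ! (Suc k mod length fs))"
          by (auto simp: denum_def)
        define gs where "gs = map projl fs"
        have fg: "fs = map Inl gs" unfolding gs_def map_map
          by (rule map_idI[symmetric]) (use set in auto)
        have set_gs: "set gs = ?C" unfolding gs_def set_map set by (simp add: image_image)
        have len: "length gs = length fs" by (simp add: gs_def)
        have "s (gs ! k) = t (gs ! (Suc k mod length gs))" if "k < length gs" for k
        proof -
          have k': "Suc k mod length gs < length gs" using ne len by (intro mod_less_divisor) simp
          have "q (Inl (s (gs ! k))) = q (Inl (t (gs ! (Suc k mod length gs))))"
          proof -
            have "fs ! j = Inl (gs ! j)" if "j < length gs" for j using that by (subst fg) simp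
            then show ?thesis using st[of k] that k' by (simp add: len[symmetric] SI)
          qed
          moreover have "gs ! k \<in> J" "gs ! (Suc k mod length gs) \<in> J"
            using nth_mem[OF that] nth_mem[OF k'] set_gs CJ by auto
          ultimately show ?thesis using qinj sJ by blast
        qed
        moreover have "distinct gs" using d unfolding fg by (simp add: distinct_map)
        ultimately have "denum s t ?C gs" using set_gs ne len by (auto simp: denum_def)
        then show ?thesis ..
      qed
      ultimately show ?thesis using sepD[OF sepR] RD0 unfolding good_def D1_def by blast
    qed simp
    assume gd: good and RD1: "R \<in> D1"
    then have sep: "separated s t Y (set vs)" and oV1: "o' \<in> V1" by (auto simp: good_def)
    obtain es' where d: "denum s t ?C es'" using gd by (auto simp: good_def)
    have notV1: "x \<in> V1" if "x \<in> V" "y \<in> Vh" "(Inl x, Inr y) \<in> R" for x y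
      using RD1 that by (auto simp: D1_def)
    \<comment> \<open>From a cycle vertex outside \<open>V1\<close> a walk never meets the host:
      every vertex it reaches is again outside \<open>V1\<close>, and by \<open>D1\<close> no host
      vertex is merged with it. So the walk takes place in \<open>Y\<close>, where
      \<open>sep\<close> applies.\<close>
    have sep1: "a = b" if a: "a \<in> set vs" "a \<notin> V1" and b: "b \<in> set vs"
      and conn: "(q (Inl a), q (Inl b)) \<in> (adj S T (Y <+> Jh))\<^sup>*" for a b
    proof -
      have aV: "a \<in> V" using a vsV by auto
      have "\<exists>y\<in>V. v = q (Inl y) \<and> (a, y) \<in> (adj s t Y)\<^sup>*"
        if "(q (Inl a), v) \<in> (adj S T (Y <+> Jh))\<^sup>*" for v
        using that
      proof (induction rule: rtrancl_induct)
        case base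
        then show ?case using aV by blast
      next
        case (step u w)
        then obtain y where y: "y \<in> V" "u = q (Inl y)" "(a, y) \<in> (adj s t Y)\<^sup>*" by blast
        have yV1: "y \<notin> V1"
        proof
          assume "y \<in> V1"
          then have "(i, a) \<in> (adj s t Y)\<^sup>*"
            using adj_rtrancl_sym[OF y(3)] by (auto simp: V1_def component_def)
          then show False using a(2) aV by (simp add: V1_def component_def)
        qed
        obtain e where e: "e \<in> Y <+> Jh" "{S e, T e} = {u, w}" using step(2) by (rule adjE)
        from e(1) show ?case
        proof
          fix j assume j: "j \<in> Y" "e = Inl j"
          have jV: "s j \<in> V" "t j \<in> V" using sY j(1) by auto
          have eq: "{q (Inl (s j)), q (Inl (t j))} = {q (Inl y), w}" using e(2) j(2) y(2) by (simp add: SI)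
          \<comment> \<open>\<open>z\<close> is the other end of edge \<open>j\<close>, and
            \<open>y\<close> itself for a loop.\<close>
          have "{s j, t j} = {y, z} \<and> w = q (Inl z)" if "z = (if s j = y then t j else s j)" for z
          proof (cases "s j = y")
            case True
            then show ?thesis using eq that by (auto simp: doubleton_eq_iff)
          next
            case False
            then have "q (Inl (s j)) \<noteq> q (Inl y)" using qinj jV y(1) by blast
            then have "q (Inl (t j)) = q (Inl y)" "w = q (Inl (s j))" using eq by (auto simp: doubleton_eq_iff)
            moreover from this have "t j = y" using qinj jV y(1) by blast
            ultimately show ?thesis using False that by auto
          qed
          then obtain z where z: "{s j, t j} = {y, z}" "w = q (Inl z)" by blast
          then have "z \<in> V" using jV by (auto simp: doubleton_eq_iff)
          moreover have "(y, z) \<in> adj s t Y" using j(1) z(1) unfolding adj_iff by blast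
          then have "(a, z) \<in> (adj s t Y)\<^sup>*" using y(3) by (rule rtrancl_into_rtrancl[rotated])
          ultimately show ?thesis using z(2) by blast
        next
          fix j assume j: "j \<in> Jh" "e = Inr j"
          have "u \<in> {q (Inr (sh j)), q (Inr (th j))}" using e(2) j(2) by (auto simp: SR)
          then obtain z where z: "z \<in> Vh" "u = q (Inr z)" using shJ[OF j(1)] by auto
          then have "(Inl y, Inr z) \<in> R" using qeq[of "Inl y" "Inr z"] y(1,2) by auto
          then show ?thesis using notV1[OF y(1) z(1)] yV1 by blast
        qed
      qed
      from this[OF conn] obtain y where "y \<in> V" "q (Inl b) = q (Inl y)" "(a, y) \<in> (adj s t Y)\<^sup>*" by blast
      moreover from this have "b = y" using qinj b vsV by blast
      ultimately show "a = b" using sep a(1) b by (simp add: separated_def)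
    qed
    have sepR: "separated S T (?Z - set (map Inl es)) (set (map (\<lambda>x. q (Inl x)) vs))"
    proof -
      have "q (Inl a) = q (Inl b)" if ab: "a \<in> set vs" "b \<in> set vs"
        and conn: "(q (Inl a), q (Inl b)) \<in> (adj S T (Y <+> Jh))\<^sup>*" for a b
      proof -
        consider "a \<notin> V1" | "b \<notin> V1" | "a \<in> V1" "b \<in> V1" by blast
        then have "a = b"
        proof cases
          case 1
          then show ?thesis using sep1 ab conn by blast
        next
          case 2
          then show ?thesis using sep1[OF ab(2) _ ab(1) adj_rtrancl_sym[OF conn]] by simp
        next
          case 3
          then have "(i, a) \<in> (adj s t Y)\<^sup>*" "(i, b) \<in> (adj s t Y)\<^sup>*" by (simp_all add: V1_def component_def)
          then have "(a, b) \<in> (adj s t Y)\<^sup>*" using adj_rtrancl_sym by (meson rtrancl_trans)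
          then show ?thesis using sep ab by (simp add: separated_def)
        qed
        then show ?thesis by simp
      qed
      then show ?thesis by (simp add: ZC separated_def)
    qed
    have dR: "denum S T (Inl ` ?C) (map Inl es')"
    proof (rule denum_transport[OF d CJ])
      show "bij_betw Inl J (Inl ` J)" by (simp add: bij_betw_def)
    qed (simp_all add: SI)
    have setC: "set (map Inl es) = Inl ` ?C" by simp
    have finZ: "finite ?Z" using fin by simp
    have "weight \<kappa> S T ?L ?Z = pad_weight \<kappa> S T ?L (Inl ` ?C) * weight \<kappa> S T ?L (Y <+> Jh)"
      using weight_peel[OF finZ cR sepR] dR unfolding setC ZC by blast
    moreover have "pad_weight \<kappa> S T ?L (Inl ` ?C) = pad_weight \<kappa> s t l ?C"
    proof -
      have "Inl ` ?C \<in> cycles S T ?Z" using cyc_in_cycles[OF cR] by simp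
      from pad_weight_denum[OF cyclic this dR]
      have "pad_weight \<kappa> S T ?L (Inl ` ?C) = \<kappa> (map ?L (map Inl es'))" .
      also have "map ?L (map Inl es') = map l es'" by simp
      also have "\<kappa> (map l es') = pad_weight \<kappa> s t l ?C"
        by (rule pad_weight_denum[OF cyclic cyc_in_cycles[OF c] d, symmetric])
      finally show ?thesis .
    qed
    moreover have "weight \<kappa> S T ?L (Y <+> Jh) = weight \<kappa> s t l (Y - J1) * wt J1 s t l (R \<inter> ?U1 \<times> ?U1)"
    proof -
      have J1Y: "J1 \<subseteq> Y" by (auto simp: J1_def component_edges_def)
      have J1V: "s e \<in> V1" "t e \<in> V1" if "e \<in> J1" for e
        using that ce[of e] by (auto simp: J1_def component_edges_def V1_def)
      have YV: "s e \<in> V - V1" "t e \<in> V - V1" if "e \<in> Y - J1" for e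
        using that ce[of e] sY by (auto simp: J1_def component_edges_def V1_def)
      \<comment> \<open>Without the pad the graph falls into two parts with no common vertex,
        because the class of a vertex outside \<open>V1\<close> contains neither vertices of
        \<open>V1\<close> nor of the host.\<close>
      have split: "Y <+> Jh = Inl ` (Y - J1) \<union> (J1 <+> Jh)" using J1Y by auto
      have far: "q (Inl x) \<noteq> q u" if "x \<in> V - V1" "u \<in> ?U1" for x u
        using that(2)
      proof
        fix y assume y: "y \<in> V1" "u = Inl y"
        then show ?thesis using qinj[of x y] that(1) V1V by blast
      next
        fix y assume y: "y \<in> Vh" "u = Inr y"
        then show ?thesis using notV1[of x y] qeq[of "Inl x" "Inr y"] that(1) by auto
      qed
      have apart: "(\<lambda>x. q (Inl x)) ` (V - V1) \<inter> q ` ?U1 = {}"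
      proof (rule equals0I, elim IntE imageE)
        fix v x u assume "v = q (Inl x)" "x \<in> V - V1" "v = q u" "u \<in> ?U1"
        then show False using far by metis
      qed
      have "S ` Inl ` (Y - J1) \<union> T ` Inl ` (Y - J1) \<subseteq> (\<lambda>x. q (Inl x)) ` (V - V1)"
        using YV by (auto simp: SI)
      moreover have "S ` (J1 <+> Jh) \<union> T ` (J1 <+> Jh) \<subseteq> q ` ?U1"
        using J1V shJ by (auto simp: SI SR)
      ultimately have dis: "(S ` Inl ` (Y - J1) \<union> T ` Inl ` (Y - J1)) \<inter> (S ` (J1 <+> Jh) \<union> T ` (J1 <+> Jh)) = {}"
        using apart Int_mono by (metis subset_empty)
      have fins: "finite (Inl ` (Y - J1))" "finite (J1 <+> Jh)"
        using fin YJ J1Y by (auto intro: finite_subset)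
      have "weight \<kappa> S T ?L (Inl ` (Y - J1)) = weight \<kappa> s t l (Y - J1)"
      proof (rule weight_transport[OF cyclic])
        show "bij_betw Inl (Y - J1) (Inl ` (Y - J1))" by (simp add: bij_betw_def)
        show "inj_on (\<lambda>x. q (Inl x)) (s ` (Y - J1) \<union> t ` (Y - J1))"
          using YV by (intro inj_on_subset[OF injm]) auto
      qed (simp_all add: SI)
      moreover have "wt J1 s t l (R \<inter> ?U1 \<times> ?U1) = weight \<kappa> S T ?L (J1 <+> Jh)"
        unfolding wt_def
      proof (rule weight_cong_kernel[OF cyclic, where f = id and X = ?U1 and a = "map_sum s sh"
            and b = "map_sum t th" and p = q and p' = "\<lambda>u. (R \<inter> ?U1 \<times> ?U1) `` {u}"])
        fix x y assume xy: "x \<in> ?U1" "y \<in> ?U1"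
        have "q x = q y \<longleftrightarrow> (x, y) \<in> R" by (rule qeq) (use xy U1 in blast)+
        also have "\<dots> \<longleftrightarrow> (x, y) \<in> R \<inter> ?U1 \<times> ?U1" using xy by blast
        also have "\<dots> \<longleftrightarrow> (R \<inter> ?U1 \<times> ?U1) `` {x} = (R \<inter> ?U1 \<times> ?U1) `` {y}"
          using eq_equiv_class_iff[OF equiv_restrict[OF R(1) U1] xy] by simp
        finally show "q x = q y \<longleftrightarrow> (R \<inter> ?U1 \<times> ?U1) `` {x} = (R \<inter> ?U1 \<times> ?U1) `` {y}" .
      qed (use J1V shJ in \<open>auto simp: S_def T_def\<close>)
      ultimately show ?thesis unfolding split weight_disjoint_union[OF fins dis] by simp
    qed
    ultimately show "wt J s t l R =
        pad_weight \<kappa> s t l ?C * weight \<kappa> s t l (Y - J1) * wt J1 s t l (R \<inter> ?U1 \<times> ?U1)"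
      unfolding wtR by simp
  qed

  have "D1 \<subseteq> D" by (auto simp: D1_def)
  have finD: "finite D" using finite_quotients[OF fin(1)] by (simp add: D_def)
  have tot: "inj_total V J s t l i o' = (\<Sum>R\<in>D. wt J s t l R)" by (simp add: inj_total_def D_def)
  show ?thesis
  proof (cases good)
    case False
    then have "inj_total V J s t l i o' = 0" unfolding tot using quot by (intro sum.neutral) blast
    then show ?thesis using False unfolding good_def by (simp only: if_False)
  next
    case True
    \<comment> \<open>A relation in \<open>D1\<close> is trivial on the vertices outside
      \<open>V1\<close>, so adding this diagonal inverts the restriction to
      \<open>?U1\<close>.\<close>
    let ?E = "Id_on (Inl ` (V - V1)) :: ('b + 'w) rel"
    have "(\<Sum>R\<in>D. wt J s t l R) = (\<Sum>R\<in>D1. wt J s t l R)"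
      using quot \<open>D1 \<subseteq> D\<close> finD by (intro sum.mono_neutral_right) blast+
    also have "\<dots> = (\<Sum>R\<in>D1. pad_weight \<kappa> s t l ?C * weight \<kappa> s t l (Y - J1) * wt J1 s t l (R \<inter> ?U1 \<times> ?U1))"
      using factor[OF _ True] \<open>D1 \<subseteq> D\<close> by (intro sum.cong) blast+
    also have "\<dots> = pad_weight \<kappa> s t l ?C * weight \<kappa> s t l (Y - J1) * (\<Sum>R\<in>D1. wt J1 s t l (R \<inter> ?U1 \<times> ?U1))"
      by (simp add: sum_distrib_left)
    also have "(\<Sum>R\<in>D1. wt J1 s t l (R \<inter> ?U1 \<times> ?U1)) = inj_total V1 J1 s t l i o'"
      unfolding inj_total_def
    proof (rule sum.reindex_bij_witness[where j = "\<lambda>R. R \<inter> ?U1 \<times> ?U1" and i = "\<lambda>R1. R1 \<union> ?E"])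
      have oV1: "o' \<in> V1" using True by (simp add: good_def)
      fix R assume RD1: "R \<in> D1"
      then have R: "equiv ?U R" "(Inl i, Inr oh) \<in> R" "(Inl o', Inr ih) \<in> R"
        and injR: "\<And>x y. x \<in> V \<Longrightarrow> y \<in> V \<Longrightarrow> (Inl x, Inl y) \<in> R \<Longrightarrow> x = y"
        and notV1: "\<And>x y. x \<in> V \<Longrightarrow> y \<in> Vh \<Longrightarrow> (Inl x, Inr y) \<in> R \<Longrightarrow> x \<in> V1"
        by (auto simp: D1_def D_def quotients_def injective_on_def)
      note RD = equivD[OF R(1)]
      have triv: "w = Inl x" if "x \<in> V - V1" "(Inl x, w) \<in> R" for x w
      proof -
        have "w \<in> ?U" using RD(5) that(2) by blast
        then show ?thesis
        proof
          fix y assume "y \<in> V" "w = Inl y"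
          then show ?thesis using injR that by blast
        next
          fix y assume "y \<in> Vh" "w = Inr y"
          then show ?thesis using notV1 that by blast
        qed
      qed
      have inU1: "u \<in> ?U1 \<or> u \<in> Inl ` (V - V1)" if "u \<in> ?U" for u using that by auto
      have "p \<in> R \<inter> ?U1 \<times> ?U1 \<union> ?E" if p: "p \<in> R" for p
      proof -
        obtain u w where uw: "p = (u, w)" by (cases p)
        have U: "u \<in> ?U" "w \<in> ?U" using RD(4,5) p uw by blast+
        consider "u \<in> Inl ` (V - V1)" | "w \<in> Inl ` (V - V1)" | "u \<in> ?U1" "w \<in> ?U1"
          using inU1 U by blast
        then show ?thesis
        proof cases
          case 1
          then have "w = u" using triv p uw by blast
          then show ?thesis using 1 uw by (simp add: Id_on_iff)
        next
          case 2
          then have "u = w" using triv RD(2) p uw by blast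
          then show ?thesis using 2 uw by (simp add: Id_on_iff)
        next
          case 3
          then show ?thesis using p uw by blast
        qed
      qed
      moreover have "?E \<subseteq> R" using RD(1) by auto
      ultimately show "R \<inter> ?U1 \<times> ?U1 \<union> ?E = R" by blast
      have "injective_on V1 (R \<inter> ?U1 \<times> ?U1)" using injR V1V by (auto simp: injective_on_def)
      moreover have "R \<inter> ?U1 \<times> ?U1 \<in> quotients V1 i o'"
        using equiv_restrict[OF R(1) U1] R(2,3) iV1 oV1 ioh by (auto simp: quotients_def)
      ultimately show "R \<inter> ?U1 \<times> ?U1 \<in> {R \<in> quotients V1 i o'. injective_on V1 R}" by simp
    next
      fix R1 assume "R1 \<in> {R \<in> quotients V1 i o'. injective_on V1 R}"
      then have R1: "equiv ?U1 R1" "(Inl i, Inr oh) \<in> R1" "(Inl o', Inr ih) \<in> R1"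
        and inj1: "\<And>x y. x \<in> V1 \<Longrightarrow> y \<in> V1 \<Longrightarrow> (Inl x, Inl y) \<in> R1 \<Longrightarrow> x = y"
        by (auto simp: quotients_def injective_on_def)
      note RD = equivD[OF R1(1)]
      have E: "(u, w) \<in> ?E \<longleftrightarrow> u = w \<and> u \<in> Inl ` (V - V1)" for u w by (auto simp: Id_on_iff)
      have dis: "u \<notin> Inl ` (V - V1)" if "u \<in> ?U1" for u using that by auto
      have "equiv ?U (R1 \<union> ?E)"
      proof (rule equivI)
        show "R1 \<union> ?E \<subseteq> ?U \<times> ?U"
        proof
          fix p assume p: "p \<in> R1 \<union> ?E"
          obtain u w where uw: "p = (u, w)" by (cases p)
          from p show "p \<in> ?U \<times> ?U"
          proof
            assume "p \<in> R1"
            then show ?thesis using RD(4)[of u w] RD(5)[of u w] U1 uw by blast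
          qed (auto simp: Id_on_iff)
        qed
        show "refl_on ?U (R1 \<union> ?E)"
          unfolding refl_on_def
        proof
          fix u assume "u \<in> ?U"
          then have "u \<in> ?U1 \<or> u \<in> Inl ` (V - V1)" by auto
          then show "(u, u) \<in> R1 \<union> ?E" using RD(1) E by blast
        qed
        show "sym (R1 \<union> ?E)" by (rule symI) (use RD(2) E in blast)
        show "trans (R1 \<union> ?E)"
        proof (rule transI)
          fix x y z assume "(x, y) \<in> R1 \<union> ?E" "(y, z) \<in> R1 \<union> ?E"
          then show "(x, z) \<in> R1 \<union> ?E" unfolding Un_iff E using RD(3) by blast
        qed
      qed
      then have "R1 \<union> ?E \<in> quotients V i o'" using R1(2,3) by (simp add: quotients_def)
      moreover have "injective_on V (R1 \<union> ?E)"
        unfolding injective_on_def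
      proof (intro ballI impI)
        fix x y assume "x \<in> V" "y \<in> V" "(Inl x, Inl y) \<in> R1 \<union> ?E"
        then consider "(Inl x, Inl y) \<in> R1" | "(Inl x, Inl y) \<in> ?E" by blast
        then show "x = y"
        proof cases
          case 1
          then have "x \<in> V1" "y \<in> V1" using RD(4,5)[OF 1] by auto
          then show ?thesis using inj1 1 by blast
        qed (simp add: E)
      qed
      moreover have "x \<in> V1" if "(Inl x, Inr y) \<in> R1 \<union> ?E" for x y
      proof -
        have "(Inl x, Inr y) \<in> R1" using that by (auto simp: E)
        then show ?thesis using RD(4) by blast
      qed
      ultimately show "R1 \<union> ?E \<in> D1" by (auto simp: D1_def D_def)
      have "?E \<inter> ?U1 \<times> ?U1 = {}" by auto
      moreover have "R1 \<inter> ?U1 \<times> ?U1 = R1"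
      proof -
        have "R1 \<subseteq> ?U1 \<times> ?U1" using R1(1) by (simp add: equiv_def)
        then show ?thesis by blast
      qed
      ultimately show "(R1 \<union> ?E) \<inter> ?U1 \<times> ?U1 = R1" by blast
    qed simp
    finally show ?thesis using True unfolding tot good_def by (simp only: simp_thms if_True)
  qed
qed

end

section \<open>The functional \<open>\<psi>\<close> as a sum over quotients\<close>

lemma adj_eq_uadj: "adj (esrc E) (etgt E) {..<length E} = uadj E"
  by (auto simp: adj_def uadj_def)

lemma connected_graph_iff:
  "connected_graph V E \<longleftrightarrow> finite V \<and> V \<noteq> {} \<and> esrc E ` {..<length E} \<subseteq> V \<and> etgt E ` {..<length E} \<subseteq> V \<and>
     (\<forall>x\<in>V. \<forall>y\<in>V. (x, y) \<in> (adj (esrc E) (etgt E) {..<length E})\<^sup>*)"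
  unfolding connected_graph_def adj_eq_uadj by auto

lemma is_gmon_iff_birooted:
  "is_gmon (V, E, i, o') \<longleftrightarrow> birooted V {..<length E} (esrc E) (etgt E) i o'"
  by (auto simp: is_gmon_def connected_graph_iff birooted_def)

lemma ucycle_iff_cyc: "ucycle E es vs \<longleftrightarrow> cyc (esrc E) (etgt E) {..<length E} es vs"
  by (auto simp: ucycle_def cyc_def doubleton_eq_iff subset_iff in_set_conv_nth)

lemma pads_eq_cycles: "pads E = cycles (esrc E) (etgt E) {..<length E}"
  by (simp add: pads_def cycles_def ucycle_iff_cyc)

lemma dir_enum_eq_denum: "dir_enum E = denum (esrc E) (etgt E)"
  by (simp add: dir_enum_def denum_def fun_eq_iff)

lemma tau0_eq_weight:
  "tau0 \<phi> V E = (if connected_graph V E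
     then weight (free_cumulant \<phi>) (esrc E) (etgt E) (elab E) {..<length E} else 0)"
proof -
  have "oriented_cactus V E \<longleftrightarrow> connected_graph V E \<and>
     (\<forall>e\<in>{..<length E}. \<exists>!C. C \<in> cycles (esrc E) (etgt E) {..<length E} \<and> e \<in> C) \<and>
     (\<forall>C\<in>cycles (esrc E) (etgt E) {..<length E}. \<exists>es. denum (esrc E) (etgt E) C es)"
    unfolding oriented_cactus_def cactus_def pads_eq_cycles dir_enum_eq_denum Ball_def lessThan_iff by blast
  then show ?thesis
    unfolding tau0_def weight_def pad_weight_def pads_eq_cycles dir_enum_eq_denum by (simp only: simp_thms split: if_split) blast
qed

lemma blk_eq:
  assumes "partition_on V P" "B \<in> P" "v \<in> B"
  shows "blk P v = B"
  unfolding blk_def using assms by (intro the_equality) (auto simp: partition_on_def disjoint_def)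

lemma blk_in:
  assumes "partition_on V P" "v \<in> V"
  shows "blk P v \<in> P"
proof -
  obtain B where "B \<in> P" "v \<in> B" using assms by (auto simp: partition_on_def)
  then show ?thesis using blk_eq[OF assms(1)] by simp
qed

lemma weight_cong:
  assumes "cyclic_invariant \<kappa>"
    and "\<And>e. e \<in> Z \<Longrightarrow> s e = s' e" "\<And>e. e \<in> Z \<Longrightarrow> t e = t' e" "\<And>e. e \<in> Z \<Longrightarrow> l e = l' e"
  shows "weight \<kappa> s t l Z = weight \<kappa> s' t' l' Z"
  by (rule weight_transport[OF assms(1), where f = id and m = id]) (use assms in auto)

lemma quot_edges_nth:
  assumes "j < length E"
  shows "esrc (quot_edges P E) j = blk P (esrc E j)" "etgt (quot_edges P E) j = blk P (etgt E j)"
    "elab (quot_edges P E) j = elab E j"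
  using assms by (simp_all add: quot_edges_def esrc_def etgt_def elab_def split_beta)

text \<open>A quotient of a connected graph is connected, so the case distinction of
  \<open>tau0_eq_weight\<close> disappears.\<close>

lemma tau0_quotient:
  assumes \<kappa>: "cyclic_invariant (free_cumulant \<phi>)" and E: "connected_graph V E" and P: "partition_on V P"
  shows "tau0 \<phi> P (quot_edges P E) =
    weight (free_cumulant \<phi>) (\<lambda>e. blk P (esrc E e)) (\<lambda>e. blk P (etgt E e)) (elab E) {..<length E}"
proof -
  let ?Q = "quot_edges P E"
  have len: "length ?Q = length E" by (simp add: quot_edges_def)
  have sub: "esrc E e \<in> V" "etgt E e \<in> V" if "e < length E" for e
    using E that by (auto simp: connected_graph_def)
  have "(A, B) \<in> (adj (esrc ?Q) (etgt ?Q) {..<length ?Q})\<^sup>*" if AB: "A \<in> P" "B \<in> P" for A B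
  proof -
    obtain x y where xy: "x \<in> A" "y \<in> B" using AB partition_onD3[OF P] by (metis ex_in_conv)
    then have "x \<in> V" "y \<in> V" using AB partition_onD1[OF P] by auto
    then have "(x, y) \<in> (adj (esrc E) (etgt E) {..<length E})\<^sup>*" using E by (simp add: connected_graph_iff)
    then have "(blk P x, blk P y) \<in> (adj (esrc ?Q) (etgt ?Q) {..<length ?Q})\<^sup>*"
      by (rule adj_rtrancl_image[where f = id]) (simp add: len quot_edges_nth)
    then show ?thesis using blk_eq[OF P] AB xy by simp
  qed
  moreover have "finite P" using finite_elements[OF _ P] E by (simp add: connected_graph_def)
  moreover have "P \<noteq> {}" using E partition_onD1[OF P] by (auto simp: connected_graph_def)
  moreover have "esrc ?Q ` {..<length ?Q} \<subseteq> P" "etgt ?Q ` {..<length ?Q} \<subseteq> P"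
    using blk_in[OF P] sub by (auto simp: len quot_edges_nth)
  ultimately have "connected_graph P ?Q" by (simp add: connected_graph_iff)
  then show ?thesis unfolding tau0_eq_weight len
    by (simp only: if_True) (rule weight_cong[OF \<kappa>], simp_all add: quot_edges_nth)
qed

lemma blk_quotient:
  assumes "equiv V R" "v \<in> V"
  shows "blk (V // R) v = R `` {v}"
  using assms by (intro blk_eq[OF partition_on_quotient[OF assms(1)]]) (auto simp: quotientI equivD(1))

text \<open>Partitions are traded for equivalence relations, which can be restricted and pulled back
  along maps as the gluing argument demands.\<close>

lemma tau_eq_sum_equiv:
  assumes \<kappa>: "cyclic_invariant (free_cumulant \<phi>)" and E: "connected_graph V E"
  shows "tau \<phi> V E = (\<Sum>R\<in>{R. equiv V R}.
    weight (free_cumulant \<phi>) (\<lambda>e. R `` {esrc E e}) (\<lambda>e. R `` {etgt E e}) (elab E) {..<length E})"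
  unfolding tau_def
proof (rule sum.reindex_bij_witness[where i = "\<lambda>R. V // R" and j = "\<lambda>P. {(x, y). \<exists>p\<in>P. x \<in> p \<and> y \<in> p}"])
  fix P assume "P \<in> {P. partition_on V P}"
  then have P: "partition_on V P" by simp
  let ?R = "{(x, y). \<exists>p\<in>P. x \<in> p \<and> y \<in> p}"
  show R: "?R \<in> {R. equiv V R}" using equiv_partition_on[OF P] by simp
  show PR: "V // ?R = P" by (rule partition_on_eq_quotient[OF P])
  have "?R `` {v} = blk P v" if "v \<in> V" for v
    using blk_quotient[of V ?R v] R that PR by simp
  moreover have "esrc E e \<in> V" "etgt E e \<in> V" if "e < length E" for e
    using E that by (auto simp: connected_graph_def)
  ultimately show "weight (free_cumulant \<phi>) (\<lambda>e. ?R `` {esrc E e}) (\<lambda>e. ?R `` {etgt E e}) (elab E) {..<length E}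
      = tau0 \<phi> P (quot_edges P E)"
    unfolding tau0_quotient[OF \<kappa> E P] by (intro weight_cong[OF \<kappa>]) auto
next
  fix R assume "R \<in> {R. equiv V R}"
  then have R: "equiv V R" by simp
  show "V // R \<in> {P. partition_on V P}" using partition_on_quotient[OF R] by simp
  show "{(x, y). \<exists>p\<in>V // R. x \<in> p \<and> y \<in> p} = R"
  proof (intro equalityI subrelI)
    fix x y assume "(x, y) \<in> {(x, y). \<exists>p\<in>V // R. x \<in> p \<and> y \<in> p}"
    then obtain z where "(z, x) \<in> R" "(z, y) \<in> R" by (auto simp: quotient_def)
    then show "(x, y) \<in> R" using equivD(2,3)[OF R] by blast
  next
    fix x y assume xy: "(x, y) \<in> R"
    then have xV: "x \<in> V" using equivD(4)[OF R] by blast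
    then have "x \<in> R `` {x}" "y \<in> R `` {x}" using equivD(1)[OF R] xy by blast+
    then show "(x, y) \<in> {(x, y). \<exists>p\<in>V // R. x \<in> p \<and> y \<in> p}" using quotientI[OF xV, of R] by blast
  qed
qed

text \<open>The correspondence between equivalence relations on an image and those on the domain
  that contain the kernel of the map. It turns identifications of vertices into conditions on
  relations.\<close>

lemma sum_equiv_image:
  shows "(\<Sum>R'\<in>{R'. equiv (q ` U) R'}. F R') =
    (\<Sum>R\<in>{R. equiv U R \<and> (\<forall>x\<in>U. \<forall>y\<in>U. q x = q y \<longrightarrow> (x, y) \<in> R)}. F (map_prod q q ` R))"
proof (rule sum.reindex_bij_witness[where i = "\<lambda>R. map_prod q q ` R"
      and j = "\<lambda>R'. {(x, y) \<in> U \<times> U. (q x, q y) \<in> R'}"])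
  fix R' assume "R' \<in> {R'. equiv (q ` U) R'}"
  then have R': "equiv (q ` U) R'" by simp
  let ?R = "{(x, y) \<in> U \<times> U. (q x, q y) \<in> R'}"
  have "equiv U ?R" by (rule equiv_pull[OF R']) simp
  moreover have "(x, y) \<in> ?R" if "x \<in> U" "y \<in> U" "q x = q y" for x y
    using that equivD(1)[OF R', of "q y"] by simp
  ultimately show "?R \<in> {R. equiv U R \<and> (\<forall>x\<in>U. \<forall>y\<in>U. q x = q y \<longrightarrow> (x, y) \<in> R)}" by blast
  show push: "map_prod q q ` ?R = R'"
  proof (intro equalityI subrelI)
    fix u w assume uw: "(u, w) \<in> R'"
    then obtain x y where "x \<in> U" "u = q x" "y \<in> U" "w = q y" using equivD(4,5)[OF R' uw] by blast
    then show "(u, w) \<in> map_prod q q ` ?R" using uw by (intro image_eqI[of _ _ "(x, y)"]) auto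
  qed auto
  show "F (map_prod q q ` ?R) = F R'" by (simp only: push)
next
  fix R assume "R \<in> {R. equiv U R \<and> (\<forall>x\<in>U. \<forall>y\<in>U. q x = q y \<longrightarrow> (x, y) \<in> R)}"
  then have R: "equiv U R" and K: "\<And>x y. x \<in> U \<Longrightarrow> y \<in> U \<Longrightarrow> q x = q y \<Longrightarrow> (x, y) \<in> R" by blast+
  note RD = equivD[OF R]
  let ?R' = "map_prod q q ` R"
  have mem: "(q x, q y) \<in> ?R' \<longleftrightarrow> (x, y) \<in> R" if "x \<in> U" "y \<in> U" for x y
  proof
    assume "(q x, q y) \<in> ?R'"
    then obtain a b where ab: "(a, b) \<in> R" "q x = q a" "q y = q b" by auto
    then have "(x, a) \<in> R" "(b, y) \<in> R" using K RD(4,5)[OF ab(1)] that by auto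
    then show "(x, y) \<in> R" using ab(1) RD(3) by blast
  qed force
  have sub: "?R' \<subseteq> q ` U \<times> q ` U" using RD(4,5) by auto
  have "equiv (q ` U) ?R'"
  proof (rule equivI[OF sub])
    show "refl_on (q ` U) ?R'" unfolding refl_on_def using mem RD(1) by blast
    show "sym ?R'" by (rule symI) (use RD(2) in force)
    show "trans ?R'"
    proof (rule transI)
      fix u v w assume uv: "(u, v) \<in> ?R'" and vw: "(v, w) \<in> ?R'"
      obtain x y z where "x \<in> U" "u = q x" "y \<in> U" "v = q y" "z \<in> U" "w = q z"
        using subsetD[OF sub uv] subsetD[OF sub vw] by auto
      then show "(u, w) \<in> ?R'" using uv vw mem RD(3) by meson
    qed
  qed
  then show "?R' \<in> {R'. equiv (q ` U) R'}" by simp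
  show "{(x, y) \<in> U \<times> U. (q x, q y) \<in> ?R'} = R"
  proof (intro equalityI subrelI)
    fix x y assume "(x, y) \<in> {(x, y) \<in> U \<times> U. (q x, q y) \<in> ?R'}"
    then have "x \<in> U" "y \<in> U" "(q x, q y) \<in> ?R'" by (simp_all only: mem_Collect_eq prod.case mem_Times_iff fst_conv snd_conv)
    then show "(x, y) \<in> R" using mem by simp
  next
    fix x y assume xy: "(x, y) \<in> R"
    have "x \<in> U" "y \<in> U" using RD(4)[OF xy] RD(5)[OF xy] by auto
    then show "(x, y) \<in> {(x, y) \<in> U \<times> U. (q x, q y) \<in> ?R'}" using mem xy by simp
  qed
qed

text \<open>The numerical codes in \<open>gmon_mult\<close> and \<open>delta_edges\<close> amount to
  a map \<open>q\<close> from the disjoint sum of the vertex sets onto the vertices of the closed-up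
  product. Its kernel is generated by the two root identifications, so the quotients of the product
  are those summed in \<open>total\<close>.\<close>

lemma psi_mon_gmon_mult:
  assumes \<kappa>: "cyclic_invariant (free_cumulant \<phi>)"
    and g: "is_gmon (V, E, i, o')" and h: "is_gmon (Vh, Eh, ih, oh)"
  shows "psi_mon \<phi> (gmon_mult (V, E, i, o') (Vh, Eh, ih, oh)) =
    host.total (free_cumulant \<phi>) Vh {..<length Eh} (esrc Eh) (etgt Eh) (elab Eh) ih oh
      V {..<length E} (esrc E) (etgt E) (elab E) i o'"
proof -
  let ?\<kappa> = "free_cumulant \<phi>"
  let ?U = "V <+> Vh"
  let ?J = "{..<length E}" and ?Jh = "{..<length Eh}"
  note gb = g[unfolded is_gmon_iff_birooted] and hb = h[unfolded is_gmon_iff_birooted]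
  interpret host ?\<kappa> Vh ?Jh "esrc Eh" "etgt Eh" "elab Eh" ih oh
    by unfold_locales (fact \<kappa> hb)+
  have io: "i \<in> V" "o' \<in> V" using gb by (auto simp: birooted_def)
  have ioh: "ih \<in> Vh" "oh \<in> Vh" using hb by (auto simp: birooted_def)
  define f2 where "f2 v = (if v = oh then 2 * i else 2 * v + 1)" for v
  \<comment> \<open>Closing up sends the output \<open>2 * o'\<close> of the product to its input
    \<open>f2 ih\<close>.\<close>
  define d where "d v = (if v = 2 * o' then f2 ih else v)" for v
  define q where "q = case_sum (\<lambda>v. d (2 * v)) (\<lambda>v. d (f2 v))"
  have q_simps: "q (Inl v) = d (2 * v)" "q (Inr v) = d (f2 v)" for v by (simp_all add: q_def)
  define E' where "E' = delta_edges (gmon_mult (V, E, i, o') (Vh, Eh, ih, oh))"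
  have mult: "gmon_mult (V, E, i, o') (Vh, Eh, ih, oh) =
      ((\<lambda>v. 2 * v) ` V \<union> f2 ` Vh, relabel (\<lambda>v. 2 * v) E @ relabel f2 Eh, f2 ih, 2 * o')"
    by (simp add: gmon_mult_def f2_def[abs_def] Let_def)
  have V': "delta_vertices (gmon_mult (V, E, i, o') (Vh, Eh, ih, oh)) = q ` ?U"
  proof -
    have "delta_vertices (gmon_mult (V, E, i, o') (Vh, Eh, ih, oh)) = d ` ((\<lambda>v. 2 * v) ` V \<union> f2 ` Vh)"
      unfolding mult delta_vertices_def d_def by simp
    then show ?thesis by (simp only: Plus_def image_Un image_image q_simps)
  qed
  have E': "E' = relabel (\<lambda>v. q (Inl v)) E @ relabel (\<lambda>v. q (Inr v)) Eh"
    unfolding E'_def mult delta_edges_def by (simp add: relabel_def q_simps d_def comp_def split_beta)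
  define f where "f = case_sum (\<lambda>j. j) (\<lambda>j. length E + j)"
  have len: "length E' = length E + length Eh" by (simp add: E' relabel_def)
  have f: "bij_betw f (?J <+> ?Jh) {..<length E'}"
    by (rule bij_betw_byWitness[where f' = "\<lambda>j. if j < length E then Inl j else Inr (j - length E)"])
       (auto simp: f_def len)
  have fs: "esrc E' (f e) = q (map_sum (esrc E) (esrc Eh) e)"
    and ft: "etgt E' (f e) = q (map_sum (etgt E) (etgt Eh) e)"
    and fl: "elab E' (f e) = case_sum (elab E) (elab Eh) e" if "e \<in> ?J <+> ?Jh" for e
    using that by (auto simp: E' f_def relabel_def esrc_def etgt_def elab_def nth_append split_beta)
  have srcU: "map_sum (esrc E) (esrc Eh) e \<in> ?U" "map_sum (etgt E) (etgt Eh) e \<in> ?U"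
    if "e \<in> ?J <+> ?Jh" for e using that gb hb by (auto simp: birooted_def)
  have q1: "q (Inl i) = q (Inr oh)" by (simp add: q_simps f2_def)
  have q2: "q (Inl o') = q (Inr ih)" by (auto simp: q_simps d_def f2_def)
  have fJ: "f e \<in> {..<length E'}" if "e \<in> ?J <+> ?Jh" for e using f that by (auto simp: bij_betw_def)
  have fL: "f (Inl j) < length E' \<and> esrc E' (f (Inl j)) = q (Inl (esrc E j)) \<and>
      etgt E' (f (Inl j)) = q (Inl (etgt E j))" if "j < length E" for j
    using that fs[of "Inl j"] ft[of "Inl j"] fJ[of "Inl j"] by auto
  have fR: "f (Inr j) < length E' \<and> esrc E' (f (Inr j)) = q (Inr (esrc Eh j)) \<and>
      etgt E' (f (Inr j)) = q (Inr (etgt Eh j))" if "j < length Eh" for j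
    using that fs[of "Inr j"] ft[of "Inr j"] fJ[of "Inr j"] by auto
  have conn1: "(q (Inl x), q (Inl y)) \<in> (adj (esrc E') (etgt E') {..<length E'})\<^sup>*" if "x \<in> V" "y \<in> V" for x y
    by (rule adj_rtrancl_image[where s = "esrc E" and t = "etgt E" and Y = ?J and f = "\<lambda>j. f (Inl j)"
          and p = "\<lambda>x. q (Inl x)"])
       (use gb that fL in \<open>auto simp: birooted_def\<close>)
  have conn2: "(q (Inr x), q (Inr y)) \<in> (adj (esrc E') (etgt E') {..<length E'})\<^sup>*" if "x \<in> Vh" "y \<in> Vh" for x y
    by (rule adj_rtrancl_image[where s = "esrc Eh" and t = "etgt Eh" and Y = ?Jh and f = "\<lambda>j. f (Inr j)"
          and p = "\<lambda>x. q (Inr x)"])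
       (use hb that fR in \<open>auto simp: birooted_def\<close>)
  have conn0: "(q (Inl i), q u) \<in> (adj (esrc E') (etgt E') {..<length E'})\<^sup>*" if "u \<in> ?U" for u
    using that conn1[OF io(1)] conn2[OF ioh(2)] q1 by auto
  have "(q u, q w) \<in> (adj (esrc E') (etgt E') {..<length E'})\<^sup>*" if "u \<in> ?U" "w \<in> ?U" for u w
    using adj_rtrancl_sym[OF conn0[OF that(1)]] conn0[OF that(2)] by (rule rtrancl_trans)
  moreover have "esrc E' ` {..<length E'} \<subseteq> q ` ?U" "etgt E' ` {..<length E'} \<subseteq> q ` ?U"
  proof -
    have "{..<length E'} = f ` (?J <+> ?Jh)" using f by (simp add: bij_betw_def)
    then show "esrc E' ` {..<length E'} \<subseteq> q ` ?U" "etgt E' ` {..<length E'} \<subseteq> q ` ?U"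
      using fs ft srcU by (simp_all only: image_image image_subset_iff) blast+
  qed
  moreover have "finite ?U" "?U \<noteq> {}" using gb hb by (auto simp: birooted_def)
  ultimately have cE': "connected_graph (q ` ?U) E'" by (auto simp: connected_graph_iff)

  have "quotients V i o' = {R. equiv ?U R \<and> (\<forall>x\<in>?U. \<forall>y\<in>?U. q x = q y \<longrightarrow> (x, y) \<in> R)}"
  proof (rule set_eqI, rule iffI)
    fix R assume "R \<in> quotients V i o'"
    then have R: "equiv ?U R" "(Inl i, Inr oh) \<in> R" "(Inl o', Inr ih) \<in> R" by (auto simp: quotients_def)
    note RD = equivD[OF R(1)]
    \<comment> \<open>Decodes parity: even numbers stand for vertices of the first factor, odd ones
      for the second. Every vertex turns out to be \<open>R\<close>-related to the decoding of its
      image under \<open>q\<close>, so \<open>q\<close> identifies no more than \<open>R\<close>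
      does, coinciding roots included.\<close>
    define \<rho> where "\<rho> v = (if even v then Inl (v div 2) else Inr (v div 2))" for v :: nat
    have \<rho>: "\<rho> (2 * v) = Inl v" "\<rho> (Suc (2 * v)) = Inr v" for v by (simp_all add: \<rho>_def)
    have \<rho>f2: "(Inr v, \<rho> (f2 v)) \<in> R" if "v \<in> Vh" for v
      using that RD(1)[of "Inr v"] RD(2)[OF R(2)] by (auto simp: f2_def \<rho>)
    have \<rho>d: "(Inl v, \<rho> (d (2 * v))) \<in> R" if "v \<in> V" for v
      using that RD(1)[of "Inl v"] RD(3)[OF R(3) \<rho>f2[OF ioh(1)]] by (auto simp: d_def \<rho>)
    have \<rho>q: "(u, \<rho> (q u)) \<in> R" if "u \<in> ?U" for u
      using that
    proof
      fix v assume "v \<in> V" "u = Inl v"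
      then show ?thesis using \<rho>d by (simp add: q_simps)
    next
      fix v assume v: "v \<in> Vh" "u = Inr v"
      show ?thesis
      proof (cases "v = oh")
        case True
        then show ?thesis using RD(3)[OF RD(2)[OF R(2)] \<rho>d[OF io(1)]] v by (simp add: q_simps f2_def)
      next
        case False
        then have "odd (f2 v)" by (simp add: f2_def)
        then have "d (f2 v) = f2 v" by (auto simp: d_def)
        then show ?thesis using \<rho>f2 v by (simp add: q_simps)
      qed
    qed
    have "(x, y) \<in> R" if "x \<in> ?U" "y \<in> ?U" "q x = q y" for x y
      using RD(3)[OF \<rho>q[OF that(1)]] RD(2)[OF \<rho>q[OF that(2)]] that(3) by simp
    then show "R \<in> {R. equiv ?U R \<and> (\<forall>x\<in>?U. \<forall>y\<in>?U. q x = q y \<longrightarrow> (x, y) \<in> R)}" using R(1) by blast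
  next
    fix R assume "R \<in> {R. equiv ?U R \<and> (\<forall>x\<in>?U. \<forall>y\<in>?U. q x = q y \<longrightarrow> (x, y) \<in> R)}"
    then show "R \<in> quotients V i o'" unfolding quotients_def using q1 q2 io ioh by blast
  qed
  note quot = this
  have "psi_mon \<phi> (gmon_mult (V, E, i, o') (Vh, Eh, ih, oh)) = tau \<phi> (q ` ?U) E'"
    by (simp add: psi_mon_def V' E'_def)
  also have "\<dots> = (\<Sum>R'\<in>{R'. equiv (q ` ?U) R'}.
      weight ?\<kappa> (\<lambda>e. R' `` {esrc E' e}) (\<lambda>e. R' `` {etgt E' e}) (elab E') {..<length E'})"
    by (rule tau_eq_sum_equiv[OF \<kappa> cE'])
  also have "\<dots> = (\<Sum>R\<in>quotients V i o'. weight ?\<kappa> (\<lambda>e. (map_prod q q ` R) `` {esrc E' e})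
      (\<lambda>e. (map_prod q q ` R) `` {etgt E' e}) (elab E') {..<length E'})"
    unfolding quot by (rule sum_equiv_image)
  also have "\<dots> = (\<Sum>R\<in>quotients V i o'. wt ?J (esrc E) (etgt E) (elab E) R)"
  proof (rule sum.cong[OF refl])
    fix R assume "R \<in> quotients V i o'"
    then have R: "equiv ?U R" and K: "\<And>x y. x \<in> ?U \<Longrightarrow> y \<in> ?U \<Longrightarrow> q x = q y \<Longrightarrow> (x, y) \<in> R"
      unfolding quot by blast+
    note RD = equivD[OF R]
    let ?R' = "map_prod q q ` R"
    have cls: "?R' `` {q x} = q ` (R `` {x})" if x: "x \<in> ?U" for x
    proof (intro equalityI subsetI)
      fix w assume "w \<in> ?R' `` {q x}"
      then obtain a b where ab: "(a, b) \<in> R" "q a = q x" "w = q b" by auto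
      then have "(x, a) \<in> R" using K[OF x RD(4)[OF ab(1)]] by simp
      then show "w \<in> q ` (R `` {x})" using RD(3)[OF _ ab(1)] ab(3) by blast
    qed force
    show "weight ?\<kappa> (\<lambda>e. ?R' `` {esrc E' e}) (\<lambda>e. ?R' `` {etgt E' e}) (elab E') {..<length E'} =
        wt ?J (esrc E) (etgt E) (elab E) R"
      unfolding wt_def
    proof (rule weight_cong_kernel[OF \<kappa> f, where X = ?U and a = "map_sum (esrc E) (esrc Eh)"
          and b = "map_sum (etgt E) (etgt Eh)" and p = "\<lambda>u. R `` {u}" and p' = "\<lambda>u. ?R' `` {q u}"])
      fix x y assume xy: "x \<in> ?U" "y \<in> ?U"
      show "(R `` {x} = R `` {y}) \<longleftrightarrow> (?R' `` {q x} = ?R' `` {q y})"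
      proof
        assume "R `` {x} = R `` {y}"
        then show "?R' `` {q x} = ?R' `` {q y}" using cls xy by simp
      next
        assume "?R' `` {q x} = ?R' `` {q y}"
        moreover have "q x \<in> ?R' `` {q x}" using cls[OF xy(1)] RD(1)[OF xy(1)] by blast
        ultimately have "q x \<in> q ` (R `` {y})" using cls[OF xy(2)] by simp
        then obtain b where b: "(y, b) \<in> R" "q x = q b" by blast
        then have "(x, b) \<in> R" using K[OF xy(1) RD(5)[OF b(1)]] by simp
        then have "(x, y) \<in> R" using RD(3)[OF _ RD(2)[OF b(1)]] by simp
        then show "R `` {x} = R `` {y}" using eq_equiv_class_iff[OF R xy] by simp
      qed
    qed (use srcU fs ft fl in auto)
  qed
  also have "\<dots> = total V ?J (esrc E) (etgt E) (elab E) i o'" by (simp add: total_def)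
  finally show ?thesis .
qed

section \<open>Reduction to trees\<close>

text \<open>The locale fixes the host; here it becomes an argument, so that one statement can range
  over all test monomials.\<close>

definition host_total where
  "host_total \<kappa> h V J s t l i o' = (case h of (Vh, Eh, ih, oh) \<Rightarrow>
     host.total \<kappa> Vh {..<length Eh} (esrc Eh) (etgt Eh) (elab Eh) ih oh V J s t l i o')"

definition host_inj_total where
  "host_inj_total \<kappa> h V J s t l i o' = (case h of (Vh, Eh, ih, oh) \<Rightarrow>
     host.inj_total \<kappa> Vh {..<length Eh} (esrc Eh) (etgt Eh) (elab Eh) ih oh V J s t l i o')"

text \<open>The quantifier order is the point: one tree polynomial serves all test monomials
  \<open>h\<close>. Such functionals are closed under linear combinations, which is all that the
  induction uses to assemble them.\<close>

definition tree_represented :: "('a::ring_1 \<Rightarrow> complex) \<Rightarrow> ('a gmon \<Rightarrow> complex) \<Rightarrow> bool" where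
  "tree_represented \<phi> F \<longleftrightarrow> (\<exists>T. is_tree_gpoly T \<and>
     (\<forall>h. is_gmon h \<longrightarrow> F h = (\<Sum>(c, x)\<leftarrow>T. c * psi_mon \<phi> (gmon_mult x h))))"

lemma tree_represented_cong:
  assumes "tree_represented \<phi> F" "\<And>h. is_gmon h \<Longrightarrow> G h = F h"
  shows "tree_represented \<phi> G"
  using assms unfolding tree_represented_def by fastforce

lemma tree_represented_zero: "tree_represented \<phi> (\<lambda>h. 0)"
  unfolding tree_represented_def by (intro exI[of _ "[]"]) (simp add: is_tree_gpoly_def)

lemma tree_represented_add:
  assumes "tree_represented \<phi> F" "tree_represented \<phi> G"
  shows "tree_represented \<phi> (\<lambda>h. F h + G h)"
proof -
  obtain T T' where "is_tree_gpoly T" "is_tree_gpoly T'"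
    "\<And>h. is_gmon h \<Longrightarrow> F h = (\<Sum>(c, x)\<leftarrow>T. c * psi_mon \<phi> (gmon_mult x h))"
    "\<And>h. is_gmon h \<Longrightarrow> G h = (\<Sum>(c, x)\<leftarrow>T'. c * psi_mon \<phi> (gmon_mult x h))"
    using assms unfolding tree_represented_def by blast
  then show ?thesis
    unfolding tree_represented_def by (intro exI[of _ "T @ T'"]) (auto simp: is_tree_gpoly_def)
qed

lemma tree_represented_scale:
  assumes "tree_represented \<phi> F"
  shows "tree_represented \<phi> (\<lambda>h. a * F h)"
proof -
  obtain T where T: "is_tree_gpoly T"
    "\<And>h. is_gmon h \<Longrightarrow> F h = (\<Sum>(c, x)\<leftarrow>T. c * psi_mon \<phi> (gmon_mult x h))"
    using assms unfolding tree_represented_def by blast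
  have "a * (\<Sum>(c, x)\<leftarrow>T. c * psi_mon \<phi> (gmon_mult x h)) =
      (\<Sum>(c, x)\<leftarrow>map (\<lambda>(c, x). (a * c, x)) T. c * psi_mon \<phi> (gmon_mult x h))" for h
    by (induction T) (auto simp: algebra_simps)
  moreover have "is_tree_gpoly (map (\<lambda>(c, x). (a * c, x)) T)"
    using T(1) unfolding is_tree_gpoly_def by auto
  ultimately show ?thesis
    unfolding tree_represented_def using T(2) by (intro exI[of _ "map (\<lambda>(c, x). (a * c, x)) T"]) simp
qed

lemma tree_represented_sum:
  assumes "finite A" "\<And>x. x \<in> A \<Longrightarrow> tree_represented \<phi> (F x)"
  shows "tree_represented \<phi> (\<lambda>h. \<Sum>x\<in>A. F x h)"
  using assms by (induction A rule: finite_induct) (simp_all add: tree_represented_zero tree_represented_add)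

lemma host_gmon:
  assumes "cyclic_invariant \<kappa>" "is_gmon (Vh, Eh, ih, oh)"
  shows "host \<kappa> Vh {..<length Eh} (esrc Eh) (etgt Eh) ih oh"
  using assms by (simp add: host_def is_gmon_iff_birooted)

context host
begin

lemma wt_cong:
  assumes f: "bij_betw f J J'"
    and st: "\<And>e. e \<in> J \<Longrightarrow> s' (f e) = s e" "\<And>e. e \<in> J \<Longrightarrow> t' (f e) = t e" "\<And>e. e \<in> J \<Longrightarrow> l' (f e) = l e"
  shows "wt J' s' t' l' R = wt J s t l R"
  unfolding wt_def
proof (rule weight_transport[OF cyclic, where f = "map_sum f id" and m = id])
  have "map_sum f id ` (J <+> Jh) = J' <+> Jh"
    using f by (auto simp: bij_betw_def Plus_def image_Un image_image)
  moreover have "inj_on (map_sum f id) (J <+> Jh)"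
  proof (rule inj_onI)
    fix x y assume "x \<in> J <+> Jh" "y \<in> J <+> Jh" "map_sum f id x = map_sum f id y"
    then show "x = y" using f by (cases x; cases y) (auto simp: bij_betw_def dest: inj_onD)
  qed
  ultimately show "bij_betw (map_sum f id) (J <+> Jh) (J' <+> Jh)" by (simp add: bij_betw_def)
qed (use st in auto)

end

lemma host_total_cong:
  assumes "cyclic_invariant \<kappa>" "is_gmon h" "bij_betw f J J'"
    and "\<And>e. e \<in> J \<Longrightarrow> s' (f e) = s e" "\<And>e. e \<in> J \<Longrightarrow> t' (f e) = t e" "\<And>e. e \<in> J \<Longrightarrow> l' (f e) = l e"
  shows "host_total \<kappa> h V J' s' t' l' i o' = host_total \<kappa> h V J s t l i o'"
proof -
  obtain Vh Eh ih oh where h: "h = (Vh, Eh, ih, oh)" by (cases h) auto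
  interpret host \<kappa> Vh "{..<length Eh}" "esrc Eh" "etgt Eh" "elab Eh" ih oh
    using host_gmon assms(1,2) h by blast
  have "wt J' s' t' l' R = wt J s t l R" for R
    by (rule wt_cong[where f = f]) (use assms(3-6) in auto)
  then show ?thesis unfolding host_total_def h prod.case total_def by simp
qed

lemma host_inj_total_cong:
  assumes "cyclic_invariant \<kappa>" "is_gmon h"
    and "\<And>e. e \<in> J \<Longrightarrow> s' e = s e" "\<And>e. e \<in> J \<Longrightarrow> t' e = t e"
  shows "host_inj_total \<kappa> h V J s' t' l i o' = host_inj_total \<kappa> h V J s t l i o'"
proof -
  obtain Vh Eh ih oh where h: "h = (Vh, Eh, ih, oh)" by (cases h) auto
  interpret host \<kappa> Vh "{..<length Eh}" "esrc Eh" "etgt Eh" "elab Eh" ih oh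
    using host_gmon assms(1,2) h by blast
  have "wt J s' t' l R = wt J s t l R" for R
    by (rule wt_cong[where f = id]) (use assms(3,4) in auto)
  then show ?thesis unfolding host_inj_total_def h prod.case inj_total_def by simp
qed

lemma host_total_eq_sum:
  assumes "cyclic_invariant \<kappa>" "is_gmon h" "birooted V J s t i o'"
  shows "host_total \<kappa> h V J s t l i o' = (\<Sum>\<sigma>\<in>{\<sigma>. equiv V \<sigma>}.
     host_inj_total \<kappa> h (rep \<sigma> ` V) J (rep \<sigma> \<circ> s) (rep \<sigma> \<circ> t) l (rep \<sigma> i) (rep \<sigma> o'))"
proof -
  obtain Vh Eh ih oh where h: "h = (Vh, Eh, ih, oh)" by (cases h) auto
  interpret host \<kappa> Vh "{..<length Eh}" "esrc Eh" "etgt Eh" "elab Eh" ih oh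
    using host_gmon assms(1,2) h by blast
  show ?thesis
    unfolding host_total_def host_inj_total_def h prod.case by (rule total_eq_sum_inj_total[OF assms(3)])
qed

lemma host_inj_total_peel:
  assumes "cyclic_invariant \<kappa>" "is_gmon h" "birooted V J s t i o'" "cyc s t J es vs"
  defines "Y \<equiv> J - set es"
  defines "V1 \<equiv> component V Y s t i" and "J1 \<equiv> component_edges V Y s t i"
  shows "host_inj_total \<kappa> h V J s t l i o' =
    (if o' \<in> V1 \<and> separated s t Y (set vs) \<and> (\<exists>es'. denum s t (set es) es')
     then pad_weight \<kappa> s t l (set es) * weight \<kappa> s t l (Y - J1) * host_inj_total \<kappa> h V1 J1 s t l i o'
     else 0)"
proof -
  obtain Vh Eh ih oh where h: "h = (Vh, Eh, ih, oh)" by (cases h) auto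
  interpret host \<kappa> Vh "{..<length Eh}" "esrc Eh" "etgt Eh" "elab Eh" ih oh
    using host_gmon assms(1,2) h by blast
  show ?thesis
    unfolding host_inj_total_def h prod.case Y_def V1_def J1_def by (rule inj_total_peel[OF assms(3,4)])
qed

text \<open>Listing the edge set in increasing order turns the graph into a monomial, which is a
  tree as it is connected and acyclic; one term with coefficient 1 represents the
  functional.\<close>

lemma tree_represented_acyclic:
  fixes V J :: "nat set"
  assumes \<kappa>: "cyclic_invariant (free_cumulant \<phi>)" and g: "birooted V J s t i o'"
    and acyclic: "\<nexists>es vs. cyc s t J es vs"
  shows "tree_represented \<phi> (\<lambda>h. host_total (free_cumulant \<phi>) h V J s t l i o')"
proof -
  have fin: "finite J" using g by (simp add: birooted_def)
  define js where "js = sorted_list_of_set J"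
  define E where "E = map (\<lambda>j. (s j, t j, l j)) js"
  have js: "set js = J" "distinct js" using fin by (simp_all add: js_def)
  have len: "length E = length js" by (simp add: E_def)
  have f: "bij_betw (\<lambda>k. js ! k) {..<length E} J"
    using bij_betw_nth[OF js(2), of "{..<length js}" J] js(1) by (simp add: len)
  have E: "esrc E k = s (js ! k)" "etgt E k = t (js ! k)" "elab E k = l (js ! k)" if "k < length E" for k
    using that by (simp_all add: E_def esrc_def etgt_def elab_def)
  have imgs: "esrc E ` {..<length E} = s ` J" "etgt E ` {..<length E} = t ` J"
  proof -
    have "J = (\<lambda>k. js ! k) ` {..<length E}" using f by (simp add: bij_betw_def)
    then show "esrc E ` {..<length E} = s ` J" "etgt E ` {..<length E} = t ` J"
      using E by (auto simp: image_image intro!: image_cong)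
  qed
  have "adj s t J = adj (esrc E) (etgt E) {..<length E}"
  proof -
    have "J = (\<lambda>k. js ! k) ` {..<length E}" using f by (simp add: bij_betw_def)
    then have "adj s t J = (\<lambda>k. (s (js ! k), t (js ! k))) ` {..<length E} \<union> (\<lambda>k. (t (js ! k), s (js ! k))) ` {..<length E}"
      by (simp add: adj_def image_image)
    also have "\<dots> = adj (esrc E) (etgt E) {..<length E}"
      unfolding adj_def using E by (intro arg_cong2[where f = "(\<union>)"] image_cong) auto
    finally show ?thesis .
  qed
  then have gE: "birooted V {..<length E} (esrc E) (etgt E) i o'"
    using g by (simp add: birooted_def imgs)
  then have mon: "is_gmon (V, E, i, o')" by (simp add: is_gmon_iff_birooted)
  have "\<not> ucycle E es vs" for es vs
  proof
    assume "ucycle E es vs"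
    then have "cyc (esrc E) (etgt E) {..<length E} es vs" by (simp add: ucycle_iff_cyc)
    then have "cyc s t J (map (\<lambda>k. js ! k) es) (map id vs)"
      by (rule cyc_transport[OF _ f]) (simp_all add: E)
    then show False using acyclic by blast
  qed
  then have tree: "is_tree_gmon (V, E, i, o')" using mon by (simp add: is_tree_gmon_def is_gmon_def)
  have "host_total (free_cumulant \<phi>) h V J s t l i o' = psi_mon \<phi> (gmon_mult (V, E, i, o') h)" if h: "is_gmon h" for h
  proof -
    obtain Vh Eh ih oh where hh: "h = (Vh, Eh, ih, oh)" by (cases h) auto
    have "host_total (free_cumulant \<phi>) h V J s t l i o' =
        host_total (free_cumulant \<phi>) h V {..<length E} (esrc E) (etgt E) (elab E) i o'"
      by (rule host_total_cong[OF \<kappa> h f]) (simp_all add: E)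
    then show ?thesis using psi_mon_gmon_mult[OF \<kappa> mon] h unfolding hh host_total_def by simp
  qed
  then show ?thesis unfolding tree_represented_def using mon tree
    by (intro exI[of _ "[(1, (V, E, i, o'))]"]) (simp add: is_tree_gpoly_def)
qed

text \<open>Peeling a cycle removes edges but perhaps no vertex, while a proper quotient loses
  vertices and keeps all edges; hence the sum as measure. The two cases feed each other, since a
  quotient of a tree may have cycles again.\<close>

lemma tree_represented_host_inj_total:
  fixes V J :: "nat set"
  assumes \<kappa>: "cyclic_invariant (free_cumulant \<phi>)" and "birooted V J s t i o'"
  shows "tree_represented \<phi> (\<lambda>h. host_inj_total (free_cumulant \<phi>) h V J s t l i o')"
  using assms(2)
proof (induction "card V + card J" arbitrary: V J s t i o' rule: less_induct)
  case less
  let ?\<kappa> = "free_cumulant \<phi>"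
  note g = less.prems
  have fin: "finite V" "finite J" using g by (auto simp: birooted_def)
  show ?case
  proof (cases "\<exists>es vs. cyc s t J es vs")
    case True
    then obtain es vs where c: "cyc s t J es vs" by blast
    let ?Y = "J - set es"
    let ?V1 = "component V ?Y s t i" and ?J1 = "component_edges V ?Y s t i"
    \<comment> \<open>The condition of the peeling formula does not mention the host, so the same
      case applies to every \<open>h\<close>.\<close>
    show ?thesis
    proof (cases "o' \<in> ?V1 \<and> separated s t ?Y (set vs) \<and> (\<exists>es'. denum s t (set es) es')")
      case good: True
      have "card ?V1 \<le> card V" using fin(1) by (intro card_mono) (auto simp: component_def)
      moreover have "card ?J1 < card J"
      proof (rule psubset_card_mono[OF fin(2)])
        have "set es \<subseteq> J" "es \<noteq> []" using c by (auto simp: cyc_def)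
        then have "hd es \<in> J" "hd es \<notin> ?J1" by (auto simp: component_edges_def)
        then show "?J1 \<subset> J" by (auto simp: component_edges_def)
      qed
      ultimately have less1: "card ?V1 + card ?J1 < card V + card J" by linarith
      have "birooted ?V1 ?J1 s t i o'" using good by (intro birooted_component[OF g]) auto
      from tree_represented_scale[OF less.hyps[OF less1 this]] show ?thesis
        by (rule tree_represented_cong) (simp only: host_inj_total_peel[OF \<kappa> _ g c] good simp_thms if_True)
    next
      case False
      show ?thesis
        by (rule tree_represented_cong[OF tree_represented_zero])
           (simp only: host_inj_total_peel[OF \<kappa> _ g c] False if_False)
    qed
  next
    case False
    let ?A = "{\<sigma>. equiv V \<sigma>}"
    let ?F = "\<lambda>h \<sigma>. host_inj_total ?\<kappa> h (rep \<sigma> ` V) J (rep \<sigma> \<circ> s) (rep \<sigma> \<circ> t) l (rep \<sigma> i) (rep \<sigma> o')"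
    have finA: "finite ?A" by (rule finite_equivs[OF fin(1)])
    have IdA: "Id_on V \<in> ?A" by (auto simp: equiv_def refl_on_def sym_def trans_def)
    have V: "s e \<in> V" "t e \<in> V" if "e \<in> J" for e using g that by (auto simp: birooted_def)
    have io: "i \<in> V" "o' \<in> V" using g by (auto simp: birooted_def)
    have Id: "?F h (Id_on V) = host_inj_total ?\<kappa> h V J s t l i o'" if h: "is_gmon h" for h
    proof -
      have "rep (Id_on V) ` V = V" using rep_Id_on[of _ V] by force
      then show ?thesis using io
        by (simp add: rep_Id_on) (rule host_inj_total_cong[OF \<kappa> h], simp_all add: rep_Id_on V)
    qed
    have "tree_represented \<phi> (\<lambda>h. ?F h \<sigma>)" if \<sigma>: "\<sigma> \<in> ?A - {Id_on V}" for \<sigma>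
    proof (rule less.hyps)
      show "card (rep \<sigma> ` V) + card J < card V + card J" using card_rep_less[OF fin(1)] \<sigma> by auto
      show "birooted (rep \<sigma> ` V) J (rep \<sigma> \<circ> s) (rep \<sigma> \<circ> t) (rep \<sigma> i) (rep \<sigma> o')"
        using birooted_rep[OF g] \<sigma> by auto
    qed
    then have "tree_represented \<phi> (\<lambda>h. \<Sum>\<sigma>\<in>?A - {Id_on V}. ?F h \<sigma>)"
      using finA by (intro tree_represented_sum) auto
    \<comment> \<open>Only the trivial quotient \<open>Id_on V\<close> fails to lower the measure;
      its term is isolated by solving the sum over all quotients for it.\<close>
    from tree_represented_add[OF tree_represented_acyclic[OF \<kappa> g False, of l] tree_represented_scale[OF this, of "-1"]]
    show ?thesis
    proof (rule tree_represented_cong)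
      fix h :: "'a gmon" assume h: "is_gmon h"
      have "host_total ?\<kappa> h V J s t l i o' = ?F h (Id_on V) + (\<Sum>\<sigma>\<in>?A - {Id_on V}. ?F h \<sigma>)"
        unfolding host_total_eq_sum[OF \<kappa> h g] by (rule sum.remove[OF finA IdA])
      then show "host_inj_total ?\<kappa> h V J s t l i o' =
          host_total ?\<kappa> h V J s t l i o' + - 1 * (\<Sum>\<sigma>\<in>?A - {Id_on V}. ?F h \<sigma>)"
        unfolding Id[OF h] by simp
    qed
  qed
qed

lemma tree_represented_psi_mon:
  assumes \<kappa>: "cyclic_invariant (free_cumulant \<phi>)" and x: "is_gmon x"
  shows "tree_represented \<phi> (\<lambda>h. psi_mon \<phi> (gmon_mult x h))"
proof -
  let ?\<kappa> = "free_cumulant \<phi>"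
  obtain V E i o' where xx: "x = (V, E, i, o')" by (cases x) auto
  let ?J = "{..<length E}"
  have g: "birooted V ?J (esrc E) (etgt E) i o'" using x by (simp add: xx is_gmon_iff_birooted)
  have "tree_represented \<phi> (\<lambda>h. \<Sum>\<sigma>\<in>{\<sigma>. equiv V \<sigma>}. host_inj_total ?\<kappa> h (rep \<sigma> ` V) ?J
      (rep \<sigma> \<circ> esrc E) (rep \<sigma> \<circ> etgt E) (elab E) (rep \<sigma> i) (rep \<sigma> o'))"
    using g birooted_rep[OF g]
    by (intro tree_represented_sum tree_represented_host_inj_total[OF \<kappa>])
       (auto simp: birooted_def intro: finite_equivs)
  then show ?thesis
  proof (rule tree_represented_cong)
    fix h :: "'a gmon" assume h: "is_gmon h"
    obtain Vh Eh ih oh where hh: "h = (Vh, Eh, ih, oh)" by (cases h) auto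
    have "psi_mon \<phi> (gmon_mult x h) = host_total ?\<kappa> h V ?J (esrc E) (etgt E) (elab E) i o'"
      using psi_mon_gmon_mult[OF \<kappa>] x h unfolding xx hh host_total_def by simp
    then show "psi_mon \<phi> (gmon_mult x h) = (\<Sum>\<sigma>\<in>{\<sigma>. equiv V \<sigma>}. host_inj_total ?\<kappa> h (rep \<sigma> ` V) ?J
      (rep \<sigma> \<circ> esrc E) (rep \<sigma> \<circ> etgt E) (elab E) (rep \<sigma> i) (rep \<sigma> o'))"
      unfolding host_total_eq_sum[OF \<kappa> h g] .
  qed
qed

lemma tree_represented_gpoly:
  assumes "cyclic_invariant (free_cumulant \<phi>)" "is_gpoly p"
  shows "tree_represented \<phi> (\<lambda>h. \<Sum>(c, x)\<leftarrow>p. c * psi_mon \<phi> (gmon_mult x h))"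
  using assms(2)
proof (induction p)
  case Nil
  then show ?case by (simp add: tree_represented_zero)
next
  case (Cons cx p)
  obtain c x where cx: "cx = (c, x)" by (cases cx)
  have "is_gmon x" "is_gpoly p" using Cons.prems by (auto simp: cx is_gpoly_def)
  then show ?case
    using tree_represented_add[OF tree_represented_scale[OF tree_represented_psi_mon[OF assms(1)]] Cons.IH]
    by (simp add: cx)
qed

section \<open>Return to graph polynomials and the congruence\<close>

lemma psi_append: "psi \<phi> (p @ q) = psi \<phi> p + psi \<phi> q"
  by (simp add: psi_def)

text \<open>With the test monomials in the outer sum, the congruence can be checked for one
  \<open>h\<close> at a time.\<close>

lemma psi_gp_mult:
  "psi \<phi> (gp_mult p u) = (\<Sum>(d, h)\<leftarrow>u. d * (\<Sum>(c, g)\<leftarrow>p. c * psi_mon \<phi> (gmon_mult g h)))"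
proof (induction p)
  case Nil
  then show ?case by (induction u) (auto simp: gp_mult_def psi_def)
next
  case (Cons cg p)
  obtain c g where cg: "cg = (c, g)" by (cases cg)
  have "psi \<phi> (gp_mult (cg # p) u) =
      psi \<phi> (map (\<lambda>(d, h). (c * d, gmon_mult g h)) u) + psi \<phi> (gp_mult p u)"
    by (simp add: gp_mult_def cg psi_append)
  also have "psi \<phi> (map (\<lambda>(d, h). (c * d, gmon_mult g h)) u) =
      (\<Sum>(d, h)\<leftarrow>u. d * (c * psi_mon \<phi> (gmon_mult g h)))"
    by (induction u) (auto simp: psi_def)
  also have "\<dots> + psi \<phi> (gp_mult p u) =
      (\<Sum>(d, h)\<leftarrow>u. d * (\<Sum>(c, g)\<leftarrow>cg # p. c * psi_mon \<phi> (gmon_mult g h)))"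
    unfolding Cons.IH by (induction u) (auto simp: cg distrib_left)
  finally show ?case .
qed

lemma sum_list_gp_diff:
  fixes F :: "'a gmon \<Rightarrow> complex"
  shows "(\<Sum>(c, g)\<leftarrow>gp_diff p q. c * F g) = (\<Sum>(c, g)\<leftarrow>p. c * F g) - (\<Sum>(c, g)\<leftarrow>q. c * F g)"
proof -
  have "(\<Sum>(c, g)\<leftarrow>map (\<lambda>(c, g). (- c, g)) q. c * F g) = - (\<Sum>(c, g)\<leftarrow>q. c * F g)"
    by (induction q) auto
  then show ?thesis by (simp add: gp_diff_def)
qed

theorem theorem2p22:
  fixes sm :: "complex \<Rightarrow> 'a::ring_1 \<Rightarrow> 'a" and \<phi> :: "'a \<Rightarrow> complex" and t :: "'a gpoly"
  assumes "complex_algebra sm"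
    and "tracial_state sm \<phi>"
    and "is_gpoly t"
  shows "\<exists>T. is_tree_gpoly T \<and> cong_psi \<phi> T t"
proof -
  \<comment> \<open>Traciality enters here: it makes the cumulant of a pad blind to the edge at
    which the enumeration starts.\<close>
  have "cyclic_invariant (free_cumulant \<phi>)"
    using assms(2) free_cumulant_rotate[of \<phi>] by (simp add: cyclic_invariant_def tracial_state_def)
  from tree_represented_gpoly[OF this assms(3)] obtain T where T: "is_tree_gpoly T"
    and eq: "\<And>h. is_gmon h \<Longrightarrow> (\<Sum>(c, x)\<leftarrow>t. c * psi_mon \<phi> (gmon_mult x h)) =
      (\<Sum>(c, x)\<leftarrow>T. c * psi_mon \<phi> (gmon_mult x h))"
    unfolding tree_represented_def by blast
  have "psi \<phi> (gp_mult (gp_diff T t) u) = 0" if "is_gpoly u" for u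
    using that unfolding psi_gp_mult sum_list_gp_diff
    by (induction u) (auto simp: is_gpoly_def eq)
  then show ?thesis using T unfolding cong_psi_def by blast
qed

end
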